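(* There is an absolute constant $c_0>0$ such that the following holds. Let $t,B\geq 1$ be integers, let $\alpha\in(0,1)$, and suppose that the ensemble $T_1,\dots,T_t$ can be represented as $T_i(x)=\varphi(x;\mathcal{D},\xi_i)$ with $\xi_1,\dots,\xi_t$ i.i.d. and independent of $\mathcal{D}$ (assumption A1), and that $k\geq 2$ is an integer such that $\beta_{3k}(\mathcal{D})<\infty$ (assumption A2). Let $\widehat q_{1-\alpha}(t)$ denote the empirical $(1-\alpha)$-quantile of $B$ bootstrap samples of the form $\mathrm{MSE}_t^*-\mathrm{MSE}_t$, and define $$\delta_{t,k,B}(\mathcal{D}) := \frac{k^2}{\sqrt{t}}\Big(\frac{\beta_{3k}(\mathcal{D})}{\sigma(\mathcal{D})}\Big)^3 + e^{-k/2} + \sqrt{\frac{\log(B)}{B}}.$$ Then $$\mathbb{P}\Big(\mathrm{MSE}_t-\mathrm{mse}_{\infty}\leq \widehat q_{1-\alpha}(t)\,\Big|\,\mathcal{D}\Big)\ \geq\ 1-\alpha-c_0\,\delta_{t,k,B}(\mathcal{D}).$$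
   Context: Setting. $\mathcal{D}=\{(X_j,Y_j)\}_{j=1}^n$ is a training set in $\mathcal{X}\times\mathbb{R}$, where $\mathcal{X}$ is an arbitrary space; everything is conditional on $\mathcal{D}$. The randomized ensemble consists of regression functions $T_1,\dots,T_t:\mathcal{X}\to\mathbb{R}$ of the form $T_i(x)=\varphi(x;\mathcal{D},\xi_i)$, where $\xi_1,\dots,\xi_t$ are i.i.d. randomizing parameters generated independently of $\mathcal{D}$, and $\varphi$ is a deterministic function not depending on $n$ or $t$. In particular $T_1,\dots,T_t$ are conditionally i.i.d. given $\mathcal{D}$. Write $\boldsymbol\xi_t=(\xi_1,\dots,\xi_t)$ and $\bar T_t=\frac1t\sum_{i=1}^tT_i$. Let $\nu$ be the distribution of a test point $(X,Y)\in\mathcal{X}\times\mathbb{R}$ drawn independently of $\mathcal{D}$ and $\boldsymbol\xi_t$. For $f:\mathcal{X}\to\mathbb{R}$ let $\psi(f)=\int_{\mathcal{X}\times\mathbb{R}}(y-f(x))^2\,d\nu(x,y)$. Define $\mathrm{MSE}_t=\psi(\bar T_t)$ (a random variable depending on $\boldsymbol\xi_t$ and $\mathcal{D}$), and let $\mathrm{mse}_\infty$ be its limit as $t\to\infty$ with $\mathcal{D}$ fixed, which equals $\psi(\vartheta)$, where $\vartheta(x)=\mathbb{E}[T_1(x)\,|\,\mathcal{D}]$. Bootstrap. Given $(\mathcal{D},\boldsymbol\xi_t)$, sample $T_1^*,\dots,T_t^*$ with replacement from $T_1,\dots,T_t$, set $\bar T_t^*=\frac1t\sum_{i=1}^tT_i^*$,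 and define the bootstrap sample $\mathrm{MSE}_t^*-\mathrm{MSE}_t:=\psi(\bar T_t^* )-\psi(\bar T_t)$. The $B$ bootstrap samples are independent copies of this, conditionally on $(\mathcal{D},\boldsymbol\xi_t)$. The empirical $(1-\alpha)$-quantile is $\inf\{s\in\mathbb{R}: \widehat G(s)\geq 1-\alpha\}$, where $\widehat G$ is the empirical distribution function of the $B$ samples. Moments. For functions $g,h$ on $\mathcal{X}\times\mathbb{R}$, $\langle g,h\rangle=\int gh\,d\nu$ and $\|g\|_{L_2}=\sqrt{\langle g,g\rangle}$; a function of $x$ alone is viewed as a function of $(x,y)$, and $y$ denotes the function $(x,y)\mapsto y$. Let $\zeta=2\langle\vartheta-y,T_1-\vartheta\rangle$ and $\sigma(\mathcal{D})=\sqrt{\mathrm{var}(\zeta|\mathcal{D})}$. Expressions involving $1/\sigma(\mathcal{D})$ are understood as $\infty$ if $\sigma(\mathcal{D})=0$. For each positive integer $k$, $$\beta_k(\mathcal{D})=\max\Big\{\big(\mathbb{E}[\|T_1-y\|_{L_2}^{2k}|\mathcal{D}]\big)^{1/k},\ \big(\mathbb{E}[\|T_1-\vartheta\|_{L_2}^{2k}|\mathcal{D}]\big)^{1/k}\Big\}.$$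
   Formalization: The formal theorem takes B ≥ 2 instead of B ≥ 1: at B = 1 the term √(log(B)/B) vanishes, a single bootstrap sample gives coverage near 1/2, and the printed bound fails for small α; the constant c₀ is stated for each choice of underlying sets. *)

theory Defs
  imports "HOL-Probability.Probability"
begin

text \<open>
  Conventions. The members of the ensemble and of the bootstrap samples are indexed from 0, so
  \<open>T\<^sub>1, \<dots>, T\<^sub>t\<close> are the functions with index in \<open>{..<t}\<close>. A training set is a function
  \<open>d :: nat \<Rightarrow> 'x \<times> real\<close> with the points \<open>d 0, \<dots>, d (n - 1)\<close>. The regression function with
  training set \<open>d\<close> and randomizing parameter \<open>r\<close> is \<open>\<phi> d r\<close>.
\<close>

definition psi :: "('x \<times> real) measure \<Rightarrow> ('x \<Rightarrow> real) \<Rightarrow> real" where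
  "psi \<nu> f = (\<integral>z. (snd z - f (fst z))\<^sup>2 \<partial>\<nu>)"

definition ens_avg :: "nat \<Rightarrow> (nat \<Rightarrow> 'x \<Rightarrow> real) \<Rightarrow> 'x \<Rightarrow> real" where
  "ens_avg t T x = (\<Sum>i<t. T i x) / real t"

definition MSE :: "('x \<times> real) measure \<Rightarrow> nat \<Rightarrow> (nat \<Rightarrow> 'x \<Rightarrow> real) \<Rightarrow> real" where
  "MSE \<nu> t T = psi \<nu> (ens_avg t T)"


subsection \<open>Moments\<close>

text \<open>
  The conditional expectation given \<open>\<D> = d\<close> of a function of \<open>(\<D>, \<xi>\<^sub>1)\<close> is the integral over the law
  \<open>P\<close> of \<open>\<xi>\<^sub>1\<close> with \<open>d\<close> held fixed, because \<open>\<xi>\<^sub>1\<close> and \<open>\<D>\<close> are independent.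
\<close>

definition theta :: "'r measure \<Rightarrow> ('d \<Rightarrow> 'r \<Rightarrow> 'x \<Rightarrow> real) \<Rightarrow> 'd \<Rightarrow> 'x \<Rightarrow> real" where
  "theta P \<phi> d x = (\<integral>r. \<phi> d r x \<partial>P)"

text \<open>The limit of \<open>MSE\<^sub>t\<close> as \<open>t \<rightarrow> \<infinity>\<close> with \<open>\<D> = d\<close> fixed, given by its value \<open>\<psi>(\<vartheta>)\<close>.\<close>

definition mse_inf ::
  "('x \<times> real) measure \<Rightarrow> 'r measure \<Rightarrow> ('d \<Rightarrow> 'r \<Rightarrow> 'x \<Rightarrow> real) \<Rightarrow> 'd \<Rightarrow> real" where
  "mse_inf \<nu> P \<phi> d = psi \<nu> (theta P \<phi> d)"

definition inner_L2 :: "'z measure \<Rightarrow> ('z \<Rightarrow> real) \<Rightarrow> ('z \<Rightarrow> real) \<Rightarrow> real" where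
  "inner_L2 \<nu> g h = (\<integral>z. g z * h z \<partial>\<nu>)"

definition zeta ::
  "('x \<times> real) measure \<Rightarrow> 'r measure \<Rightarrow> ('d \<Rightarrow> 'r \<Rightarrow> 'x \<Rightarrow> real) \<Rightarrow> 'd \<Rightarrow> 'r \<Rightarrow> real" where
  "zeta \<nu> P \<phi> d r =
     2 * inner_L2 \<nu> (\<lambda>(x, y). theta P \<phi> d x - y) (\<lambda>(x, y). \<phi> d r x - theta P \<phi> d x)"

definition sigma_D ::
  "('x \<times> real) measure \<Rightarrow> 'r measure \<Rightarrow> ('d \<Rightarrow> 'r \<Rightarrow> 'x \<Rightarrow> real) \<Rightarrow> 'd \<Rightarrow> real" where
  "sigma_D \<nu> P \<phi> d =
     sqrt (\<integral>r. (zeta \<nu> P \<phi> d r - (\<integral>r'. zeta \<nu> P \<phi> d r' \<partial>P))\<^sup>2 \<partial>P)"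

definition ennroot :: "nat \<Rightarrow> ennreal \<Rightarrow> ennreal" where
  "ennroot k a = (if a = \<infinity> then \<infinity> else ennreal (root k (enn2real a)))"

text \<open>Extended-valued, so that \<open>\<beta>\<^sub>k(d) < \<infinity>\<close> is a genuine condition.\<close>

definition norm_L2 :: "'z measure \<Rightarrow> ('z \<Rightarrow> real) \<Rightarrow> ennreal" where
  "norm_L2 \<nu> g = ennroot 2 (\<integral>\<^sup>+z. ennreal (g z * g z) \<partial>\<nu>)"

definition beta ::
  "('x \<times> real) measure \<Rightarrow> 'r measure \<Rightarrow> ('d \<Rightarrow> 'r \<Rightarrow> 'x \<Rightarrow> real) \<Rightarrow> nat \<Rightarrow> 'd \<Rightarrow> ennreal" where
  "beta \<nu> P \<phi> k d = max
     (ennroot k (\<integral>\<^sup>+r. norm_L2 \<nu> (\<lambda>(x, y). \<phi> d r x - y) ^ (2 * k) \<partial>P))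
     (ennroot k (\<integral>\<^sup>+r. norm_L2 \<nu> (\<lambda>(x, y). \<phi> d r x - theta P \<phi> d x) ^ (2 * k) \<partial>P))"

text \<open>
  The case \<open>\<sigma>(d) = 0\<close> is separate since division by zero in \<open>ereal\<close> does not give \<open>\<infinity>\<close> when
  the numerator \<open>\<beta>(d)\<close> is 0 as well.
\<close>

definition delta ::
  "('x \<times> real) measure \<Rightarrow> 'r measure \<Rightarrow> ('d \<Rightarrow> 'r \<Rightarrow> 'x \<Rightarrow> real) \<Rightarrow> nat \<Rightarrow> nat \<Rightarrow> nat \<Rightarrow> 'd \<Rightarrow> ereal"
where
  "delta \<nu> P \<phi> t k B d =
     (if sigma_D \<nu> P \<phi> d = 0 then \<infinity>
      else ereal ((real k)\<^sup>2 / sqrt (real t)) *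
             (enn2ereal (beta \<nu> P \<phi> (3 * k) d) / ereal (sigma_D \<nu> P \<phi> d)) ^ 3)
     + ereal (exp (- (real k / 2))) + ereal (sqrt (ln (real B) / real B))"


subsection \<open>Bootstrap samples and their empirical quantile\<close>

text \<open>
  A resample of size \<open>t\<close> with replacement is given by indices \<open>J 0, \<dots>, J (t - 1)\<close> in \<open>{..<t}\<close>.
\<close>

definition boot_sample ::
  "('x \<times> real) measure \<Rightarrow> nat \<Rightarrow> (nat \<Rightarrow> 'x \<Rightarrow> real) \<Rightarrow> (nat \<Rightarrow> nat) \<Rightarrow> real" where
  "boot_sample \<nu> t T J = psi \<nu> (ens_avg t (\<lambda>i. T (J i))) - psi \<nu> (ens_avg t T)"

definition emp_cdf :: "nat \<Rightarrow> (nat \<Rightarrow> real) \<Rightarrow> real \<Rightarrow> real" where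
  "emp_cdf B G s = real (card {b \<in> {..<B}. G b \<le> s}) / real B"

definition emp_quantile :: "nat \<Rightarrow> (nat \<Rightarrow> real) \<Rightarrow> real \<Rightarrow> real" where
  "emp_quantile B G p = Inf {s. emp_cdf B G s \<ge> p}"


subsection \<open>The probabilistic setting\<close>

text \<open>Independence of random variables whose value types differ (\<open>indep_var\<close> needs equal types).\<close>

definition indep_rv ::
  "'w measure \<Rightarrow> 'a measure \<Rightarrow> ('w \<Rightarrow> 'a) \<Rightarrow> 'b measure \<Rightarrow> ('w \<Rightarrow> 'b) \<Rightarrow> bool" where
  "indep_rv M S U S' V \<longleftrightarrow>
     U \<in> measurable M S \<and> V \<in> measurable M S' \<and>
     prob_space.indep_set M
       {U -` A \<inter> space M |A. A \<in> sets S} {V -` A \<inter> space M |A. A \<in> sets S'}"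

abbreviation train_space :: "'x measure \<Rightarrow> nat \<Rightarrow> (nat \<Rightarrow> 'x \<times> real) measure" where
  "train_space MX n \<equiv> PiM {..<n} (\<lambda>_. MX \<Otimes>\<^sub>M borel)"

definition cond_prob_given ::
  "'w measure \<Rightarrow> 'd measure \<Rightarrow> ('w \<Rightarrow> 'd) \<Rightarrow> 'w set \<Rightarrow> 'w \<Rightarrow> real" where
  "cond_prob_given M S D A =
     real_cond_exp M (vimage_algebra (space M) D S) (indicat_real A)"

text \<open>
  \<open>D\<close> is the training set, \<open>\<nu>\<close> the law of the test point, \<open>\<xi> i\<close> are the randomizing parameters
  and \<open>P\<close> is their common law. The test point is independent of \<open>D\<close> and the \<open>\<xi> i\<close> and occurs only
  through \<open>\<nu>\<close>.
\<close>

locale randomized_ensemble = prob_space M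
  for M :: "'w measure" +
  fixes MX :: "'x measure" and \<nu> :: "('x \<times> real) measure"
    and R P :: "'r measure" and n t :: nat
    and \<phi> :: "(nat \<Rightarrow> 'x \<times> real) \<Rightarrow> 'r \<Rightarrow> 'x \<Rightarrow> real"
    and D :: "'w \<Rightarrow> nat \<Rightarrow> 'x \<times> real" and \<xi> :: "nat \<Rightarrow> 'w \<Rightarrow> 'r"
  assumes prob_nu: "prob_space \<nu>" and sets_nu: "sets \<nu> = sets (MX \<Otimes>\<^sub>M borel)"
    and phi_measurable:
      "(\<lambda>(d, r, x). \<phi> d r x) \<in> borel_measurable (train_space MX n \<Otimes>\<^sub>M (R \<Otimes>\<^sub>M MX))"
    and xi_indep: "indep_vars (\<lambda>_. R) \<xi> {..<t}"
    and xi_law: "\<And>i. i < t \<Longrightarrow> distr M R (\<xi> i) = P"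
    and D_xi_indep:
      "indep_rv M (train_space MX n) D (PiM {..<t} (\<lambda>_. R)) (\<lambda>\<omega>. \<lambda>i\<in>{..<t}. \<xi> i \<omega>)"

text \<open>
  \<open>J b i\<close> is the index of the \<open>i\<close>-th function drawn in the \<open>b\<close>-th bootstrap sample. Given
  \<open>(D, \<xi>)\<close>, all these indices are i.i.d. uniform on \<open>{..<t}\<close>.
\<close>

locale bootstrapped_ensemble = randomized_ensemble M MX \<nu> R P n t \<phi> D \<xi>
  for M :: "'w measure" and MX :: "'x measure" and \<nu> and R P :: "'r measure" and n t \<phi> D \<xi> +
  fixes B :: nat and J :: "nat \<Rightarrow> nat \<Rightarrow> 'w \<Rightarrow> nat"
  assumes J_indep:
      "indep_vars (\<lambda>_. count_space {..<t}) (\<lambda>(b, i). J b i) ({..<B} \<times> {..<t})"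
    and J_uniform:
      "\<And>b i. b < B \<Longrightarrow> i < t \<Longrightarrow> distr M (count_space {..<t}) (J b i) = uniform_count_measure {..<t}"
    and J_D_xi_indep:
      "indep_rv M
         (train_space MX n \<Otimes>\<^sub>M PiM {..<t} (\<lambda>_. R)) (\<lambda>\<omega>. (D \<omega>, \<lambda>i\<in>{..<t}. \<xi> i \<omega>))
         (PiM ({..<B} \<times> {..<t}) (\<lambda>_. count_space {..<t}))
         (\<lambda>\<omega>. \<lambda>(b, i)\<in>{..<B} \<times> {..<t}. J b i \<omega>)"

end

theory Submission
  imports Defs
begin

text \<open>
  Fix the training set and put \<open>U\<^sub>i = T\<^sub>i - \<vartheta>\<close> and \<open>a = \<vartheta> - y\<close>. With \<open>u\<close> the average of the \<open>U\<^sub>i\<close>,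
  \<open>MSE\<^sub>t - mse\<^sub>\<infinity> = 2\<langle>a, u\<rangle> + \<parallel>u\<parallel>\<^sup>2\<close>. The linear part is an average of the i.i.d. variables
  \<open>\<zeta>\<^sub>i\<close>, and a bootstrap sample is at least an average of resampled \<open>2\<langle>a + u, U\<^sub>j - u\<rangle>\<close>, because
  its quadratic part is nonnegative. By the Berry--Esseen theorem both linear parts are normal
  up to \<open>O((\<beta>/\<sigma>)\<^sup>3/\<surd>t)\<close>, once moment bounds of order \<open>k\<close> and Markov's inequality have shown that,
  outside an event of probability \<open>O(e\<^sup>-\<^sup>k)\<close>, the quadratic part is \<open>O(k\<^sup>2\<beta>/t)\<close> and the empirical
  variance is close to \<open>\<sigma>\<^sup>2\<close>. Finally \<open>MSE\<^sub>t - mse\<^sub>\<infinity>\<close> exceeds the empirical quantile iff at least the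
  fraction \<open>1 - \<alpha>\<close> of the bootstrap samples lies below it, and given the ensemble the number of
  such samples is binomial, so Hoeffding's inequality at a single point is enough.
\<close>

section \<open>The normal distribution and Stein's equation\<close>

text \<open>The two normal approximations are combined by the probability integral transform. On
  good samples the conditional probability that one bootstrap sample lies below
  \<open>excess\<close> is at most \<open>Phi (sqrt t * zbar / s)\<close> plus an error. As
  \<open>zbar\<close> is itself nearly normal, this random variable is nearly uniform on [0,1], so
  it exceeds 1 - \<alpha> - sqrt(ln B / B) with probability about \<alpha> + sqrt(ln B / B). The
  obstacle is that every error of normal approximation has to become a multiple of the single
  quantity \<eta> = (k^2 / sqrt t) (b / s)^3, where b is an upper bound of the moment. Errors of
  lower degree in b / s are absorbed because Cauchy-Schwarz forces b / s \<ge> 1/8, and a large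
  \<eta> makes the claim trivial. The order 3k of the moment comes from averages of cubes whose k-th
  powers are integrated. Given \<open>D\<close>, the parameters and the resampling indices have a
  fixed product law, so the conditional probability is the mass of a section.\<close>

lemma has_real_derivative_integral_atMost:
  fixes g :: "real \<Rightarrow> real"
  assumes cont: "continuous_on UNIV g" and int: "integrable lborel g"
  shows "((\<lambda>w. \<integral>x. indicator {..w} x * g x \<partial>lborel) has_real_derivative g w) (at w)"
proof -
  \<comment> \<open>Cutting at a point to the left of \<open>w\<close> leaves a constant plus a
    proper integral over a compact interval, to which the fundamental theorem applies.\<close>
  define a where "a = w - 1"
  define c where "c = (\<integral>x. indicator {..a} x * g x \<partial>lborel)"
  have intI: "integrable lborel (\<lambda>x. indicator A x * g x)" if "A \<in> sets borel" for A
    using integrable_mult_indicator[of A lborel g] int that by simp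
  have eq: "(\<integral>x. indicator {..u} x * g x \<partial>lborel) = c + integral {a..u} g" if u: "u \<in> {a..}" for u
  proof -
    have "(\<integral>x. indicator {..u} x * g x \<partial>lborel)
        = (\<integral>x. indicator {..a} x * g x + indicator {a<..u} x * g x \<partial>lborel)"
      using u by (intro Bochner_Integration.integral_cong) (auto simp: indicator_def)
    also have "\<dots> = c + (\<integral>x. indicator {a<..u} x * g x \<partial>lborel)"
      unfolding c_def by (intro Bochner_Integration.integral_add intI) auto
    also have "(\<integral>x. indicator {a<..u} x * g x \<partial>lborel) = (\<integral>x. indicator {a..u} x * g x \<partial>lborel)"
    proof (rule integral_cong_AE)
      show "AE x in lborel. indicator {a<..u} x * g x = indicator {a..u} x * g x"
        using AE_lborel_singleton[of a] by eventually_elim (auto simp: indicator_def)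
    qed (use intI in \<open>auto intro: borel_measurable_integrable\<close>)
    also have "\<dots> = integral {a..u} g"
      using set_borel_integral_eq_integral(2)[of "{a..u}" g] intI[of "{a..u}"]
      by (simp add: set_integrable_def set_lebesgue_integral_def)
    finally show ?thesis .
  qed
  have "((\<lambda>u. integral {a..u} g) has_real_derivative g w) (at w within {a..w+1})"
    by (rule integral_has_real_derivative) (auto simp: a_def intro: continuous_on_subset[OF cont])
  then have "((\<lambda>u. c + integral {a..u} g) has_real_derivative g w) (at w within {a..w+1})"
    by (auto intro!: derivative_eq_intros)
  then have "((\<lambda>u. c + integral {a..u} g) has_real_derivative g w) (at w)"
    using at_within_Icc_at[of a w "w + 1"] by (simp add: a_def)
  then show ?thesis
    by (rule has_field_derivative_transform_within_open[of _ _ _ "{a<..}"]) (use eq in \<open>simp_all add: a_def\<close>)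
qed

abbreviation \<phi>\<^sub>N :: "real \<Rightarrow> real" where "\<phi>\<^sub>N \<equiv> std_normal_density"

definition Phi :: "real \<Rightarrow> real" where
  "Phi w = (\<integral>x. indicator {..w} x * \<phi>\<^sub>N x \<partial>lborel)"

lemma integrable_phiN: "integrable lborel \<phi>\<^sub>N"
  by simp

lemma continuous_phiN: "continuous_on UNIV \<phi>\<^sub>N"
  unfolding std_normal_density_def by (intro continuous_intros) auto

lemma Phi_deriv: "(Phi has_real_derivative \<phi>\<^sub>N w) (at w)"
  unfolding Phi_def[abs_def]
  by (rule has_real_derivative_integral_atMost[OF continuous_phiN integrable_phiN])

lemma Phi_cdf: "Phi = cdf std_normal_distribution"
proof
  fix w
  have "emeasure std_normal_distribution {..w} = (\<integral>\<^sup>+x. ennreal (\<phi>\<^sub>N x) * indicator {..w} x \<partial>lborel)"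
    by (subst emeasure_density) auto
  also have "\<dots> = (\<integral>\<^sup>+x. ennreal (indicator {..w} x * \<phi>\<^sub>N x) \<partial>lborel)"
    by (intro nn_integral_cong) (auto simp: indicator_def)
  also have "\<dots> = ennreal (Phi w)"
    unfolding Phi_def using integrable_mult_indicator[OF _ integrable_phiN, of "{..w}"]
    by (intro nn_integral_eq_integral) auto
  finally show "Phi w = cdf std_normal_distribution w"
    by (auto simp: cdf_def measure_def Phi_def intro!: integral_nonneg_AE)
qed

interpretation std_normal: real_distribution std_normal_distribution
  by (rule real_dist_normal_dist)

lemma Phi_at_top: "(Phi \<longlongrightarrow> 1) at_top" and Phi_at_bot: "(Phi \<longlongrightarrow> 0) at_bot"
  and Phi_nonneg: "0 \<le> Phi w" and Phi_le_1: "Phi w \<le> 1" and Phi_mono: "x \<le> y \<Longrightarrow> Phi x \<le> Phi y"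
  unfolding Phi_cdf using std_normal.cdf_lim_at_top_prob std_normal.cdf_lim_at_bot
  by (auto intro: std_normal.cdf_bounded_prob std_normal.cdf_nonneg std_normal.cdf_nondecreasing)

lemma phiN_pos: "0 < \<phi>\<^sub>N x" by (simp add: normal_density_pos)

lemma phiN_le_1: "\<phi>\<^sub>N x \<le> 1"
proof -
  have "1 \<le> sqrt (2 * pi)" using pi_gt3 by simp
  moreover have "exp (- x\<^sup>2 / 2) \<le> 1" by simp
  ultimately show ?thesis unfolding std_normal_density_def
    by (metis divide_le_eq_1_pos exp_ge_zero less_le_trans mult_le_one zero_le_divide_1_iff zero_less_one order.trans zero_le_one)
qed

lemma phiN_minus: "\<phi>\<^sub>N (- x) = \<phi>\<^sub>N x" by (simp add: std_normal_density_def)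

lemma phiN_deriv: "(\<phi>\<^sub>N has_real_derivative - w * \<phi>\<^sub>N w) (at w)"
  unfolding std_normal_density_def[abs_def]
  by (auto intro!: derivative_eq_intros simp: field_simps)

text \<open>The sum \<open>Phi (-w) + Phi w\<close> has derivative 0, and its constant value is read
  off from the limit at infinity.\<close>

lemma Phi_minus: "Phi (- w) = 1 - Phi w"
proof -
  have d: "((\<lambda>w. Phi (-w) + Phi w) has_real_derivative 0) (at w)" for w
    by (rule derivative_eq_intros DERIV_chain'[OF _ Phi_deriv] Phi_deriv | simp add: phiN_minus)+
  have const: "Phi (-w) + Phi w = Phi (-0) + Phi 0" for w
    by (rule DERIV_isconst_all) (use d in blast)
  have "((\<lambda>w. Phi (-w) + Phi w) \<longlongrightarrow> 0 + 1) at_top"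
    by (intro tendsto_add Phi_at_top filterlim_compose[OF Phi_at_bot] filterlim_uminus_at_bot_at_top)
  then have "((\<lambda>w::real. Phi (-0) + Phi 0) \<longlongrightarrow> 1) at_top"
    using const by simp
  then have "Phi (-0) + Phi 0 = 1"
    using tendsto_unique[OF trivial_limit_at_top_linorder _ tendsto_const] by metis
  with const[of w] show ?thesis by simp
qed

section \<open>Lipschitz, tail and scaling bounds for the normal distribution function\<close>

lemma Phi_Lipschitz: "\<bar>Phi x - Phi y\<bar> \<le> \<bar>x - y\<bar>"
proof -
  have *: "Phi y - Phi x \<le> y - x" if "x < y" for x y
  proof -
    have "\<exists>z>x. z < y \<and> Phi y - Phi x = (y - x) * \<phi>\<^sub>N z"
      by (rule MVT2[OF that]) (rule Phi_deriv)
    then obtain z where "Phi y - Phi x = (y - x) * \<phi>\<^sub>N z" by blast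
    then show ?thesis using that phiN_le_1[of z] by (simp add: mult_left_le)
  qed
  show ?thesis using *[of x y] *[of y x] Phi_mono[of x y] Phi_mono[of y x]
    by (cases x y rule: linorder_cases) auto
qed

text \<open>The function \<open>g\<close> has the positive derivative
  \<open>\<phi>\<^sub>N w / w\<^sup>2\<close> and the limit 0 at infinity, hence it is
  nonpositive.\<close>

lemma Mills_upper:
  assumes "0 < w" shows "w * (1 - Phi w) \<le> \<phi>\<^sub>N w"
proof -
  define g where "g = (\<lambda>w. 1 - Phi w - \<phi>\<^sub>N w / w)"
  have d: "(g has_real_derivative \<phi>\<^sub>N w / w\<^sup>2) (at w)" if "w > 0" for w
    unfolding g_def using that
    by (auto intro!: derivative_eq_intros Phi_deriv phiN_deriv simp: field_simps power2_eq_square)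
  have lim: "(g \<longlongrightarrow> 1 - 1 - 0) at_top"
    unfolding g_def
  proof (intro tendsto_diff tendsto_const Phi_at_top)
    show "((\<lambda>w. \<phi>\<^sub>N w / w) \<longlongrightarrow> 0) at_top"
    proof (rule tendsto_sandwich[OF _ _ tendsto_const tendsto_inverse_0_at_top[OF filterlim_ident]])
      show "\<forall>\<^sub>F w in at_top. 0 \<le> \<phi>\<^sub>N w / w"
        using eventually_gt_at_top[of 0] by eventually_elim simp
      show "\<forall>\<^sub>F w in at_top. \<phi>\<^sub>N w / w \<le> inverse w"
        using eventually_gt_at_top[of 0] by eventually_elim (use phiN_le_1 in \<open>simp add: field_simps\<close>)
    qed
  qed
  have mono: "g w \<le> g v" if "w \<le> v" for v
  proof (rule DERIV_nonneg_imp_nondecreasing[OF that])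
    fix x assume "w \<le> x" "x \<le> v"
    then show "\<exists>y. (g has_real_derivative y) (at x) \<and> 0 \<le> y"
      using d[of x] assms phiN_pos[of x] by (intro exI[of _ "\<phi>\<^sub>N x / x\<^sup>2"]) auto
  qed
  have "g w \<le> 0"
    by (rule tendsto_lowerbound[of g _ at_top]) (use lim mono in \<open>auto simp: eventually_at_top_linorder\<close>)
  then show ?thesis using assms by (simp add: g_def field_simps)
qed

text \<open>For \<open>w \<ge> 1\<close> the Mills bound gives even the factor 1. On [0,1] the
  density is at least 1/5, because sqrt(2 pi) \<le> 3 and exp(1/2) \<le> 5/3. The 5 reappears as the
  bound of the Stein solution.\<close>

lemma Phi_tail_le:
  assumes "0 \<le> w" shows "1 - Phi w \<le> 5 * \<phi>\<^sub>N w"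
proof (cases "w \<ge> 1")
  case True
  then have "1 - Phi w \<le> w * (1 - Phi w)"
    using Phi_le_1[of w] by (simp add: mult_right_le_one_le mult_le_cancel_right1)
  with Mills_upper[of w] True phiN_pos[of w] show ?thesis by linarith
next
  case False
  have "sqrt (2 * pi) \<le> 3" by (rule real_le_lsqrt) (use pi_less_4 in auto)
  moreover have "exp (w\<^sup>2/2) \<le> 5/3"
  proof -
    have "w\<^sup>2 \<le> 1" using False assms by (simp add: power_le_one)
    then have "exp (w\<^sup>2/2) \<le> exp (1/2)" by simp
    also have "exp (1/2) \<le> (5/3::real)"
    proof (rule power2_le_imp_le)
      have "exp (1/2)^2 = exp (1::real)" by (simp flip: exp_of_nat_mult)
      also have "\<dots> \<le> (5/3)^2" using e_less_272 by (simp add: power2_eq_square)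
      finally show "exp (1/2)^2 \<le> (5/3::real)^2" .
    qed simp
    finally show ?thesis .
  qed
  ultimately have "sqrt (2 * pi) * exp (w\<^sup>2/2) \<le> 3 * (5/3)" by (intro mult_mono) auto
  then have "1 \<le> 5 * \<phi>\<^sub>N w" by (simp add: std_normal_density_def exp_minus field_simps)
  with Phi_nonneg[of w] show ?thesis by linarith
qed

text \<open>In the variable \<open>u = ln s\<close> the derivative of
  \<open>Phi (x * exp (- u))\<close> is \<open>- v * \<phi>\<^sub>N v\<close> with
  \<open>v = x * exp (- u)\<close>, which is bounded by 1 whatever \<open>x\<close> is. This serves
  to replace an empirical standard deviation by the true one.\<close>

lemma Phi_scale:
  assumes "0 < s" shows "\<bar>Phi (x / s) - Phi x\<bar> \<le> \<bar>ln s\<bar>"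
proof -
  define g where "g = (\<lambda>u. Phi (x * exp (- u)))"
  have d: "(g has_real_derivative - (x * exp (-u)) * \<phi>\<^sub>N (x * exp (-u))) (at u)" for u
    unfolding g_def
    by (rule DERIV_cong[OF DERIV_chain'[OF _ Phi_deriv]]) (auto intro!: derivative_eq_intros)
  have b: "\<bar>v * \<phi>\<^sub>N v\<bar> \<le> 1" for v
  proof -
    have "\<bar>v\<bar> \<le> 1 + v\<^sup>2/2" using zero_le_power2[of "\<bar>v\<bar> - 1"] by (simp add: power2_diff)
    also have "\<dots> \<le> exp (v\<^sup>2/2)" by (rule exp_ge_add_one_self)
    finally have "\<bar>v\<bar> * exp (-v\<^sup>2/2) \<le> 1" by (simp add: exp_minus field_simps)
    moreover have "1 \<le> sqrt (2 * pi)" using pi_gt3 by simp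
    ultimately have "\<bar>v\<bar> * exp (-v\<^sup>2/2) \<le> sqrt (2*pi)" by linarith
    then show ?thesis by (simp add: std_normal_density_def abs_mult)
  qed
  have *: "\<bar>g v - g u\<bar> \<le> v - u" if "u < v" for u v
  proof -
    have "\<exists>z>u. z < v \<and> g v - g u = (v - u) * (- (x * exp (-z)) * \<phi>\<^sub>N (x * exp (-z)))"
      by (rule MVT2[OF that]) (rule d)
    then obtain z where z: "g v - g u = (v - u) * (- (x * exp (-z)) * \<phi>\<^sub>N (x * exp (-z)))" by blast
    have "\<bar>g v - g u\<bar> = (v - u) * \<bar>x * exp (-z) * \<phi>\<^sub>N (x * exp (-z))\<bar>"
      unfolding z using that by (simp add: abs_mult)
    also have "\<dots> \<le> (v - u) * 1" using that b by (intro mult_left_mono) auto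
    finally show ?thesis by simp
  qed
  have "\<bar>g (ln s) - g 0\<bar> \<le> \<bar>ln s\<bar>"
    using *[of 0 "ln s"] *[of "ln s" 0] by (cases "ln s" "0::real" rule: linorder_cases) (auto simp: abs_minus_commute)
  then show ?thesis using assms by (simp add: g_def exp_minus divide_inverse)
qed

text \<open>The solution of Stein's equation \<open>f' w - w * f w = h w - E h\<close>.\<close>

definition stein_int :: "(real \<Rightarrow> real) \<Rightarrow> real \<Rightarrow> real" where
  "stein_int h w = (\<integral>x. indicator {..w} x * (h x * \<phi>\<^sub>N x) \<partial>lborel)"

definition normal_exp :: "(real \<Rightarrow> real) \<Rightarrow> real" where
  "normal_exp h = (\<integral>x. h x * \<phi>\<^sub>N x \<partial>lborel)"

definition stein_sol :: "(real \<Rightarrow> real) \<Rightarrow> real \<Rightarrow> real" where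
  "stein_sol h w = (stein_int h w - normal_exp h * Phi w) / \<phi>\<^sub>N w"

section \<open>Bounds for the solution of Stein's equation\<close>

context
  fixes h :: "real \<Rightarrow> real"
  assumes cont: "continuous_on UNIV h" and h01: "\<And>x. 0 \<le> h x" "\<And>x. h x \<le> 1"
begin

lemma integrable_h_phiN: "integrable lborel (\<lambda>x. h x * \<phi>\<^sub>N x)"
proof (rule Bochner_Integration.integrable_bound[OF integrable_phiN])
  show "(\<lambda>x. h x * \<phi>\<^sub>N x) \<in> borel_measurable lborel"
    using borel_measurable_continuous_onI[OF cont] by measurable
  show "AE x in lborel. norm (h x * \<phi>\<^sub>N x) \<le> norm (\<phi>\<^sub>N x)"
    using h01 by (auto simp: abs_mult mult_left_le_one_le)
qed

lemma stein_int_bounds: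
  "0 \<le> stein_int h w" "stein_int h w \<le> Phi w"
  "stein_int h w \<le> normal_exp h" "normal_exp h - stein_int h w \<le> 1 - Phi w"
proof -
  have i1: "integrable lborel (\<lambda>x. indicator {..w} x * (h x * \<phi>\<^sub>N x))"
    using integrable_mult_indicator[OF _ integrable_h_phiN, of "{..w}"] by simp
  have i2: "integrable lborel (\<lambda>x. indicator {..w} x * \<phi>\<^sub>N x)"
    using integrable_mult_indicator[OF _ integrable_phiN, of "{..w}"] by simp
  have le: "h x * \<phi>\<^sub>N x \<le> \<phi>\<^sub>N x" "0 \<le> h x * \<phi>\<^sub>N x" for x using h01 by (auto simp: mult_left_le_one_le)
  show "0 \<le> stein_int h w" unfolding stein_int_def using le by (intro integral_nonneg_AE) auto
  show "stein_int h w \<le> Phi w" unfolding stein_int_def Phi_def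
    using le by (intro integral_mono i1 i2) (auto simp: indicator_def)
  show "stein_int h w \<le> normal_exp h" unfolding stein_int_def normal_exp_def
    using le by (intro integral_mono i1 integrable_h_phiN) (auto simp: indicator_def)
  have "normal_exp h - stein_int h w = (\<integral>x. h x * \<phi>\<^sub>N x - indicator {..w} x * (h x * \<phi>\<^sub>N x) \<partial>lborel)"
    unfolding stein_int_def normal_exp_def
    by (intro Bochner_Integration.integral_diff[symmetric] i1 integrable_h_phiN)
  also have "\<dots> \<le> (\<integral>x. \<phi>\<^sub>N x - indicator {..w} x * \<phi>\<^sub>N x \<partial>lborel)"
    using le by (intro integral_mono Bochner_Integration.integrable_diff i1 i2 integrable_h_phiN integrable_phiN)
      (auto simp: indicator_def)
  also have "\<dots> = 1 - Phi w"
    unfolding Phi_def by (subst Bochner_Integration.integral_diff[OF integrable_phiN i2]) simp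
  finally show "normal_exp h - stein_int h w \<le> 1 - Phi w" .
qed

lemma normal_exp_01: "0 \<le> normal_exp h" "normal_exp h \<le> 1"
  using stein_int_bounds[of 0] by linarith+

text \<open>Continuity of \<open>h\<close> makes the numerator differentiable at every point. For an
  indicator the derivative would jump at the threshold, so continuous test functions are used
  throughout.\<close>

lemma stein_sol_deriv:
  "(stein_sol h has_real_derivative w * stein_sol h w + h w - normal_exp h) (at w)"
proof -
  have [derivative_intros]: "(stein_int h has_real_derivative h w * \<phi>\<^sub>N w) (at w)"
    unfolding stein_int_def[abs_def]
    by (rule has_real_derivative_integral_atMost)
       (intro continuous_intros cont continuous_phiN integrable_h_phiN)+
  have p: "\<phi>\<^sub>N w \<noteq> 0" using phiN_pos[of w] by simp
  have "((\<lambda>w. (stein_int h w - normal_exp h * Phi w) / \<phi>\<^sub>N w) has_real_derivative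
     ((h w * \<phi>\<^sub>N w - normal_exp h * \<phi>\<^sub>N w) * \<phi>\<^sub>N w - (stein_int h w - normal_exp h * Phi w) * (- w * \<phi>\<^sub>N w))
       / (\<phi>\<^sub>N w * \<phi>\<^sub>N w)) (at w)"
    by (intro derivative_intros DERIV_divide DERIV_diff DERIV_cmult Phi_deriv phiN_deriv p)
  then show ?thesis
    unfolding stein_sol_def[abs_def] by (rule DERIV_cong) (use p in \<open>simp add: field_simps\<close>)
qed

text \<open>Both \<open>stein_int h w\<close> and \<open>normal_exp h * Phi w\<close> lie between 0
  and \<open>Phi w\<close>. For the second bound the same number is the difference of
  \<open>normal_exp h * (1 - Phi w)\<close> and \<open>normal_exp h - stein_int h w\<close>, which
  lie between 0 and \<open>1 - Phi w\<close>. One bound serves negative, the other positive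
  \<open>w\<close>.\<close>

lemma stein_num_le:
  "\<bar>stein_int h w - normal_exp h * Phi w\<bar> \<le> Phi w"
  "\<bar>stein_int h w - normal_exp h * Phi w\<bar> \<le> 1 - Phi w"
proof -
  have 1: "0 \<le> normal_exp h * Phi w" "normal_exp h * Phi w \<le> Phi w"
    "0 \<le> normal_exp h * (1 - Phi w)" "normal_exp h * (1 - Phi w) \<le> 1 - Phi w"
    using normal_exp_01 Phi_nonneg[of w] Phi_le_1[of w] by (auto simp: mult_left_le_one_le)
  then show "\<bar>stein_int h w - normal_exp h * Phi w\<bar> \<le> Phi w" using stein_int_bounds[of w] by linarith
  show "\<bar>stein_int h w - normal_exp h * Phi w\<bar> \<le> 1 - Phi w"
    using 1 stein_int_bounds[of w] by (simp add: algebra_simps)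
qed

lemma stein_sol_bound: "\<bar>stein_sol h w\<bar> \<le> 5"
proof -
  have "\<bar>stein_int h w - normal_exp h * Phi w\<bar> \<le> 5 * \<phi>\<^sub>N w"
    using Phi_tail_le[of w] Phi_tail_le[of "-w"] stein_num_le[of w]
    by (cases "w \<ge> 0") (simp_all add: Phi_minus phiN_minus)
  then show ?thesis
    unfolding stein_sol_def using phiN_pos[of w] by (simp add: field_simps)
qed

text \<open>The factor \<open>w\<close> is absorbed by the Mills ratio, applied at \<open>-w\<close>
  for negative \<open>w\<close>.\<close>

lemma stein_sol_bound': "\<bar>w * stein_sol h w\<bar> \<le> 1"
proof -
  have "\<bar>w\<bar> * \<bar>stein_int h w - normal_exp h * Phi w\<bar> \<le> \<phi>\<^sub>N w"
  proof (cases w "0::real" rule: linorder_cases)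
    case less
    have "\<bar>w\<bar> * \<bar>stein_int h w - normal_exp h * Phi w\<bar> \<le> \<bar>w\<bar> * Phi w"
      by (intro mult_left_mono stein_num_le) auto
    also have "\<bar>w\<bar> * Phi w \<le> \<phi>\<^sub>N w"
      using Mills_upper[of "-w"] less by (simp add: Phi_minus phiN_minus)
    finally show ?thesis .
  next
    case greater
    have "\<bar>w\<bar> * \<bar>stein_int h w - normal_exp h * Phi w\<bar> \<le> \<bar>w\<bar> * (1 - Phi w)"
      by (intro mult_left_mono stein_num_le) auto
    also have "\<bar>w\<bar> * (1 - Phi w) \<le> \<phi>\<^sub>N w"
      using Mills_upper[of w] greater by simp
    finally show ?thesis .
  qed (use phiN_pos[of w] in auto)
  then show ?thesis
    unfolding stein_sol_def using phiN_pos[of w] by (simp add: abs_mult abs_divide)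
qed

text \<open>By Stein's equation the expression is the derivative of \<open>stein_sol h\<close>; the
  product with \<open>w\<close> and the centred \<open>h\<close> contribute 1 each.\<close>

lemma stein_deriv_bound: "\<bar>w * stein_sol h w + h w - normal_exp h\<bar> \<le> 2"
  using stein_sol_bound'[of w] h01[of w] normal_exp_01 by linarith

lemma stein_sol_Lipschitz: "\<bar>stein_sol h v - stein_sol h w\<bar> \<le> 2 * \<bar>v - w\<bar>"
proof -
  have *: "\<bar>stein_sol h v - stein_sol h w\<bar> \<le> 2 * (v - w)" if "w < v" for v w
  proof -
    have "\<exists>z>w. z < v \<and> stein_sol h v - stein_sol h w = (v - w) * (z * stein_sol h z + h z - normal_exp h)"
      by (rule MVT2[OF that]) (rule stein_sol_deriv)
    then obtain z where z: "stein_sol h v - stein_sol h w = (v - w) * (z * stein_sol h z + h z - normal_exp h)"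
      by blast
    have "\<bar>stein_sol h v - stein_sol h w\<bar> = (v - w) * \<bar>z * stein_sol h z + h z - normal_exp h\<bar>"
      unfolding z using that by (simp add: abs_mult)
    also have "\<dots> \<le> (v - w) * 2" using that stein_deriv_bound by (intro mult_left_mono) auto
    finally show ?thesis by simp
  qed
  show ?thesis using *[of w v] *[of v w]
    by (cases v w rule: linorder_cases) (auto simp: abs_minus_commute)
qed

text \<open>With \<open>f\<close> the Stein solution, the increment of its derivative is
  \<open>s * f (w + s) + w * (f (w + s) - f w)\<close> plus the increment of \<open>h\<close>. The
  last term is left as it stands, since a uniform bound for it would be too coarse when
  \<open>h\<close> is a steep ramp.\<close>

lemma stein_deriv_diff:
  "\<bar>((w + s) * stein_sol h (w + s) + h (w + s) - normal_exp h) - (w * stein_sol h w + h w - normal_exp h)\<bar>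
     \<le> \<bar>s\<bar> * (5 + 2 * \<bar>w\<bar>) + \<bar>h (w + s) - h w\<bar>"
proof -
  have "((w + s) * stein_sol h (w + s) + h (w + s) - normal_exp h) - (w * stein_sol h w + h w - normal_exp h)
     = s * stein_sol h (w + s) + w * (stein_sol h (w + s) - stein_sol h w) + (h (w + s) - h w)"
    by (simp add: algebra_simps)
  also have "\<bar>\<dots>\<bar> \<le> \<bar>s * stein_sol h (w + s)\<bar> + \<bar>w * (stein_sol h (w + s) - stein_sol h w)\<bar> + \<bar>h (w + s) - h w\<bar>"
    by linarith
  also have "\<dots> = \<bar>s\<bar> * \<bar>stein_sol h (w + s)\<bar> + \<bar>w\<bar> * \<bar>stein_sol h (w + s) - stein_sol h w\<bar> + \<bar>h (w + s) - h w\<bar>"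
    by (simp add: abs_mult)
  also have "\<dots> \<le> \<bar>s\<bar> * 5 + \<bar>w\<bar> * (2 * \<bar>s\<bar>) + \<bar>h (w + s) - h w\<bar>"
    using stein_sol_bound[of "w+s"] stein_sol_Lipschitz[of "w+s" w]
    by (intro add_mono mult_left_mono) auto
  finally show ?thesis by (simp add: algebra_simps)
qed

end

section \<open>The Berry--Esseen theorem\<close>

lemma pair_integral_mult:
  fixes f :: "'a \<Rightarrow> real" and g :: "'b \<Rightarrow> real"
  assumes "prob_space M" "prob_space N" and f: "integrable M f" and g: "integrable N g"
  shows "integrable (M \<Otimes>\<^sub>M N) (\<lambda>z. f (fst z) * g (snd z))"
    and "(\<integral>z. f (fst z) * g (snd z) \<partial>(M \<Otimes>\<^sub>M N)) = (\<integral>x. f x \<partial>M) * (\<integral>y. g y \<partial>N)"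
proof -
  interpret M: prob_space M by fact
  interpret N: prob_space N by fact
  interpret pair_prob_space M N ..
  have [measurable]: "f \<in> borel_measurable M" "g \<in> borel_measurable N" using f g by auto
  show i: "integrable (M \<Otimes>\<^sub>M N) (\<lambda>z. f (fst z) * g (snd z))"
    by (rule Fubini_integrable) (use f g in \<open>auto simp: abs_mult\<close>)
  show "(\<integral>z. f (fst z) * g (snd z) \<partial>(M \<Otimes>\<^sub>M N)) = (\<integral>x. f x \<partial>M) * (\<integral>y. g y \<partial>N)"
    using integral_fst'[OF i] f g by simp
qed

text \<open>The \<open>n\<close>-fold convolution power of \<open>\<mu>\<close>. Laws instead of
  random variables turn the induction on \<open>n\<close> into a statement about one product
  measure, with the new summand as its first component.\<close>

primrec sum_law :: "real measure \<Rightarrow> nat \<Rightarrow> real measure" where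
  "sum_law \<mu> 0 = return borel 0"
| "sum_law \<mu> (Suc n) = distr (\<mu> \<Otimes>\<^sub>M sum_law \<mu> n) borel (\<lambda>z. fst z + snd z)"

lemma sets_sum_law [simp, measurable_cong]: "sets (sum_law \<mu> n) = sets borel"
  by (cases n) auto

lemma space_sum_law [simp]: "space (sum_law \<mu> n) = UNIV"
  by (cases n) auto

context real_distribution
begin

lemma prob_space_sum_law: "prob_space (sum_law M n)"
proof (induction n)
  case 0
  then show ?case by (simp add: prob_space_return)
next
  case (Suc n)
  interpret L: prob_space "sum_law M n" by fact
  interpret P: pair_prob_space M "sum_law M n" ..
  show ?case by (simp, rule P.prob_space_distr) measurable
qed

lemma integral_sum_law_Suc:
  fixes F :: "real \<Rightarrow> real"
  assumes [measurable]: "F \<in> borel_measurable borel"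
  shows "(\<integral>s. F s \<partial>sum_law M (Suc n)) = (\<integral>z. F (fst z + snd z) \<partial>(M \<Otimes>\<^sub>M sum_law M n))"
    and "integrable (sum_law M (Suc n)) F \<longleftrightarrow> integrable (M \<Otimes>\<^sub>M sum_law M n) (\<lambda>z. F (fst z + snd z))"
  by (simp_all, subst integral_distr integrable_distr_eq; measurable)+

end

locale std_increment = real_distribution \<mu> for \<mu> :: "real measure" +
  assumes int1: "integrable \<mu> (\<lambda>x. x)" and mean0: "(\<integral>x. x \<partial>\<mu>) = 0"
    and int2: "integrable \<mu> (\<lambda>x. x\<^sup>2)" and var1: "(\<integral>x. x\<^sup>2 \<partial>\<mu>) = 1"
    and int3: "integrable \<mu> (\<lambda>x. \<bar>x\<bar> ^ 3)"
begin

abbreviation "L \<equiv> sum_law \<mu>"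
definition "\<gamma> = (\<integral>x. \<bar>x\<bar> ^ 3 \<partial>\<mu>)"

lemma sum_law_moments:
  "integrable (L n) (\<lambda>s. s)" "integrable (L n) (\<lambda>s. s\<^sup>2)"
  "(\<integral>s. s \<partial>L n) = 0" "(\<integral>s. s\<^sup>2 \<partial>L n) = n"
proof (induction n)
  case 0
  interpret L0: prob_space "return borel (0::real)" by (simp add: prob_space_return)
  {
    case 1 show ?case by (simp, rule L0.integrable_const_bound[of _ 0]) (auto simp: AE_return)
  next
    case 2 show ?case by (simp, rule L0.integrable_const_bound[of _ 0]) (auto simp: AE_return)
  next
    case 3 show ?case by (simp add: integral_return)
  next
    case 4 show ?case by (simp add: integral_return)
  }
next
  case (Suc n)
  note pm = pair_integral_mult[OF prob_space_axioms prob_space_sum_law[of n]]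
  interpret L: prob_space "L n" by (rule prob_space_sum_law)
  have c: "integrable \<mu> (\<lambda>_. 1::real)" "integrable (L n) (\<lambda>_. 1::real)" by auto
  note i = pm(1)[OF int1 c(2)] pm(1)[OF c(1) Suc(1)] pm(1)[OF int2 c(2)] pm(1)[OF int1 Suc(1)] pm(1)[OF c(1) Suc(2)]
  note e = pm(2)[OF int1 c(2)] pm(2)[OF c(1) Suc(1)] pm(2)[OF int2 c(2)] pm(2)[OF int1 Suc(1)] pm(2)[OF c(1) Suc(2)]
  have eq: "(x + s)\<^sup>2 = x\<^sup>2 * 1 + 2 * (x * s) + 1 * s\<^sup>2" for x s :: real by (simp add: power2_sum)
  {
    case 1 show ?case
      by (subst integral_sum_law_Suc) (use i in \<open>auto intro!: Bochner_Integration.integrable_add\<close>)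
  next
    case 2 show ?case
      by (subst integral_sum_law_Suc, measurable, unfold eq)
         (intro Bochner_Integration.integrable_add integrable_mult_right i)
  next
    case 3 show ?case
      by (subst integral_sum_law_Suc, measurable)
         (use i e Suc mean0 in \<open>simp add: Bochner_Integration.integral_add\<close>)
  next
    case 4
    have "(\<integral>s. s\<^sup>2 \<partial>L (Suc n)) = (\<integral>z. (fst z)\<^sup>2 * 1 + 2 * (fst z * snd z) + 1 * (snd z)\<^sup>2 \<partial>(\<mu> \<Otimes>\<^sub>M L n))"
      by (subst integral_sum_law_Suc, measurable, unfold eq) simp
    also have "\<dots> = (\<integral>z. (fst z)\<^sup>2 * 1 \<partial>(\<mu> \<Otimes>\<^sub>M L n)) + 2 * (\<integral>z. fst z * snd z \<partial>(\<mu> \<Otimes>\<^sub>M L n))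
         + (\<integral>z. 1 * (snd z)\<^sup>2 \<partial>(\<mu> \<Otimes>\<^sub>M L n))"
      by (simp only: Bochner_Integration.integral_add Bochner_Integration.integrable_add
           integrable_mult_right integral_mult_right_zero i)
    also have "\<dots> = real (Suc n)"
      unfolding e using mean0 var1 Suc prob_space L.prob_space by simp
    finally show ?case .
  }
qed

text \<open>Each of the \<open>n + 1\<close> exchangeable summands contributes equally to the left-hand side.\<close>

lemma stein_exchange:
  fixes g :: "real \<Rightarrow> real"
  assumes [measurable]: "g \<in> borel_measurable borel" and b: "\<And>x. \<bar>g x\<bar> \<le> c"
  shows "(\<integral>s. s * g s \<partial>L (Suc n)) = Suc n * (\<integral>z. fst z * g (fst z + snd z) \<partial>(\<mu> \<Otimes>\<^sub>M L n))"
  using assms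
proof (induction n arbitrary: g)
  case 0
  note [measurable] = 0(1) and [measurable_cong] = sets_return
  interpret L0: prob_space "return borel (0::real)" by (simp add: prob_space_return)
  interpret P: pair_prob_space \<mu> "return borel (0::real)" ..
  have "AE z in \<mu> \<Otimes>\<^sub>M return borel (0::real). snd z = 0"
  proof -
    have "AE x in \<mu>. AE y in return borel (0::real). snd (x, y) = 0"
      by (auto simp: AE_return)
    moreover have "snd -` {0} \<inter> space (\<mu> \<Otimes>\<^sub>M return borel (0::real)) \<in> sets (\<mu> \<Otimes>\<^sub>M return borel (0::real))"
      by (rule measurable_sets[OF measurable_snd]) simp
    moreover have "snd -` {0} \<inter> space (\<mu> \<Otimes>\<^sub>M return borel (0::real))
        = {z \<in> space (\<mu> \<Otimes>\<^sub>M return borel (0::real)). snd z = 0}" by auto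
    ultimately show ?thesis by (intro P.AE_pair_measure) auto
  qed
  then have "(\<integral>z. (fst z + snd z) * g (fst z + snd z) \<partial>(\<mu> \<Otimes>\<^sub>M return borel 0))
     = (\<integral>z. fst z * g (fst z + snd z) \<partial>(\<mu> \<Otimes>\<^sub>M return borel 0))"
    by (intro integral_cong_AE; (measurable; fail)?) auto
  then show ?case by (subst integral_sum_law_Suc) auto
next
  case (Suc n)
  note [measurable] = Suc.prems(1)
  note gb = Suc.prems(2)
  interpret L: prob_space "L n" by (rule prob_space_sum_law)
  interpret L': prob_space "L (Suc n)" by (rule prob_space_sum_law)
  interpret P: pair_prob_space \<mu> "L n" ..
  interpret P': pair_prob_space \<mu> "L (Suc n)" ..
  interpret PP: pair_prob_space \<mu> \<mu> ..
  \<comment> \<open>\<open>H x y\<close> averages out all summands but two. Its symmetry in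
    \<open>x\<close> and \<open>y\<close> is the exchangeability on which the argument
    rests.\<close>
  define H where "H = (\<lambda>x y. \<integral>s. g (x + y + s) \<partial>L n)"
  have [measurable]: "(\<lambda>z. H (fst z) (snd z)) \<in> borel_measurable (\<mu> \<Otimes>\<^sub>M \<mu>)"
    unfolding H_def by measurable
  have gi: "integrable (L n) (\<lambda>s. g (x + s))" for x
    by (rule L.integrable_const_bound[of _ c]) (use gb in auto)
  have Hb: "\<bar>H x y\<bar> \<le> c" for x y
  proof -
    have "\<bar>H x y\<bar> \<le> (\<integral>s. \<bar>g (x + y + s)\<bar> \<partial>L n)" unfolding H_def by (rule integral_abs_bound)
    also have "\<dots> \<le> (\<integral>s. c \<partial>L n)" using gi gb by (intro integral_mono) auto
    finally show ?thesis using L.prob_space by simp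
  qed
  have Hsym: "H x y = H y x" for x y by (simp add: H_def add.commute)
  have c1: "integrable (L n) (\<lambda>_. c)" "integrable (L (Suc n)) (\<lambda>_. c)" "integrable \<mu> (\<lambda>_. c)"
    by (auto simp del: sum_law.simps)
  have c0: "0 \<le> c" using gb[of 0] by linarith
  have i1: "integrable (\<mu> \<Otimes>\<^sub>M L (Suc n)) (\<lambda>z. fst z * g (fst z + snd z))"
  proof (rule Bochner_Integration.integrable_bound)
    show "integrable (\<mu> \<Otimes>\<^sub>M L (Suc n)) (\<lambda>z. fst z * c)"
      by (rule pair_integral_mult) (unfold_locales, use int1 c1 in auto)
    show "AE z in \<mu> \<Otimes>\<^sub>M L (Suc n). norm (fst z * g (fst z + snd z)) \<le> norm (fst z * c)"
      using gb c0 by (auto simp: abs_mult intro!: mult_left_mono)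
  qed measurable
  have i2: "integrable (\<mu> \<Otimes>\<^sub>M L (Suc n)) (\<lambda>z. snd z * g (fst z + snd z))"
  proof (rule Bochner_Integration.integrable_bound)
    show "integrable (\<mu> \<Otimes>\<^sub>M L (Suc n)) (\<lambda>z. c * snd z)"
      by (rule pair_integral_mult(1)[of \<mu> "L (Suc n)" "\<lambda>_. c" "\<lambda>s. s"])
         (unfold_locales, use sum_law_moments(1)[of "Suc n"] c1 in auto)
    show "AE z in \<mu> \<Otimes>\<^sub>M L (Suc n). norm (snd z * g (fst z + snd z)) \<le> norm (c * snd z)"
      using gb c0 by (auto simp: abs_mult mult.commute[of c] intro!: mult_left_mono)
  qed measurable
  have iH: "integrable (\<mu> \<Otimes>\<^sub>M \<mu>) (\<lambda>z. fst z * H (fst z) (snd z))"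
  proof (rule Bochner_Integration.integrable_bound)
    show "integrable (\<mu> \<Otimes>\<^sub>M \<mu>) (\<lambda>z. fst z * c)"
      by (rule pair_integral_mult) (unfold_locales, use int1 c1 in auto)
    show "AE z in \<mu> \<Otimes>\<^sub>M \<mu>. norm (fst z * H (fst z) (snd z)) \<le> norm (fst z * c)"
      using Hb c0 by (auto simp: abs_mult intro!: mult_left_mono)
  qed measurable
  have iH': "integrable (\<mu> \<Otimes>\<^sub>M \<mu>) (\<lambda>(x, y). y * H x y)"
    using PP.integrable_product_swap[OF iH] by (simp add: split_def Hsym)
  have i3: "integrable (\<mu> \<Otimes>\<^sub>M L n) (\<lambda>z. fst z * g (x + (fst z + snd z)))" for x
  proof (rule Bochner_Integration.integrable_bound)
    show "integrable (\<mu> \<Otimes>\<^sub>M L n) (\<lambda>z. fst z * c)"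
      by (rule pair_integral_mult) (unfold_locales, use int1 c1 in auto)
    show "AE z in \<mu> \<Otimes>\<^sub>M L n. norm (fst z * g (x + (fst z + snd z))) \<le> norm (fst z * c)"
      using gb c0 by (auto simp: abs_mult intro!: mult_left_mono)
  qed measurable
  have T: "(\<integral>z. fst z * g (fst z + snd z) \<partial>(\<mu> \<Otimes>\<^sub>M L (Suc n))) = (\<integral>x. \<integral>y. x * H x y \<partial>\<mu> \<partial>\<mu>)"
  proof -
    have "(\<integral>z. fst z * g (fst z + snd z) \<partial>(\<mu> \<Otimes>\<^sub>M L (Suc n))) = (\<integral>x. \<integral>s. x * g (x + s) \<partial>L (Suc n) \<partial>\<mu>)"
      using P'.integral_fst'[OF i1] by simp
    also have "\<dots> = (\<integral>x. \<integral>y. x * H x y \<partial>\<mu> \<partial>\<mu>)"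
    proof (rule Bochner_Integration.integral_cong[OF refl])
      fix x
      have ii: "integrable (\<mu> \<Otimes>\<^sub>M L n) (\<lambda>z. g (x + (fst z + snd z)))"
        by (rule P.integrable_const_bound[of _ c]) (use gb in auto)
      have "(\<integral>s. g (x + s) \<partial>L (Suc n)) = (\<integral>y. H x y \<partial>\<mu>)"
        by (subst integral_sum_law_Suc, measurable)
           (use P.integral_fst'[OF ii] in \<open>simp add: H_def add.assoc\<close>)
      then show "(\<integral>s. x * g (x + s) \<partial>L (Suc n)) = (\<integral>y. x * H x y \<partial>\<mu>)"
        by (simp del: sum_law.simps) 
    qed
    finally show ?thesis .
  qed
  have T': "(\<integral>z. snd z * g (fst z + snd z) \<partial>(\<mu> \<Otimes>\<^sub>M L (Suc n)))
     = Suc n * (\<integral>x. \<integral>y. x * H x y \<partial>\<mu> \<partial>\<mu>)"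
  proof -
    have "(\<integral>z. snd z * g (fst z + snd z) \<partial>(\<mu> \<Otimes>\<^sub>M L (Suc n))) = (\<integral>x. \<integral>s. s * g (x + s) \<partial>L (Suc n) \<partial>\<mu>)"
      using P'.integral_fst'[OF i2] by simp
    also have "\<dots> = (\<integral>x. Suc n * (\<integral>y. y * H x y \<partial>\<mu>) \<partial>\<mu>)"
    proof (rule Bochner_Integration.integral_cong[OF refl])
      fix x
      \<comment> \<open>The induction hypothesis is applied to the shifted function, with the fresh
        summand \<open>x\<close> frozen.\<close>
      have "(\<integral>s. s * g (x + s) \<partial>L (Suc n)) = Suc n * (\<integral>z. fst z * g (x + (fst z + snd z)) \<partial>(\<mu> \<Otimes>\<^sub>M L n))"
        by (rule Suc.IH) (use gb in auto)
      also have "(\<integral>z. fst z * g (x + (fst z + snd z)) \<partial>(\<mu> \<Otimes>\<^sub>M L n)) = (\<integral>y. y * H x y \<partial>\<mu>)"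
        using P.integral_fst'[OF i3] by (simp add: H_def add.assoc)
      finally show "(\<integral>s. s * g (x + s) \<partial>L (Suc n)) = Suc n * (\<integral>y. y * H x y \<partial>\<mu>)" .
    qed
    also have "\<dots> = Suc n * (\<integral>x. \<integral>y. y * H x y \<partial>\<mu> \<partial>\<mu>)" by simp
    \<comment> \<open>Fubini followed by symmetry moves the weight from a summand inside the sum to
      the fresh one.\<close>
    also have "(\<integral>x. \<integral>y. y * H x y \<partial>\<mu> \<partial>\<mu>) = (\<integral>y. \<integral>x. y * H x y \<partial>\<mu> \<partial>\<mu>)"
      by (rule PP.Fubini_integral[symmetric, OF iH'])
    also have "\<dots> = (\<integral>x. \<integral>y. x * H x y \<partial>\<mu> \<partial>\<mu>)"
      by (simp only: Hsym)
    finally show ?thesis .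
  qed
  have "(\<integral>s. s * g s \<partial>L (Suc (Suc n))) = (\<integral>z. fst z * g (fst z + snd z) + snd z * g (fst z + snd z) \<partial>(\<mu> \<Otimes>\<^sub>M L (Suc n)))"
    by (subst integral_sum_law_Suc, measurable) (simp add: distrib_right del: sum_law.simps)
  also have "\<dots> = (\<integral>z. fst z * g (fst z + snd z) \<partial>(\<mu> \<Otimes>\<^sub>M L (Suc n))) + (\<integral>z. snd z * g (fst z + snd z) \<partial>(\<mu> \<Otimes>\<^sub>M L (Suc n)))"
    by (rule Bochner_Integration.integral_add[OF i1 i2])
  also have "\<dots> = Suc (Suc n) * (\<integral>z. fst z * g (fst z + snd z) \<partial>(\<mu> \<Otimes>\<^sub>M L (Suc n)))"
    unfolding T T' by (simp add: algebra_simps)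
  finally show ?case .
qed

text \<open>Pointwise inequalities between powers of \<bar>x\<bar> replace the inequalities of
  Jensen and Hoelder; the last one comes from (2u + 1)(u - 1)^2 \<ge> 0 with u = \<bar>x\<bar>. The
  bound \<open>1 \<le> \<gamma>\<close> makes the case of one summand trivial.\<close>

lemma abs_moment_le: "integrable \<mu> (\<lambda>x. \<bar>x\<bar>)" "(\<integral>x. \<bar>x\<bar> \<partial>\<mu>) \<le> 1" "1 \<le> \<gamma>"
proof -
  show i: "integrable \<mu> (\<lambda>x. \<bar>x\<bar>)" using int1 by simp
  have "(\<integral>x. \<bar>x\<bar> \<partial>\<mu>) \<le> (\<integral>x. (x\<^sup>2 + 1) / 2 \<partial>\<mu>)"
  proof (intro integral_mono i)
    show "\<bar>x\<bar> \<le> (x\<^sup>2 + 1) / 2" for x :: real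
      using zero_le_power2[of "\<bar>x\<bar> - 1"] by (simp add: power2_diff)
  qed (use int2 in auto)
  also have "\<dots> = 1" using int2 var1 prob_space by simp
  finally show "(\<integral>x. \<bar>x\<bar> \<partial>\<mu>) \<le> 1" .
  have "(\<integral>x. x\<^sup>2 \<partial>\<mu>) \<le> (\<integral>x. (2 * \<bar>x\<bar>^3 + 1) / 3 \<partial>\<mu>)"
  proof (intro integral_mono int2)
    fix x :: real
    have "0 \<le> (2 * \<bar>x\<bar> + 1) * (\<bar>x\<bar> - 1)\<^sup>2" by simp
    also have "\<dots> = 2 * \<bar>x\<bar>^3 + 1 - 3 * \<bar>x\<bar>\<^sup>2" by (simp add: power2_eq_square power3_eq_cube algebra_simps)
    finally show "x\<^sup>2 \<le> (2 * \<bar>x\<bar>^3 + 1) / 3" by simp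
  qed (use int3 in auto)
  also have "\<dots> = (2 * \<gamma> + 1) / 3" unfolding \<gamma>_def using int3 prob_space by simp
  finally show "1 \<le> \<gamma>" using var1 by simp
qed

end

text \<open>A Lipschitz stand-in for the indicator of \<open>{..z}\<close>, falling linearly from 1
  to 0 across an interval of width \<open>\<kappa>\<close>. A wider ramp costs more in the
  comparison with the indicator but has a tamer Stein solution.\<close>

definition ramp :: "real \<Rightarrow> real \<Rightarrow> real \<Rightarrow> real" where
  "ramp z \<kappa> x = max 0 (min 1 ((z + \<kappa> - x) / \<kappa>))"

text \<open>
  A bound for the oscillation of the derivative of the Stein solution within distance \<open>y\<close> of \<open>w\<close>. The
  indicator is kept, since anticoncentration makes its expectation small.
\<close>

definition ramp_mod :: "real \<Rightarrow> real \<Rightarrow> real \<Rightarrow> real \<Rightarrow> real" where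
  "ramp_mod z \<kappa> w y = y * (5 + 2 * \<bar>w\<bar>) + min 1 (y / \<kappa>) * indicator {z - y<..z + \<kappa> + y} w"

context
  fixes z \<kappa> :: real
  assumes lam: "0 < \<kappa>"
begin

lemma ramp_cont: "continuous_on UNIV (ramp z \<kappa>)"
  unfolding ramp_def using lam by (intro continuous_intros) auto

lemma ramp_01: "0 \<le> ramp z \<kappa> x" "ramp z \<kappa> x \<le> 1"
  by (auto simp: ramp_def)

lemma ramp_indicator: "indicator {..z} x \<le> ramp z \<kappa> x" "ramp z \<kappa> x \<le> indicator {..z + \<kappa>} x"
  using lam by (auto simp: ramp_def indicator_def field_simps max_def min_def)

text \<open>The slope is \<open>1 / \<kappa>\<close>, all values lie in [0,1], and nothing changes
  unless \<open>w\<close> comes within \<open>y\<close> of the sloping piece. All three facts are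
  kept, to be traded off against each other later.\<close>

lemma ramp_diff:
  assumes "\<bar>s\<bar> \<le> y"
  shows "\<bar>ramp z \<kappa> (w + s) - ramp z \<kappa> w\<bar> \<le> min 1 (y / \<kappa>) * indicator {z - y<..z + \<kappa> + y} w"
proof -
  have 1: "\<bar>ramp z \<kappa> (w + s) - ramp z \<kappa> w\<bar> \<le> 1"
    using ramp_01[of w] ramp_01[of "w + s"] by linarith
  have "(z + \<kappa> - (w + s)) / \<kappa> - (z + \<kappa> - w) / \<kappa> = - s / \<kappa>" using lam by (simp add: field_simps)
  then have "\<bar>ramp z \<kappa> (w + s) - ramp z \<kappa> w\<bar> \<le> \<bar>- s / \<kappa>\<bar>"
    unfolding ramp_def by linarith
  also have "\<dots> \<le> y / \<kappa>" using assms lam by (simp add: abs_divide divide_right_mono)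
  finally have 2: "\<bar>ramp z \<kappa> (w + s) - ramp z \<kappa> w\<bar> \<le> min 1 (y / \<kappa>)" using 1 by simp
  have "ramp z \<kappa> (w + s) = ramp z \<kappa> w" if "w \<notin> {z - y<..z + \<kappa> + y}"
  proof (cases "w \<le> z - y")
    case True
    then have "indicator {..z} w = (1::real)" "indicator {..z} (w + s) = (1::real)" using assms by auto
    then show ?thesis using ramp_indicator(1)[of w] ramp_indicator(1)[of "w+s"] ramp_01[of w] ramp_01[of "w+s"] by linarith
  next
    case False
    with that have "z + \<kappa> < w" "z + \<kappa> < w + s" using assms by auto
    then have "indicator {..z+\<kappa>} w = (0::real)" "indicator {..z+\<kappa>} (w + s) = (0::real)" by auto
    then show ?thesis using ramp_indicator(2)[of w] ramp_indicator(2)[of "w+s"] ramp_01[of w] ramp_01[of "w+s"] by linarith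
  qed
  with 2 show ?thesis by (auto simp: indicator_def)
qed

lemma normal_exp_ramp: "Phi z \<le> normal_exp (ramp z \<kappa>)" "normal_exp (ramp z \<kappa>) \<le> Phi (z + \<kappa>)"
proof -
  have i: "integrable lborel (\<lambda>x. indicator {..w} x * \<phi>\<^sub>N x)" for w
    using integrable_mult_indicator[OF _ integrable_phiN, of "{..w}"] by simp
  have j: "integrable lborel (\<lambda>x. ramp z \<kappa> x * \<phi>\<^sub>N x)"
    by (rule integrable_h_phiN[OF ramp_cont ramp_01])
  show "Phi z \<le> normal_exp (ramp z \<kappa>)" "normal_exp (ramp z \<kappa>) \<le> Phi (z + \<kappa>)"
    unfolding Phi_def normal_exp_def
    by (intro integral_mono i j mult_right_mono ramp_indicator; simp)+
qed

definition "sol = stein_sol (ramp z \<kappa>)"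
definition "dsol w = w * sol w + ramp z \<kappa> w - normal_exp (ramp z \<kappa>)"

lemma sol_deriv: "(sol has_real_derivative dsol w) (at w)"
  unfolding sol_def dsol_def by (rule stein_sol_deriv[OF ramp_cont ramp_01])

lemma sol_measurable [measurable]: "sol \<in> borel_measurable borel"
  by (rule borel_measurable_continuous_onI)
     (auto intro!: continuous_at_imp_continuous_on DERIV_isCont[OF sol_deriv])

lemma ramp_measurable [measurable]: "ramp z \<kappa> \<in> borel_measurable borel"
  by (rule borel_measurable_continuous_onI[OF ramp_cont])

lemma dsol_measurable [measurable]: "dsol \<in> borel_measurable borel"
  unfolding dsol_def[abs_def] by measurable

lemma sol_bound: "\<bar>sol w\<bar> \<le> 5"
  unfolding sol_def by (rule stein_sol_bound[OF ramp_cont ramp_01])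

lemma dsol_bound: "\<bar>dsol w\<bar> \<le> 2"
  unfolding dsol_def sol_def by (rule stein_deriv_bound[OF ramp_cont ramp_01])

lemma dsol_diff:
  assumes "\<bar>s\<bar> \<le> y" shows "\<bar>dsol (w + s) - dsol w\<bar> \<le> ramp_mod z \<kappa> w y"
proof -
  have "\<bar>dsol (w + s) - dsol w\<bar> \<le> \<bar>s\<bar> * (5 + 2 * \<bar>w\<bar>) + \<bar>ramp z \<kappa> (w + s) - ramp z \<kappa> w\<bar>"
    unfolding dsol_def sol_def by (rule stein_deriv_diff[OF ramp_cont ramp_01])
  also have "\<dots> \<le> ramp_mod z \<kappa> w y"
    unfolding ramp_mod_def by (intro add_mono mult_right_mono assms ramp_diff) auto
  finally show ?thesis .
qed

text \<open>Mean value theorem only: the derivative of \<open>sol\<close> inherits the kinks of the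
  ramp, so the remainder is measured by the oscillation of \<open>dsol\<close> and not by a second
  derivative.\<close>

lemma sol_taylor: "\<bar>sol (w + s) - sol w - s * dsol w\<bar> \<le> \<bar>s\<bar> * ramp_mod z \<kappa> w \<bar>s\<bar>"
proof -
  have "\<exists>\<xi>. \<bar>\<xi>\<bar> \<le> \<bar>s\<bar> \<and> sol (w + s) - sol w = s * dsol (w + \<xi>)"
  proof (cases s "0::real" rule: linorder_cases)
    case less
    have "\<exists>x>w + s. x < w \<and> sol w - sol (w + s) = (w - (w + s)) * dsol x"
      by (rule MVT2) (use less sol_deriv in auto)
    then obtain x where "w + s < x" "x < w" "sol (w + s) - sol w = s * dsol x" by auto
    then show ?thesis using less by (intro exI[of _ "x - w"]) auto
  next
    case greater
    have "\<exists>x>w. x < w + s \<and> sol (w + s) - sol w = ((w + s) - w) * dsol x"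
      by (rule MVT2) (use greater sol_deriv in auto)
    then obtain x where "w < x" "x < w + s" "sol (w + s) - sol w = s * dsol x" by auto
    then show ?thesis using greater by (intro exI[of _ "x - w"]) auto
  qed (auto intro: exI[of _ 0])
  then obtain \<xi> where \<xi>: "\<bar>\<xi>\<bar> \<le> \<bar>s\<bar>" and eq: "sol (w + s) - sol w = s * dsol (w + \<xi>)" by blast
  have "\<bar>sol (w + s) - sol w - s * dsol w\<bar> = \<bar>s\<bar> * \<bar>dsol (w + \<xi>) - dsol w\<bar>"
    unfolding eq by (simp add: right_diff_distrib[symmetric] abs_mult)
  also have "\<dots> \<le> \<bar>s\<bar> * ramp_mod z \<kappa> w \<bar>s\<bar>"
    by (intro mult_left_mono dsol_diff \<xi>) auto
  finally show ?thesis .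
qed

end

section \<open>The induction step of the Berry-Esseen bound\<close>

context std_increment
begin

context
  fixes n :: nat and \<delta> z \<kappa> r :: real
  assumes n1: "1 \<le> n" and kappa: "0 < \<kappa>" and r_def: "r = sqrt (real (Suc n))"
    and clt: "\<And>u. \<bar>measure (L n) {..u * sqrt n} - Phi u\<bar> \<le> \<delta>"
begin

lemma r_pos: "0 < r" and r2: "r\<^sup>2 = Suc n" by (auto simp: r_def)

text \<open>Anticoncentration inherited from the assumed normal approximation for \<open>n\<close>
  summands: the normal mass of the interval plus two errors \<open>\<delta>\<close>. The factor 2
  bounds \<open>r / sqrt n\<close>, since the interval is scaled for \<open>n + 1\<close>
  summands.\<close>

lemma measure_interval_le:
  assumes "0 \<le> y"
  shows "measure (L n) {s. s / r \<in> {z - y<..z + \<kappa> + y}} \<le> 2 * (\<kappa> + 2 * y) + 2 * \<delta>"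
proof -
  interpret L: prob_space "L n" by (rule prob_space_sum_law)
  interpret L: finite_borel_measure "L n" by unfold_locales auto
  have sn: "0 < sqrt n" using n1 by simp
  define a b where "a = (z - y) * r / sqrt n" and "b = (z + \<kappa> + y) * r / sqrt n"
  have ab: "a < b" unfolding a_def b_def using assms kappa r_pos sn
    by (intro divide_strict_right_mono mult_strict_right_mono) auto
  have "{s. s / r \<in> {z - y<..z + \<kappa> + y}} = {a * sqrt n<..b * sqrt n}"
  proof -
    have "a * sqrt n = (z - y) * r" "b * sqrt n = (z + \<kappa> + y) * r" using sn by (auto simp: a_def b_def)
    then show ?thesis using r_pos by (auto simp: field_simps)
  qed
  then have "measure (L n) {s. s / r \<in> {z - y<..z + \<kappa> + y}}
     = measure (L n) {..b * sqrt n} - measure (L n) {..a * sqrt n}"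
    using L.cdf_diff_eq[of "a * sqrt n" "b * sqrt n"] ab sn by (simp add: cdf_def)
  also have "\<dots> \<le> Phi b - Phi a + 2 * \<delta>"
    using clt[of a] clt[of b] by linarith
  also have "Phi b - Phi a \<le> b - a" using Phi_Lipschitz[of b a] ab by linarith
  also have "b - a = (\<kappa> + 2 * y) * (r / sqrt n)"
    unfolding a_def b_def using sn by (simp add: field_simps)
  also have "\<dots> \<le> (\<kappa> + 2 * y) * 2"
  proof (rule mult_left_mono)
    have "r \<le> sqrt (4 * n)" unfolding r_def using n1 by (intro real_sqrt_le_mono) linarith
    then show "r / sqrt n \<le> 2" using sn by (simp add: real_sqrt_mult field_simps)
  qed (use assms kappa in auto)
  finally show ?thesis by simp
qed

lemma delta_nonneg: "0 \<le> \<delta>" using clt[of 0] by linarith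

lemma integrable_abs_sum: "integrable (L n) (\<lambda>s. \<bar>s\<bar> / r)" "(\<integral>s. \<bar>s\<bar> / r \<partial>L n) \<le> 1"
proof -
  interpret L: prob_space "L n" by (rule prob_space_sum_law)
  show i: "integrable (L n) (\<lambda>s. \<bar>s\<bar> / r)"
    using sum_law_moments(1)[of n] by simp
  have "(\<integral>s. \<bar>s\<bar> / r \<partial>L n) \<le> (\<integral>s. (1 + s\<^sup>2 / r\<^sup>2) / 2 \<partial>L n)"
  proof (intro integral_mono i)
    show "\<bar>s\<bar> / r \<le> (1 + s\<^sup>2 / r\<^sup>2) / 2" for s
      using zero_le_power2[of "\<bar>s\<bar> / r - 1"] by (simp add: power2_diff power_divide mult.commute add.commute)
  qed (use sum_law_moments(2)[of n] in auto)
  also have "\<dots> = (1 + n / r\<^sup>2) / 2"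
    using sum_law_moments(2,4)[of n] L.prob_space by simp
  also have "\<dots> \<le> 1" unfolding r2 by (simp add: field_simps)
  finally show "(\<integral>s. \<bar>s\<bar> / r \<partial>L n) \<le> 1" .
qed

text \<open>13 = 7 + 2 + 4. The absolute part gives 7. In the indicator part the minimum is used as
  \<open>y / \<kappa>\<close> against \<open>2 * \<kappa> + 2 * \<delta>\<close>, and as 1 against
  the widening \<open>4 * y\<close> of the interval.\<close>

lemma ramp_mod_integral:
  assumes y: "0 \<le> y"
  shows "integrable (L n) (\<lambda>s. ramp_mod z \<kappa> (s / r) y)" (is ?i)
    and "(\<integral>s. ramp_mod z \<kappa> (s / r) y \<partial>L n) \<le> y * (13 + 2 * \<delta> / \<kappa>)" (is ?le)
proof -
  interpret L: prob_space "L n" by (rule prob_space_sum_law)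
  let ?A = "{s. s / r \<in> {z - y<..z + \<kappa> + y}}"
  have A: "?A \<in> sets (L n)" by simp
  have eq: "ramp_mod z \<kappa> (s / r) y = y * (5 + 2 * (\<bar>s\<bar> / r)) + min 1 (y / \<kappa>) * indicator ?A s" for s
    using r_pos by (auto simp: ramp_mod_def indicator_def)
  have i1: "integrable (L n) (\<lambda>s. y * (5 + 2 * (\<bar>s\<bar> / r)))"
    using integrable_abs_sum by (intro integrable_mult_right Bochner_Integration.integrable_add) auto
  have i2: "integrable (L n) (\<lambda>s. min 1 (y / \<kappa>) * indicator ?A s)"
    using A by (intro integrable_mult_right L.integrable_const_bound[of _ 1]) auto
  show ?i unfolding eq by (intro Bochner_Integration.integrable_add i1 i2)
  have "(\<integral>s. ramp_mod z \<kappa> (s / r) y \<partial>L n)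
      = (\<integral>s. y * (5 + 2 * (\<bar>s\<bar> / r)) \<partial>L n) + (\<integral>s. min 1 (y / \<kappa>) * indicator ?A s \<partial>L n)"
    unfolding eq by (rule Bochner_Integration.integral_add[OF i1 i2])
  also have "(\<integral>s. min 1 (y / \<kappa>) * indicator ?A s \<partial>L n) = min 1 (y / \<kappa>) * measure (L n) ?A"
    using A by simp
  also have "(\<integral>s. y * (5 + 2 * (\<bar>s\<bar> / r)) \<partial>L n) = y * (5 + 2 * (\<integral>s. \<bar>s\<bar> / r \<partial>L n))"
    using integrable_abs_sum(1) L.prob_space by (simp del: times_divide_eq_right)
  also have "y * (5 + 2 * (\<integral>s. \<bar>s\<bar> / r \<partial>L n)) + min 1 (y / \<kappa>) * measure (L n) ?A
     \<le> y * (5 + 2 * 1) + min 1 (y / \<kappa>) * (2 * (\<kappa> + 2 * y) + 2 * \<delta>)"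
    using y kappa by (intro add_mono mult_left_mono measure_interval_le integrable_abs_sum) auto
  also have "min 1 (y / \<kappa>) * (2 * (\<kappa> + 2 * y) + 2 * \<delta>)
     = min 1 (y / \<kappa>) * (2 * \<kappa> + 2 * \<delta>) + min 1 (y / \<kappa>) * (4 * y)" by (simp add: algebra_simps)
  also have "\<dots> \<le> y / \<kappa> * (2 * \<kappa> + 2 * \<delta>) + 1 * (4 * y)"
    using y kappa delta_nonneg by (intro add_mono mult_right_mono) auto
  also have "y * (5 + 2 * 1) + (y / \<kappa> * (2 * \<kappa> + 2 * \<delta>) + 1 * (4 * y)) = y * (13 + 2 * \<delta> / \<kappa>)"
    using kappa by (simp add: field_simps)
  finally show ?le by simp
qed

text \<open>Stein's equation turns the left-hand side into E f'(W) - E W f(W) for the normalised sum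
  W. Exchangeability isolates one summand, and after subtracting terms of known mean only
  first-order Taylor remainders in that summand are left, which \<open>ramp_mod\<close>
  controls.\<close>

lemma stein_step:
  "\<bar>(\<integral>s. ramp z \<kappa> (s / r) \<partial>L (Suc n)) - normal_exp (ramp z \<kappa>)\<bar> \<le> 2 * \<gamma> / r * (13 + 2 * \<delta> / \<kappa>)"
proof -
  interpret L: prob_space "L n" by (rule prob_space_sum_law)
  interpret L': prob_space "L (Suc n)" by (rule prob_space_sum_law)
  interpret P: pair_prob_space \<mu> "L n" ..
  note pm = pair_integral_mult[OF prob_space_axioms prob_space_sum_law[of n]]
  note [measurable] = sol_measurable[OF kappa] dsol_measurable[OF kappa] ramp_measurable[OF kappa]
  let ?Q = "\<mu> \<Otimes>\<^sub>M L n"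
  let ?f = "sol z \<kappa>" and ?d = "dsol z \<kappa>"
  note fb = sol_bound[OF kappa, of z] and db = dsol_bound[OF kappa, of z]
  have Nr: "real (Suc n) = r * r" using r2 by (simp add: power2_eq_square)
  have i_d: "integrable (L n) (\<lambda>s. ?d (s / r))" "integrable (L n) (\<lambda>s. ?f (s / r))"
    by (rule L.integrable_const_bound[of _ 2]; use db in auto)
       (rule L.integrable_const_bound[of _ 5]; use fb in auto)
  have c: "integrable \<mu> (\<lambda>_. 1::real)" "integrable (L n) (\<lambda>_. 1::real)" by auto
  have i1: "integrable ?Q (\<lambda>z. ?d ((fst z + snd z) / r))"
    by (rule P.integrable_const_bound[of _ 2]) (use db in auto)
  have i2: "integrable ?Q (\<lambda>z. fst z * ?f ((fst z + snd z) / r))"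
  proof (rule Bochner_Integration.integrable_bound)
    show "integrable ?Q (\<lambda>z. fst z * 5)" using pm(1)[OF int1 c(2)] by simp
    show "AE z in ?Q. norm (fst z * ?f ((fst z + snd z) / r)) \<le> norm (fst z * 5)"
      using fb by (auto simp: abs_mult intro!: mult_left_mono)
  qed measurable
  note i3 = pm(1)[OF c(1) i_d(1)] pm(1)[OF int2 i_d(1)] pm(1)[OF int1 i_d(2)]
  note e3 = pm(2)[OF c(1) i_d(1)] pm(2)[OF int2 i_d(1)] pm(2)[OF int1 i_d(2)]
  have i4: "integrable (L (Suc n)) (\<lambda>s. ?d (s / r))"
    by (rule L'.integrable_const_bound[of _ 2]) (use db in auto)
  have i5: "integrable (L (Suc n)) (\<lambda>s. s * ?f (s / r))"
  proof (rule Bochner_Integration.integrable_bound)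
    show "integrable (L (Suc n)) (\<lambda>s. s * 5)" using sum_law_moments(1)[of "Suc n"] by simp
    show "AE s in L (Suc n). norm (s * ?f (s / r)) \<le> norm (s * 5)"
      using fb by (auto simp: abs_mult intro!: mult_left_mono)
  qed measurable
  have i6: "integrable (L (Suc n)) (\<lambda>s. ramp z \<kappa> (s / r))"
    by (rule L'.integrable_const_bound[of _ 1]) (use ramp_01 kappa in auto)
  have "(\<integral>s. ramp z \<kappa> (s / r) \<partial>L (Suc n)) - normal_exp (ramp z \<kappa>)
      = (\<integral>s. ramp z \<kappa> (s / r) - normal_exp (ramp z \<kappa>) \<partial>L (Suc n))"
    using L'.prob_space by (subst Bochner_Integration.integral_diff[OF i6]) (auto simp del: sum_law.simps)
  also have "\<dots> = (\<integral>s. ?d (s / r) - (s * ?f (s / r)) / r \<partial>L (Suc n))"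
    by (simp add: dsol_def[OF kappa] del: sum_law.simps)
  also have "\<dots> = (\<integral>s. ?d (s / r) \<partial>L (Suc n)) - (\<integral>s. s * ?f (s / r) \<partial>L (Suc n)) / r"
    by (subst Bochner_Integration.integral_diff) (use i4 i5 in \<open>auto simp del: sum_law.simps\<close>)
  also have "(\<integral>s. ?d (s / r) \<partial>L (Suc n)) = (\<integral>z. ?d ((fst z + snd z) / r) \<partial>?Q)"
    by (subst integral_sum_law_Suc) auto
  also have "(\<integral>s. s * ?f (s / r) \<partial>L (Suc n)) = Suc n * (\<integral>z. fst z * ?f ((fst z + snd z) / r) \<partial>?Q)"
    by (rule stein_exchange) (use fb in auto)
  also have "Suc n * (\<integral>z. fst z * ?f ((fst z + snd z) / r) \<partial>?Q) / r = r * (\<integral>z. fst z * ?f ((fst z + snd z) / r) \<partial>?Q)"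
    unfolding Nr using r_pos by simp
  \<comment> \<open>Terms are inserted whose contributions cancel: \<open>fst z\<close> is
    independent of \<open>snd z\<close>, has mean 0 and has second moment 1.\<close>
  also have "(\<integral>z. ?d ((fst z + snd z) / r) \<partial>?Q) - r * (\<integral>z. fst z * ?f ((fst z + snd z) / r) \<partial>?Q)
     = (\<integral>z. (?d ((fst z + snd z) / r) - 1 * ?d (snd z / r))
         - r * (fst z * ?f ((fst z + snd z) / r) - fst z * ?f (snd z / r)) + (fst z)\<^sup>2 * ?d (snd z / r) \<partial>?Q)"
    by (simp only: Bochner_Integration.integral_add Bochner_Integration.integral_diff integrable_mult_right
        integral_mult_right_zero[where c = r] Bochner_Integration.integrable_add Bochner_Integration.integrable_diff i1 i2 i3 e3
        mean0 var1) (use prob_space in simp)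
  finally have eq: "(\<integral>s. ramp z \<kappa> (s / r) \<partial>L (Suc n)) - normal_exp (ramp z \<kappa>) =
     (\<integral>z. (?d ((fst z + snd z) / r) - 1 * ?d (snd z / r))
         - r * (fst z * ?f ((fst z + snd z) / r) - fst z * ?f (snd z / r)) + (fst z)\<^sup>2 * ?d (snd z / r) \<partial>?Q)"
    (is "_ = (\<integral>z. ?F z \<partial>?Q)") .
  \<comment> \<open>The 1 belongs to the increment of the derivative. The square belongs to the
    Taylor remainder, whose prefactor \<open>r * \<bar>x\<bar> * \<bar>e\<bar>\<close> equals
    \<open>x\<^sup>2\<close>.\<close>
  let ?G = "\<lambda>w. (1 + (fst w)\<^sup>2) * ramp_mod z \<kappa> (snd w / r) (\<bar>fst w\<bar> / r)"
  have pt: "\<bar>?F w\<bar> \<le> ?G w" for w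
  proof -
    define x e v where "x = fst w" and "e = fst w / r" and "v = snd w / r"
    have ve: "(fst w + snd w) / r = v + e" and re: "r * e = x"
      using r_pos by (auto simp: v_def e_def x_def field_simps)
    have "?F w = (?d (v + e) - ?d v) - r * x * (?f (v + e) - ?f v - e * ?d v)"
    proof -
      have "r * x * e = x\<^sup>2" using re by (metis mult.assoc mult.commute power2_eq_square)
      moreover have "(x + snd w) / r = v + e" using ve by (simp add: x_def)
      ultimately show ?thesis
        by (simp add: x_def[symmetric] v_def[symmetric] right_diff_distrib mult.assoc[symmetric])
    qed
    also have "\<bar>\<dots>\<bar> \<le> \<bar>?d (v + e) - ?d v\<bar> + \<bar>r * x * (?f (v + e) - ?f v - e * ?d v)\<bar>" by linarith
    also have "\<bar>r * x * (?f (v + e) - ?f v - e * ?d v)\<bar> = r * \<bar>x\<bar> * \<bar>?f (v + e) - ?f v - e * ?d v\<bar>"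
      using r_pos by (simp add: abs_mult)
    also have "\<bar>?d (v + e) - ?d v\<bar> + r * \<bar>x\<bar> * \<bar>?f (v + e) - ?f v - e * ?d v\<bar>
       \<le> ramp_mod z \<kappa> v \<bar>e\<bar> + r * \<bar>x\<bar> * (\<bar>e\<bar> * ramp_mod z \<kappa> v \<bar>e\<bar>)"
      using r_pos by (intro add_mono mult_left_mono dsol_diff sol_taylor kappa) auto
    also have "r * \<bar>x\<bar> * (\<bar>e\<bar> * ramp_mod z \<kappa> v \<bar>e\<bar>) = x\<^sup>2 * ramp_mod z \<kappa> v \<bar>e\<bar>"
      using r_pos by (simp add: x_def e_def abs_divide power2_eq_square)
    also have "ramp_mod z \<kappa> v \<bar>e\<bar> + x\<^sup>2 * ramp_mod z \<kappa> v \<bar>e\<bar> = ?G w"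
      using r_pos by (simp add: x_def v_def e_def abs_divide algebra_simps)
    finally show ?thesis .
  qed
  have G0: "0 \<le> ?G w" for w using pt[of w] abs_ge_zero order.trans by blast
  have iG: "integrable ?Q ?G"
  proof (rule Bochner_Integration.integrable_bound)
    have a3: "integrable \<mu> (\<lambda>x. \<bar>x\<bar> + \<bar>x\<bar>^3)" "integrable \<mu> (\<lambda>x. 1 + x\<^sup>2)"
      using abs_moment_le int3 int2 by auto
    have a4: "integrable (L n) (\<lambda>s. (5 + 2 * (\<bar>s\<bar> / r)) / r)"
      by (intro integrable_divide Bochner_Integration.integrable_add integrable_mult_right integrable_abs
            sum_law_moments) auto
    show "integrable ?Q (\<lambda>w. (\<bar>fst w\<bar> + \<bar>fst w\<bar>^3) * ((5 + 2 * (\<bar>snd w\<bar> / r)) / r) + (1 + (fst w)\<^sup>2) * 1)"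
      by (intro Bochner_Integration.integrable_add pm(1)[OF a3(1) a4] pm(1)[OF a3(2) c(2)])
    show "?G \<in> borel_measurable ?Q" unfolding ramp_mod_def indicator_def greaterThanAtMost_iff by measurable
    have "?G w \<le> (\<bar>fst w\<bar> + \<bar>fst w\<bar>^3) * ((5 + 2 * (\<bar>snd w\<bar> / r)) / r) + (1 + (fst w)\<^sup>2) * 1" for w
    proof -
      have "ramp_mod z \<kappa> (snd w / r) (\<bar>fst w\<bar> / r) \<le> \<bar>fst w\<bar> / r * (5 + 2 * (\<bar>snd w\<bar> / r)) + 1"
        unfolding ramp_mod_def using r_pos by (auto simp: indicator_def)
      then have "?G w \<le> (1 + (fst w)\<^sup>2) * (\<bar>fst w\<bar> / r * (5 + 2 * (\<bar>snd w\<bar> / r)) + 1)"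
        by (intro mult_left_mono) auto
      also have "\<dots> = (\<bar>fst w\<bar> + \<bar>fst w\<bar>\<^sup>2 * \<bar>fst w\<bar>) * ((5 + 2 * (\<bar>snd w\<bar> / r)) / r) + (1 + (fst w)\<^sup>2) * 1"
        using r_pos by (simp add: field_simps)
      also have "\<bar>fst w\<bar>\<^sup>2 * \<bar>fst w\<bar> = \<bar>fst w\<bar> ^ 3" by (simp only: power2_eq_square power3_eq_cube)
      finally show ?thesis .
    qed
    then show "AE w in ?Q. norm (?G w) \<le> norm ((\<bar>fst w\<bar> + \<bar>fst w\<bar>^3) * ((5 + 2 * (\<bar>snd w\<bar> / r)) / r) + (1 + (fst w)\<^sup>2) * 1)"
      using G0 by (intro AE_I2) (smt (verit) real_norm_def)
  qed
  have "\<bar>\<integral>z. ?F z \<partial>?Q\<bar> \<le> (\<integral>w. ?G w \<partial>?Q)"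
    by (rule order.trans[OF integral_abs_bound], rule integral_mono_AE'[OF iG]) (use pt G0 in simp_all)
  also have "\<dots> = (\<integral>x. \<integral>s. (1 + x\<^sup>2) * ramp_mod z \<kappa> (s / r) (\<bar>x\<bar> / r) \<partial>L n \<partial>\<mu>)"
    using P.integral_fst'[OF iG] by simp
  also have "\<dots> \<le> (\<integral>x. (\<bar>x\<bar> + \<bar>x\<bar>^3) * ((13 + 2 * \<delta> / \<kappa>) / r) \<partial>\<mu>)"
  proof (rule integral_mono)
    show "integrable \<mu> (\<lambda>x. \<integral>s. (1 + x\<^sup>2) * ramp_mod z \<kappa> (s / r) (\<bar>x\<bar> / r) \<partial>L n)"
      using P.integrable_fst'[OF iG] by simp
    show "integrable \<mu> (\<lambda>x. (\<bar>x\<bar> + \<bar>x\<bar>^3) * ((13 + 2 * \<delta> / \<kappa>) / r))"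
      using abs_moment_le int3 by auto
    fix x
    have "(\<integral>s. (1 + x\<^sup>2) * ramp_mod z \<kappa> (s / r) (\<bar>x\<bar> / r) \<partial>L n) = (1 + x\<^sup>2) * (\<integral>s. ramp_mod z \<kappa> (s / r) (\<bar>x\<bar> / r) \<partial>L n)"
      by simp
    also have "\<dots> \<le> (1 + x\<^sup>2) * (\<bar>x\<bar> / r * (13 + 2 * \<delta> / \<kappa>))"
      using r_pos by (intro mult_left_mono ramp_mod_integral) auto
    also have "\<dots> = (\<bar>x\<bar> + \<bar>x\<bar>\<^sup>2 * \<bar>x\<bar>) * ((13 + 2 * \<delta> / \<kappa>) / r)"
      using r_pos kappa by (simp add: field_simps)
    also have "\<bar>x\<bar>\<^sup>2 * \<bar>x\<bar> = \<bar>x\<bar> ^ 3" by (simp only: power2_eq_square power3_eq_cube)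
    finally show "(\<integral>s. (1 + x\<^sup>2) * ramp_mod z \<kappa> (s / r) (\<bar>x\<bar> / r) \<partial>L n) \<le> (\<bar>x\<bar> + \<bar>x\<bar>^3) * ((13 + 2 * \<delta> / \<kappa>) / r)" .
  qed
  also have "\<dots> = ((\<integral>x. \<bar>x\<bar> \<partial>\<mu>) + \<gamma>) * ((13 + 2 * \<delta> / \<kappa>) / r)"
    unfolding \<gamma>_def using abs_moment_le(1) int3 by simp
  \<comment> \<open>The first absolute moment is at most 1, hence at most
    \<open>\<gamma>\<close>.\<close>
  also have "\<dots> \<le> (2 * \<gamma>) * ((13 + 2 * \<delta> / \<kappa>) / r)"
    using abs_moment_le delta_nonneg kappa r_pos by (intro mult_right_mono) auto
  finally show ?thesis unfolding eq by simp
qed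

end

text \<open>
  For the width \<open>8\<gamma>/\<surd>(n + 1)\<close> of the ramp, the error for \<open>n\<close> enters the bound for \<open>n + 1\<close> with the factor \<open>1/2\<close>
  only, so that the induction closes.
\<close>

theorem berry_esseen_law:
  assumes "1 \<le> n"
  shows "\<bar>measure (L n) {..u * sqrt n} - Phi u\<bar> \<le> 120 * \<gamma> / sqrt n"
  using assms
proof (induction n arbitrary: u rule: nat_induct_at_least)
  case base
  interpret L: prob_space "L 1" by (rule prob_space_sum_law)
  have "\<bar>measure (L 1) {..u * sqrt (real 1)} - Phi u\<bar> \<le> 1"
    using L.prob_le_1[of "{..u * sqrt (real 1)}"] measure_nonneg[of "L 1" "{..u * sqrt (real 1)}"]
      Phi_nonneg[of u] Phi_le_1[of u] by linarith
  then show ?case using abs_moment_le(3) by simp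
next
  case (Suc n)
  define r where "r = sqrt (real (Suc n))"
  define \<delta> where "\<delta> = 120 * \<gamma> / sqrt n"
  define \<kappa> where "\<kappa> = 8 * \<gamma> / r"
  have r: "0 < r" by (simp add: r_def)
  have g: "0 < \<gamma>" using abs_moment_le by simp
  have k: "0 < \<kappa>" using r g by (simp add: \<kappa>_def)
  have clt: "\<bar>measure (L n) {..v * sqrt n} - Phi v\<bar> \<le> \<delta>" for v
    unfolding \<delta>_def by (rule Suc.IH)
  define err where "err = 2 * \<gamma> / r * (13 + 2 * \<delta> / \<kappa>)"
  note st = stein_step[OF Suc.hyps k r_def clt, folded err_def]
  interpret L: prob_space "L (Suc n)" by (rule prob_space_sum_law)
  have i: "integrable (L (Suc n)) (\<lambda>s. ramp z \<kappa> (s / r))" for z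
    using ramp_measurable[OF k, of z] ramp_01[OF k, of z]
    by (intro L.integrable_const_bound[of _ 1]) auto
  have S: "{..u * r} \<in> sets (L (Suc n))" by simp
  have ind: "(indicator {..u * r} s :: real) = indicator {..u} (s / r)" for s
    using r by (auto simp: indicator_def field_simps)
  have m: "measure (L (Suc n)) {..u * r} = (\<integral>s. indicator {..u} (s / r) \<partial>L (Suc n))"
    unfolding ind[symmetric] by (simp del: sum_law.simps)
  have im: "integrable (L (Suc n)) (\<lambda>s. indicator {..u} (s / r) :: real)"
    unfolding ind[symmetric] using S by (simp del: sum_law.simps add: L.emeasure_eq_measure)
  have "measure (L (Suc n)) {..u * r} \<le> (\<integral>s. ramp u \<kappa> (s / r) \<partial>L (Suc n))"
    unfolding m by (intro integral_mono im i ramp_indicator k)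
  also have "\<dots> \<le> normal_exp (ramp u \<kappa>) + err" using st[of u] by linarith
  also have "\<dots> \<le> Phi u + \<kappa> + err"
    using normal_exp_ramp(2)[OF k, of u] Phi_Lipschitz[of "u + \<kappa>" u] k by linarith
  finally have up: "measure (L (Suc n)) {..u * r} \<le> Phi u + \<kappa> + err" .
  \<comment> \<open>For the lower bound the ramp is shifted so that it ends at \<open>u\<close> and
    lies below the indicator of \<open>{..u}\<close>.\<close>
  have "Phi u - \<kappa> - err \<le> normal_exp (ramp (u - \<kappa>) \<kappa>) - err"
    using normal_exp_ramp(1)[OF k, of "u - \<kappa>"] Phi_Lipschitz[of "u - \<kappa>" u] k by linarith
  also have "\<dots> \<le> (\<integral>s. ramp (u - \<kappa>) \<kappa> (s / r) \<partial>L (Suc n))" using st[of "u - \<kappa>"] by linarith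
  also have "\<dots> \<le> measure (L (Suc n)) {..u * r}"
    unfolding m using ramp_indicator(2)[OF k, of "u - \<kappa>"] by (intro integral_mono im i) simp
  finally have "\<bar>measure (L (Suc n)) {..u * r} - Phi u\<bar> \<le> \<kappa> + err" using up by linarith
  \<comment> \<open>The ramp contributes 8, the Stein step 26 and, through the choice of
    \<open>\<kappa>\<close>, half of \<open>\<delta>\<close>.\<close>
  also have "\<kappa> + err = 34 * \<gamma> / r + \<delta> / 2"
    unfolding err_def \<kappa>_def using r g by (simp add: field_simps)
  also have "\<delta> \<le> 170 * \<gamma> / r"
  proof -
    have "r \<le> sqrt (2 * n)" unfolding r_def using Suc.hyps by (intro real_sqrt_le_mono) linarith
    \<comment> \<open>17/12 is a rational bound for sqrt 2, and 120 * 17/12 = 170. Then 34 + 170/2 =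
      119 stays below 120.\<close>
    also have "\<dots> \<le> 17 / 12 * sqrt n"
      unfolding real_sqrt_mult by (intro mult_right_mono real_le_lsqrt) (auto simp: power2_eq_square)
    finally have "120 * r \<le> 170 * sqrt n" by simp
    then have "\<gamma> * (120 * r) \<le> \<gamma> * (170 * sqrt n)" using g by (intro mult_left_mono) auto
    then show ?thesis unfolding \<delta>_def using r Suc.hyps by (simp add: field_simps)
  qed
  also have "34 * \<gamma> / r + 170 * \<gamma> / r / 2 \<le> 120 * \<gamma> / r" using g r by (simp add: field_simps)
  finally show ?case by (simp add: r_def)
qed

end

section \<open>From convolution powers to independent random variables\<close>

lemma (in prob_space) distr_sum_sum_law:
  assumes "finite I" "indep_vars (\<lambda>_. borel) X I" "\<And>i. i \<in> I \<Longrightarrow> distr M borel (X i) = \<mu>"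
  shows "distr M borel (\<lambda>\<omega>. \<Sum>i\<in>I. X i \<omega>) = sum_law \<mu> (card I)"
  using assms
proof (induction I rule: finite_induct)
  case empty
  show ?case by simp
next
  case (insert i I)
  have ind: "indep_vars (\<lambda>_. borel) X I" by (rule indep_vars_subset[OF insert.prems(1)]) auto
  have [measurable]: "X i \<in> borel_measurable M" "(\<lambda>\<omega>. \<Sum>i\<in>I. X i \<omega>) \<in> borel_measurable M"
    using insert.prems(1) ind unfolding indep_vars_def by (auto intro!: borel_measurable_sum)
  have "indep_var borel (X i) borel (\<lambda>\<omega>. \<Sum>i\<in>I. X i \<omega>)"
    using insert by (intro indep_vars_sum) auto
  then have "distr M (borel \<Otimes>\<^sub>M borel) (\<lambda>\<omega>. (X i \<omega>, \<Sum>i\<in>I. X i \<omega>)) = \<mu> \<Otimes>\<^sub>M sum_law \<mu> (card I)"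
    using insert.IH[OF ind] insert.prems(2) by (simp add: indep_var_distribution_eq)
  then have "sum_law \<mu> (card (insert i I))
      = distr (distr M (borel \<Otimes>\<^sub>M borel) (\<lambda>\<omega>. (X i \<omega>, \<Sum>i\<in>I. X i \<omega>))) borel (\<lambda>z. fst z + snd z)"
    using insert.hyps by simp
  also have "\<dots> = distr M borel (\<lambda>\<omega>. \<Sum>i\<in>insert i I. X i \<omega>)"
    using insert.hyps by (subst distr_distr) (auto simp: comp_def)
  finally show ?case by simp
qed

text \<open>Division by \<open>s\<close> standardises the increments; the third absolute moment of
  the standardised law is the original one divided by \<open>s ^ 3\<close>.\<close>

theorem (in prob_space) berry_esseen_iid:
  fixes X :: "'i \<Rightarrow> 'a \<Rightarrow> real"
  assumes fin: "finite I" "I \<noteq> {}" and ind: "indep_vars (\<lambda>_. borel) X I"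
    and law: "\<And>i. i \<in> I \<Longrightarrow> distr M borel (X i) = \<mu>"
    and s: "0 < s" and m: "integrable \<mu> (\<lambda>x. x)" "(\<integral>x. x \<partial>\<mu>) = 0"
    and v: "integrable \<mu> (\<lambda>x. x\<^sup>2)" "(\<integral>x. x\<^sup>2 \<partial>\<mu>) = s\<^sup>2"
    and i3: "integrable \<mu> (\<lambda>x. \<bar>x\<bar> ^ 3)"
  shows "\<bar>prob {\<omega> \<in> space M. (\<Sum>i\<in>I. X i \<omega>) \<le> u * (s * sqrt (card I))} - Phi u\<bar>
    \<le> 120 * (\<integral>x. \<bar>x\<bar> ^ 3 \<partial>\<mu>) / (s ^ 3 * sqrt (card I))"
proof -
  obtain i where i: "i \<in> I" using fin by auto
  have Xm [measurable]: "X i \<in> borel_measurable M" if "i \<in> I" for i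
    using ind that unfolding indep_vars_def by auto
  interpret mu: prob_space \<mu> using law[OF i] prob_space_distr[OF Xm[OF i]] by simp
  have [measurable_cong, simp]: "sets \<mu> = sets borel" using law[OF i] by (metis sets_distr)
  define \<mu>' where "\<mu>' = distr \<mu> borel (\<lambda>x. x / s)"
  have [simp]: "sets \<mu>' = sets borel" "space \<mu>' = UNIV" by (auto simp: \<mu>'_def)
  have pr: "prob_space \<mu>'" unfolding \<mu>'_def by (rule mu.prob_space_distr) simp
  have e: "integrable \<mu>' f \<longleftrightarrow> integrable \<mu> (\<lambda>x. f (x / s))" "(\<integral>x. f x \<partial>\<mu>') = (\<integral>x. f (x / s) \<partial>\<mu>)"
    if "f \<in> borel_measurable borel" for f :: "real \<Rightarrow> real"
    unfolding \<mu>'_def using that by (auto simp: integral_distr integrable_distr_eq)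
  have "std_increment \<mu>'"
  proof (intro std_increment.intro std_increment_axioms.intro)
    show "real_distribution \<mu>'" using pr by (simp add: real_distribution_def real_distribution_axioms_def)
    show "integrable \<mu>' (\<lambda>x. x)"
      by (subst e(1)) (auto intro: integrable_divide m(1))
    have "(\<integral>x. x / s \<partial>\<mu>) = 0" by (simp only: integral_divide_zero m(2) div_0)
    then show "(\<integral>x. x \<partial>\<mu>') = 0" by (subst e(2)) auto
    show "integrable \<mu>' (\<lambda>x. x\<^sup>2)"
      by (subst e(1)) (auto simp: power_divide intro: integrable_divide v(1))
    have "(\<integral>x. (x / s)\<^sup>2 \<partial>\<mu>) = 1"
      using s by (simp only: power_divide integral_divide_zero v(2)) simp
    then show "(\<integral>x. x\<^sup>2 \<partial>\<mu>') = 1" by (subst e(2)) auto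
    show "integrable \<mu>' (\<lambda>x. \<bar>x\<bar> ^ 3)"
      by (subst e(1)) (auto simp: power_divide abs_divide intro: integrable_divide i3)
  qed
  then interpret S: std_increment \<mu>' .
  have "distr M borel (\<lambda>\<omega>. \<Sum>i\<in>I. X i \<omega> / s) = sum_law \<mu>' (card I)"
  proof (rule distr_sum_sum_law[OF fin(1)])
    show "indep_vars (\<lambda>_. borel) (\<lambda>i \<omega>. X i \<omega> / s) I"
      by (rule indep_vars_compose2[OF ind]) simp
    show "distr M borel (\<lambda>\<omega>. X i \<omega> / s) = \<mu>'" if "i \<in> I" for i
      unfolding \<mu>'_def law[OF that, symmetric] using that by (subst distr_distr) (auto simp: comp_def)
  qed
  then have "measure (S.L (card I)) {..u * sqrt (card I)}
     = measure (distr M borel (\<lambda>\<omega>. \<Sum>i\<in>I. X i \<omega> / s)) {..u * sqrt (card I)}" by simp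
  also have "\<dots> = prob {\<omega> \<in> space M. (\<Sum>i\<in>I. X i \<omega> / s) \<le> u * sqrt (card I)}"
    by (subst measure_distr) (auto intro!: borel_measurable_sum arg_cong[where f = prob])
  also have "{\<omega> \<in> space M. (\<Sum>i\<in>I. X i \<omega> / s) \<le> u * sqrt (card I)}
      = {\<omega> \<in> space M. (\<Sum>i\<in>I. X i \<omega>) \<le> u * (s * sqrt (card I))}"
    using s by (simp add: sum_divide_distrib[symmetric] pos_divide_le_eq mult_ac)
  finally have eq: "measure (S.L (card I)) {..u * sqrt (card I)}
      = prob {\<omega> \<in> space M. (\<Sum>i\<in>I. X i \<omega>) \<le> u * (s * sqrt (card I))}" .
  have "S.\<gamma> = (\<integral>x. \<bar>x\<bar> ^ 3 \<partial>\<mu>) / s ^ 3"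
    unfolding S.\<gamma>_def using s by (subst e(2)) (auto simp: abs_divide power_divide)
  moreover have "1 \<le> card I" using fin by (simp add: Suc_le_eq card_gt_0_iff)
  ultimately show ?thesis using S.berry_esseen_law[of "card I" u] unfolding eq by simp
qed

section \<open>Moments of sums of centred vectors\<close>

text \<open>Taylor's formula for a power, with \<open>C\<close> dominating both end points. The
  induction multiplies by \<open>p + y\<close>, which therefore has to be nonnegative. For
  \<open>k = 0\<close> the truncated exponent \<open>k - 1\<close> does no harm because of the
  factor \<open>k\<close>.\<close>

lemma power_add_le_taylor:
  fixes p y C :: real
  assumes "0 \<le> p" "0 \<le> p + y" "p \<le> C" "p + y \<le> C"
  shows "(p + y) ^ Suc k \<le> p ^ Suc k + real (Suc k) * p ^ k * y + real k * real (Suc k) / 2 * y\<^sup>2 * C ^ (k - 1)"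
proof (induction k)
  case 0
  then show ?case by simp
next
  case (Suc k)
  have C: "0 \<le> C" using assms by linarith
  have 1: "real k * C ^ (k - 1) * (p + y) \<le> real k * C ^ k"
  proof (cases k)
    case (Suc j)
    have "C ^ j * (p + y) \<le> C ^ j * C" by (intro mult_left_mono assms) (use C in auto)
    then have "real k * (C ^ j * (p + y)) \<le> real k * (C ^ j * C)" by (rule mult_left_mono) simp
    then show ?thesis using Suc by (simp add: mult_ac)
  qed simp
  have 2: "p ^ k \<le> C ^ k" using assms by (intro power_mono)
  have "(p + y) ^ Suc (Suc k) = (p + y) ^ Suc k * (p + y)" by (simp add: mult_ac)
  also have "\<dots> \<le> (p ^ Suc k + real (Suc k) * p ^ k * y + real k * real (Suc k) / 2 * y\<^sup>2 * C ^ (k - 1)) * (p + y)"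
    by (intro mult_right_mono Suc.IH assms)
  also have "\<dots> = p ^ Suc (Suc k) + real (Suc (Suc k)) * p ^ Suc k * y + real (Suc k) * y\<^sup>2 * p ^ k
      + real (Suc k) / 2 * y\<^sup>2 * (real k * C ^ (k - 1) * (p + y))"
    by (simp add: field_simps power2_eq_square)
  also have "\<dots> \<le> p ^ Suc (Suc k) + real (Suc (Suc k)) * p ^ Suc k * y + real (Suc k) * y\<^sup>2 * C ^ k
      + real (Suc k) / 2 * y\<^sup>2 * (real k * C ^ k)"
    by (intro add_left_mono add_mono mult_left_mono 1 2 order.refl) auto
  also have "\<dots> = p ^ Suc (Suc k) + real (Suc (Suc k)) * p ^ Suc k * y
      + real (Suc k) * real (Suc (Suc k)) / 2 * y\<^sup>2 * C ^ (Suc k - 1)"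
    by (simp add: algebra_simps)
  finally show ?case .
qed

text \<open>\<open>A\<close> and \<open>b\<close> are the norms of two vectors and \<open>X\<close>
  is their inner product. Taylor's formula is used with \<open>y = 2 * X + b\<^sup>2\<close> and
  \<open>C = (A + b)\<^sup>2\<close>, where y^2 \<le> 4 b^2 C. The share of b^2 in the linear term
  moves into the remainder, so that the only linear term left is the one in \<open>X\<close>, which
  will integrate to 0.\<close>

lemma norm_power_taylor:
  fixes A b X :: real
  assumes "0 \<le> A" "0 \<le> b" "\<bar>X\<bar> \<le> A * b"
  shows "(A\<^sup>2 + 2 * X + b\<^sup>2) ^ Suc k
    \<le> (A\<^sup>2) ^ Suc k + 2 * real (Suc k) * ((A\<^sup>2) ^ k * X) + 2 * (real (Suc k))\<^sup>2 * (((A + b)\<^sup>2) ^ k * b\<^sup>2)"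
proof -
  define y C where "y = 2 * X + b\<^sup>2" and "C = (A + b)\<^sup>2"
  have Ab: "0 \<le> A * b" using assms by simp
  have sq: "(A - b)\<^sup>2 = A\<^sup>2 - 2 * (A * b) + b\<^sup>2" "C = A\<^sup>2 + 2 * (A * b) + b\<^sup>2"
    unfolding C_def by (simp_all add: power2_diff power2_sum)
  have a: "0 \<le> A\<^sup>2" "0 \<le> A\<^sup>2 + y" "A\<^sup>2 \<le> C" "A\<^sup>2 + y \<le> C"
    using assms(3) Ab zero_le_power2[of "A - b"] unfolding y_def sq by (auto simp: abs_le_iff)
  have y2: "y\<^sup>2 \<le> 4 * b\<^sup>2 * C"
  proof -
    have "\<bar>y\<bar> \<le> 2 * b * (A + b)"
      using assms(3) Ab zero_le_square[of b] unfolding y_def abs_le_iff power2_eq_square by argo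
    then have "y\<^sup>2 \<le> (2 * b * (A + b))\<^sup>2" by (metis abs_ge_zero power2_abs power_mono)
    then show ?thesis by (simp add: C_def power_mult_distrib)
  qed
  have b1: "real k * y\<^sup>2 * C ^ (k - 1) \<le> real k * (4 * b\<^sup>2 * C ^ k)"
  proof (cases k)
    case (Suc j)
    have "y\<^sup>2 * C ^ j \<le> 4 * b\<^sup>2 * C * C ^ j" using y2 a by (intro mult_right_mono) auto
    then have "real k * (y\<^sup>2 * C ^ j) \<le> real k * (4 * b\<^sup>2 * C * C ^ j)" by (rule mult_left_mono) simp
    then show ?thesis using Suc by (simp add: mult_ac)
  qed simp
  have b2: "(A\<^sup>2) ^ k \<le> C ^ k" using a by (intro power_mono) auto
  have "(A\<^sup>2 + y) ^ Suc k \<le> (A\<^sup>2) ^ Suc k + real (Suc k) * (A\<^sup>2) ^ k * y + real k * real (Suc k) / 2 * y\<^sup>2 * C ^ (k - 1)"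
    by (rule power_add_le_taylor[OF a])
  also have "\<dots> = (A\<^sup>2) ^ Suc k + 2 * real (Suc k) * ((A\<^sup>2) ^ k * X) + real (Suc k) * b\<^sup>2 * (A\<^sup>2) ^ k
      + real (Suc k) / 2 * (real k * y\<^sup>2 * C ^ (k - 1))"
    unfolding y_def by (simp add: algebra_simps)
  also have "\<dots> \<le> (A\<^sup>2) ^ Suc k + 2 * real (Suc k) * ((A\<^sup>2) ^ k * X) + real (Suc k) * b\<^sup>2 * C ^ k
      + real (Suc k) / 2 * (real k * (4 * b\<^sup>2 * C ^ k))"
    by (intro add_mono mult_left_mono b1 b2) auto
  also have "\<dots> = (A\<^sup>2) ^ Suc k + 2 * real (Suc k) * ((A\<^sup>2) ^ k * X)
      + real (Suc k) * (2 * real k + 1) * (C ^ k * b\<^sup>2)"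
    by (simp add: algebra_simps)
  also have "\<dots> \<le> (A\<^sup>2) ^ Suc k + 2 * real (Suc k) * ((A\<^sup>2) ^ k * X)
      + 2 * (real (Suc k))\<^sup>2 * (C ^ k * b\<^sup>2)"
  proof (intro add_left_mono mult_right_mono)
    show "real (Suc k) * (2 * real k + 1) \<le> 2 * (real (Suc k))\<^sup>2"
      by (simp add: power2_eq_square algebra_simps)
  qed (use a in auto)
  finally show ?thesis by (simp add: y_def C_def add.assoc)
qed

text \<open>Young's inequality with weight \<open>p\<close>. For \<open>m = max (A / p) b\<close>
  the left-hand side is at most (p + 1)^(2k) m^(2k+2), and (1 + 1/p)^(2k) \<le> e \<le> 3 because
  \<open>p\<close> is at least 2k.\<close>

lemma mixed_power_le:
  fixes A b p :: real
  assumes "0 \<le> A" "0 \<le> b" and p: "0 < p" "2 * real k \<le> p"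
  shows "((A + b)\<^sup>2) ^ k * b\<^sup>2 \<le> 3 * (p\<^sup>2) ^ k * ((A\<^sup>2) ^ Suc k / (p\<^sup>2) ^ Suc k + (b\<^sup>2) ^ Suc k)"
proof -
  define m where "m = max (A / p) b"
  have m0: "0 \<le> m" and mb: "b \<le> m" and mA: "A \<le> p * m"
    using assms by (auto simp: m_def max_def field_simps)
  have "(A + b)\<^sup>2 \<le> ((p + 1) * m)\<^sup>2" using assms mb mA by (intro power_mono) (auto simp: algebra_simps)
  then have "((A + b)\<^sup>2) ^ k * b\<^sup>2 \<le> (((p + 1) * m)\<^sup>2) ^ k * m\<^sup>2"
    using assms mb by (intro mult_mono power_mono) auto
  also have "\<dots> = ((p + 1)\<^sup>2) ^ k * (m\<^sup>2) ^ Suc k"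
    by (simp add: power_mult_distrib mult_ac)
  also have "\<dots> \<le> (3 * (p\<^sup>2) ^ k) * ((A\<^sup>2) ^ Suc k / (p\<^sup>2) ^ Suc k + (b\<^sup>2) ^ Suc k)"
  proof (rule mult_mono)
    have "p + 1 = p * (1 + 1 / p)" using p by (simp add: field_simps)
    then have "((p + 1)\<^sup>2) ^ k = (p * (1 + 1 / p)) ^ (2 * k)" by (simp only: power_mult)
    also have "\<dots> = (p\<^sup>2) ^ k * (1 + 1 / p) ^ (2 * k)" by (simp add: power_mult_distrib power_mult)
    also have "\<dots> \<le> (p\<^sup>2) ^ k * 3"
    proof (rule mult_left_mono)
      have "(1 + 1 / p) ^ (2 * k) \<le> exp (1 / p) ^ (2 * k)"
        using p by (intro power_mono exp_ge_add_one_self) auto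
      also have "\<dots> = exp (2 * k / p)" by (simp flip: exp_of_nat_mult)
      also have "\<dots> \<le> exp 1" using p by simp
      also have "\<dots> \<le> 3" by (rule exp_le)
      finally show "(1 + 1 / p) ^ (2 * k) \<le> 3" .
    qed simp
    finally show "((p + 1)\<^sup>2) ^ k \<le> 3 * (p\<^sup>2) ^ k" by (simp add: mult.commute)
    have "(m\<^sup>2) ^ Suc k \<le> ((A / p)\<^sup>2) ^ Suc k + (b\<^sup>2) ^ Suc k"
      unfolding m_def by (auto simp: max_def)
    also have "((A / p)\<^sup>2) ^ Suc k = (A\<^sup>2) ^ Suc k / (p\<^sup>2) ^ Suc k" by (simp add: power_divide)
    finally show "(m\<^sup>2) ^ Suc k \<le> (A\<^sup>2) ^ Suc k / (p\<^sup>2) ^ Suc k + (b\<^sup>2) ^ Suc k" .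
  qed auto
  finally show ?thesis .
qed

text \<open>Vectors enter only through their Gram kernel, so that one moment bound serves both inner
  products of functions and products of scalars. \<open>G_psd\<close> and \<open>G_CS\<close> are
  positivity and Cauchy-Schwarz for sums, and \<open>G_mean0\<close> is centredness in the weak
  sense.\<close>

locale moment_kernel = prob_space P for P :: "'r measure" +
  fixes G :: "'r \<Rightarrow> 'r \<Rightarrow> real"
  assumes G_meas: "(\<lambda>z. G (fst z) (snd z)) \<in> borel_measurable (P \<Otimes>\<^sub>M P)"
    and G_sym: "G r s = G s r"
    and G_psd: "\<And>w (n::nat). (\<And>i. i < n \<Longrightarrow> w i \<in> space P) \<Longrightarrow> 0 \<le> (\<Sum>i<n. \<Sum>j<n. G (w i) (w j))"
    and G_CS: "\<And>w (n::nat) r. (\<And>i. i < n \<Longrightarrow> w i \<in> space P) \<Longrightarrow> r \<in> space P \<Longrightarrow>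
          (\<Sum>i<n. G (w i) r)\<^sup>2 \<le> (\<Sum>i<n. \<Sum>j<n. G (w i) (w j)) * G r r"
    and G_mean0: "\<And>r. r \<in> space P \<Longrightarrow> (\<integral>s. G r s \<partial>P) = 0"
begin

text \<open>The squared norm of the sum of the first \<open>n\<close> vectors.\<close>

definition Q :: "nat \<Rightarrow> (nat \<Rightarrow> 'r) \<Rightarrow> real" where
  "Q n w = (\<Sum>i<n. \<Sum>j<n. G (w i) (w j))"

abbreviation "Pw n \<equiv> PiM {..<n} (\<lambda>_::nat. P)"

lemma G_comp [measurable (raw)]:
  "f \<in> measurable N P \<Longrightarrow> g \<in> measurable N P \<Longrightarrow> (\<lambda>x. G (f x) (g x)) \<in> borel_measurable N"
  using measurable_compose[OF measurable_Pair G_meas, of f N g] by simp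

lemma Q_measurable [measurable]: "Q n \<in> borel_measurable (Pw n)"
  unfolding Q_def by (intro borel_measurable_sum G_comp measurable_component_singleton) auto

lemma G_diag_nonneg: "r \<in> space P \<Longrightarrow> 0 \<le> G r r"
  using G_psd[of 1 "\<lambda>_. r"] by simp

lemma prob_space_Pi: "prob_space (Pw n)"
  by (rule prob_space_PiM) (rule prob_space_axioms)

lemma Q_Suc: "Q (Suc n) (w(n := r)) = Q n w + 2 * (\<Sum>i<n. G (w i) r) + G r r"
proof -
  have "(\<Sum>i<n. G r (w i)) = (\<Sum>i<n. G (w i) r)" by (intro sum.cong) (auto intro: G_sym)
  then show ?thesis
    unfolding Q_def by (simp add: sum.distrib)
qed

lemma Pi_Suc: "Pw (Suc n) = distr (P \<Otimes>\<^sub>M Pw n) (Pw (Suc n)) (\<lambda>z. (snd z)(n := fst z))"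
  using distr_pair_PiM_eq_PiM[of "{..<n}" "\<lambda>_. P" n] prob_space_axioms
  by (simp add: lessThan_Suc split_def)

lemma Pi_Suc_measurable [measurable]:
  "(\<lambda>z. (snd z)(n := fst z)) \<in> measurable (P \<Otimes>\<^sub>M Pw n) (Pw (Suc n))"
  unfolding lessThan_Suc by (rule measurable_fun_upd[where J = "{..<n}"]) auto

text \<open>
  The summands are added one by one, expanding to second order; the first-order term is centred.
  The factor \<open>12 m\<^sup>2\<close> instead of the optimal \<open>O(m)\<close> is affordable because of the \<open>k\<^sup>2\<close> in \<open>\<delta>\<close>.
\<close>

theorem moment_bound:
  assumes m: "1 \<le> m" and int: "integrable P (\<lambda>r. G r r ^ m)" and le: "(\<integral>r. G r r ^ m \<partial>P) \<le> c"
  shows "integrable (Pw n) (\<lambda>w. Q n w ^ m) \<and> (\<integral>w. Q n w ^ m \<partial>Pw n) \<le> c * (12 * (real m)\<^sup>2 * real n) ^ m"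
proof (induction n)
  case 0
  then show ?case using m by (auto simp: Q_def power_0_left)
next
  case (Suc n)
  obtain k where k: "m = Suc k" using m by (cases m) auto
  define K where "K = 12 * (real m)\<^sup>2"
  have K: "0 < K" using m by (simp add: K_def)
  interpret Pn: prob_space "Pw n" by (rule prob_space_Pi)
  interpret PP: pair_prob_space P "Pw n" ..
  note pm = pair_integral_mult[OF prob_space_axioms prob_space_Pi[of n]]
  let ?PP = "P \<Otimes>\<^sub>M Pw n"
  have c0: "0 \<le> c"
  proof -
    have "0 \<le> (\<integral>r. G r r ^ m \<partial>P)" using G_diag_nonneg by (intro integral_nonneg_AE) auto
    then show ?thesis using le by simp
  qed
  have one: "integrable P (\<lambda>_. 1::real)" "integrable (Pw n) (\<lambda>_. 1::real)" by auto
  have iG: "integrable ?PP (\<lambda>z. G (fst z) (fst z) ^ m)" using pm(1)[OF int one(2)] by simp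
  have eG: "(\<integral>z. G (fst z) (fst z) ^ m \<partial>?PP) = (\<integral>r. G r r ^ m \<partial>P)"
    using pm(2)[OF int one(2)] Pn.prob_space by simp
  have iQ: "integrable ?PP (\<lambda>z. Q n (snd z) ^ m)" using pm(1)[OF one(1), of "\<lambda>w. Q n w ^ m"] Suc.IH by simp
  have eQ: "(\<integral>z. Q n (snd z) ^ m \<partial>?PP) = (\<integral>w. Q n w ^ m \<partial>Pw n)"
    using pm(2)[OF one(1), of "\<lambda>w. Q n w ^ m"] Suc.IH prob_space by simp
  define X where "X = (\<lambda>z. \<Sum>i<n. G (snd z i) (fst z))"
  have [measurable]: "X \<in> borel_measurable ?PP"
    unfolding X_def
    by (intro borel_measurable_sum G_comp measurable_compose[OF measurable_snd] measurable_component_singleton) auto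
  define S where "S = (\<lambda>z. Q (Suc n) ((snd z)(n := fst z)))"
  have [measurable]: "S \<in> borel_measurable ?PP"
    unfolding S_def by measurable
  have S_eq: "S z = Q n (snd z) + 2 * X z + G (fst z) (fst z)" for z
    unfolding S_def X_def by (rule Q_Suc)
  have sp1: "snd z i \<in> space P" if "z \<in> space ?PP" "i < n" for z i
  proof -
    have "snd z \<in> (\<Pi>\<^sub>E i\<in>{..<n}. space P)"
      using that(1) by (simp only: space_pair_measure space_PiM mem_Times_iff)
    then show ?thesis by (rule PiE_mem) (use that in simp)
  qed
  have sp2: "fst z \<in> space P" if "z \<in> space ?PP" for z
    using that by (simp only: space_pair_measure mem_Times_iff)
  have Q0: "0 \<le> Q n (snd z)" if "z \<in> space ?PP" for z
    unfolding Q_def using sp1[OF that] by (rule G_psd)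
  have g0: "0 \<le> G (fst z) (fst z)" if "z \<in> space ?PP" for z
    using sp2[OF that] by (rule G_diag_nonneg)
  have XX: "(X z)\<^sup>2 \<le> Q n (snd z) * G (fst z) (fst z)" if "z \<in> space ?PP" for z
    unfolding Q_def X_def using sp1[OF that] sp2[OF that] by (rule G_CS)
  have S0: "0 \<le> S z" if "z \<in> space ?PP" for z
    unfolding S_def Q_def
  proof (rule G_psd)
    show "((snd z)(n := fst z)) i \<in> space P" if "i < Suc n" for i
      using sp1[of z i] sp2[of z] \<open>z \<in> space ?PP\<close> that by (cases "i = n") auto
  qed
  have Xab: "\<bar>X z\<bar> \<le> sqrt (Q n (snd z)) * sqrt (G (fst z) (fst z))" if "z \<in> space ?PP" for z
    using XX[OF that] by (metis real_sqrt_abs real_sqrt_le_mono real_sqrt_mult)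
  have tail: "integrable (Pw (Suc n)) (\<lambda>w. Q (Suc n) w ^ m) \<longleftrightarrow> integrable ?PP (\<lambda>z. S z ^ m)"
    "(\<integral>w. Q (Suc n) w ^ m \<partial>Pw (Suc n)) = (\<integral>z. S z ^ m \<partial>?PP)"
    unfolding S_def by (subst Pi_Suc, subst integrable_distr_eq integral_distr; measurable)+
  show ?case
  proof (cases "n = 0")
    \<comment> \<open>Kept apart because the weight \<open>sqrt (K * n)\<close> used below vanishes
      for \<open>n = 0\<close>.\<close>
    case True
    have "S z = G (fst z) (fst z)" for z unfolding S_eq using True by (simp add: Q_def X_def)
    moreover have "1 \<le> (12 * (real m)\<^sup>2 * real (Suc n)) ^ m"
    proof (rule one_le_power)
      have "1 \<le> (real m)\<^sup>2" using m by (intro one_le_power) simp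
      then show "1 \<le> 12 * (real m)\<^sup>2 * real (Suc n)" using True by simp
    qed
    then have "c * 1 \<le> c * (12 * (real m)\<^sup>2 * real (Suc n)) ^ m" using c0 by (intro mult_left_mono)
    ultimately show ?thesis unfolding tail using iG eG le by auto
  next
    case False
    \<comment> \<open>With this weight the induction hypothesis bounds both halves of Young's
      inequality by \<open>c\<close>, so the remainder contributes 6 m^2 (K n)^k * 2 c = c K (K
      n)^k. Then (K n)^m + K (K n)^k = K (n + 1) (K n)^k closes the induction.\<close>
    define p where "p = sqrt (K * n)"
    have Kn: "0 < K * n" using K False by simp
    have p0: "0 < p" and p2: "p\<^sup>2 = K * n" using Kn by (auto simp: p_def)
    have pk: "2 * real k \<le> p"
      unfolding p_def
    proof (rule real_le_rsqrt)
      have "(2 * real k)\<^sup>2 \<le> (2 * real m)\<^sup>2" by (intro power_mono) (auto simp: k)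
      also have "\<dots> \<le> K * 1" by (simp add: K_def power_mult_distrib)
      also have "\<dots> \<le> K * n" using K False by (intro mult_left_mono) auto
      finally show "(2 * real k)\<^sup>2 \<le> K * n" .
    qed
    define Z where "Z = (\<lambda>z. Q n (snd z) ^ m + 2 * real m * (Q n (snd z) ^ k * X z)
        + 6 * (real m)\<^sup>2 * (K * n) ^ k * (Q n (snd z) ^ m / (K * n) ^ m + G (fst z) (fst z) ^ m))"
    have SZ: "S z ^ m \<le> Z z" if z: "z \<in> space ?PP" for z
    proof -
      define A b where "A = sqrt (Q n (snd z))" and "b = sqrt (G (fst z) (fst z))"
      have Ab: "A\<^sup>2 = Q n (snd z)" "b\<^sup>2 = G (fst z) (fst z)" "0 \<le> A" "0 \<le> b"
        using Q0[OF z] g0[OF z] by (auto simp: A_def b_def)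
      have "S z ^ m = (A\<^sup>2 + 2 * X z + b\<^sup>2) ^ Suc k" unfolding S_eq Ab k ..
      also have "\<dots> \<le> (A\<^sup>2) ^ Suc k + 2 * real (Suc k) * ((A\<^sup>2) ^ k * X z)
          + 2 * (real (Suc k))\<^sup>2 * (((A + b)\<^sup>2) ^ k * b\<^sup>2)"
        by (rule norm_power_taylor) (use Ab Xab[OF z] in \<open>auto simp: A_def b_def\<close>)
      also have "\<dots> \<le> (A\<^sup>2) ^ Suc k + 2 * real (Suc k) * ((A\<^sup>2) ^ k * X z)
          + 2 * (real (Suc k))\<^sup>2 * (3 * (p\<^sup>2) ^ k * ((A\<^sup>2) ^ Suc k / (p\<^sup>2) ^ Suc k + (b\<^sup>2) ^ Suc k))"
        by (intro add_left_mono mult_left_mono mixed_power_le Ab p0 pk) auto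
      also have "\<dots> = Z z" unfolding Z_def p2 Ab k by (simp only: mult.assoc[symmetric])
      finally show ?thesis .
    qed
    have iX: "integrable ?PP (\<lambda>z. Q n (snd z) ^ k * X z)"
    proof (rule Bochner_Integration.integrable_bound[OF Bochner_Integration.integrable_add[OF iQ iG]])
      show "AE z in ?PP. norm (Q n (snd z) ^ k * X z) \<le> norm (Q n (snd z) ^ m + G (fst z) (fst z) ^ m)"
      proof (rule AE_I2)
        fix z assume z: "z \<in> space ?PP"
        define t where "t = max (Q n (snd z)) (G (fst z) (fst z))"
        have t: "Q n (snd z) \<le> t" "G (fst z) (fst z) \<le> t" "0 \<le> t" using Q0[OF z] by (auto simp: t_def)
        have "(X z)\<^sup>2 \<le> t * t" using XX[OF z] t Q0[OF z] g0[OF z] by (meson mult_mono order.trans)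
        then have "\<bar>X z\<bar> \<le> t" using t by (metis abs_le_square_iff abs_of_nonneg power2_eq_square)
        then have "Q n (snd z) ^ k * \<bar>X z\<bar> \<le> t ^ k * t"
          using t Q0[OF z] by (intro mult_mono power_mono) auto
        also have "\<dots> = t ^ m" by (simp add: k)
        also have "\<dots> \<le> Q n (snd z) ^ m + G (fst z) (fst z) ^ m"
          unfolding t_def using Q0[OF z] g0[OF z] by (auto simp: max_def)
        finally show "norm (Q n (snd z) ^ k * X z) \<le> norm (Q n (snd z) ^ m + G (fst z) (fst z) ^ m)"
          using Q0[OF z] g0[OF z] by (simp add: abs_mult)
      qed
    qed measurable
    \<comment> \<open>Integrating over the new vector first, with the old ones fixed, leaves a sum
      of pairings with it, each of mean 0.\<close>
    have eX: "(\<integral>z. Q n (snd z) ^ k * X z \<partial>?PP) = 0"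
    proof -
      have "(\<integral>z. Q n (snd z) ^ k * X z \<partial>?PP) = (\<integral>w. \<integral>r. Q n w ^ k * X (r, w) \<partial>P \<partial>Pw n)"
        using PP.integral_fst'[OF iX] PP.Fubini_integral[of "\<lambda>r w. Q n w ^ k * X (r, w)"] iX
        by (simp add: split_def)
      also have "\<dots> = (\<integral>w. 0 \<partial>Pw n)"
      proof (rule Bochner_Integration.integral_cong[OF refl])
        fix w assume w: "w \<in> space (Pw n)"
        have wi: "w i \<in> space P" if "i < n" for i
          using w that unfolding space_PiM by (intro PiE_mem[of w "{..<n}" "\<lambda>_. space P"]) auto
        have ig: "integrable P (\<lambda>s. G s s)"
        proof (rule Bochner_Integration.integrable_bound[OF Bochner_Integration.integrable_add[OF one(1) int]])
          have "x \<le> 1 + x ^ m" if "0 \<le> x" for x :: real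
            using that m self_le_power[of x m] by (cases "x \<le> 1") (auto simp: add_increasing2)
          then show "AE s in P. norm (G s s) \<le> norm (1 + G s s ^ m)"
            using G_diag_nonneg by (intro AE_I2) (simp add: abs_of_nonneg)
        qed measurable
        have "integrable P (\<lambda>s. G (w i) s)" if i: "i < n" for i
        proof (rule Bochner_Integration.integrable_bound)
          show "integrable P (\<lambda>s. G (w i) (w i) + G s s)" using ig by simp
          show "(\<lambda>s. G (w i) s) \<in> borel_measurable P" using wi[OF i] by measurable
          show "AE s in P. norm (G (w i) s) \<le> norm (G (w i) (w i) + G s s)"
          proof (rule AE_I2)
            fix s assume s: "s \<in> space P"
            have "(G (w i) s)\<^sup>2 \<le> G (w i) (w i) * G s s"
              using G_CS[of 1 "\<lambda>_. w i" s] wi[OF i] s by simp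
            also have "\<dots> \<le> (G (w i) (w i) + G s s)\<^sup>2"
              using G_diag_nonneg[OF s] G_diag_nonneg[OF wi[OF i]] by (simp add: power2_eq_square algebra_simps add_increasing add_increasing2)
            finally show "norm (G (w i) s) \<le> norm (G (w i) (w i) + G s s)"
              by (simp add: abs_le_square_iff)
          qed
        qed
        then have "(\<integral>r. X (r, w) \<partial>P) = (\<Sum>i<n. \<integral>r. G (w i) r \<partial>P)"
          unfolding X_def by (subst Bochner_Integration.integral_sum[symmetric]) auto
        also have "\<dots> = 0" using G_mean0 wi by simp
        finally show "(\<integral>r. Q n w ^ k * X (r, w) \<partial>P) = 0" by simp
      qed
      finally show ?thesis by simp
    qed
    have iZ: "integrable ?PP Z"
      unfolding Z_def by (intro Bochner_Integration.integrable_add integrable_mult_right integrable_divide iQ iX iG)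
    have iS: "integrable ?PP (\<lambda>z. S z ^ m)"
      by (rule Bochner_Integration.integrable_bound[OF iZ], measurable)
         (use SZ S0 in \<open>auto intro!: AE_I2 simp: abs_of_nonneg intro: order.trans[OF _ abs_ge_self]\<close>)
    have "(\<integral>z. S z ^ m \<partial>?PP) \<le> (\<integral>z. Z z \<partial>?PP)" by (intro integral_mono iS iZ SZ)
    also have "\<dots> = (\<integral>z. Q n (snd z) ^ m \<partial>?PP) + 2 * real m * (\<integral>z. Q n (snd z) ^ k * X z \<partial>?PP)
        + 6 * (real m)\<^sup>2 * (K * n) ^ k * ((\<integral>z. Q n (snd z) ^ m \<partial>?PP) / (K * n) ^ m + (\<integral>z. G (fst z) (fst z) ^ m \<partial>?PP))"
      unfolding Z_def using iQ iX iG by simp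
    also have "\<dots> = (\<integral>w. Q n w ^ m \<partial>Pw n)
        + 6 * (real m)\<^sup>2 * (K * n) ^ k * ((\<integral>w. Q n w ^ m \<partial>Pw n) / (K * n) ^ m + (\<integral>r. G r r ^ m \<partial>P))"
      unfolding eX eQ eG by simp
    also have "\<dots> \<le> c * (K * n) ^ m + 6 * (real m)\<^sup>2 * (K * n) ^ k * (c * (K * n) ^ m / (K * n) ^ m + c)"
      using Suc.IH le Kn by (intro add_mono mult_left_mono divide_right_mono) (auto simp: K_def)
    also have "\<dots> = c * ((K * n) ^ m + K * (K * n) ^ k)"
      using Kn False by (simp add: K_def algebra_simps)
    also have "\<dots> \<le> c * (K * Suc n) ^ m"
    proof (rule mult_left_mono[OF _ c0])
      have "(K * n) ^ m + K * (K * n) ^ k = (K * n) ^ k * (K * Suc n)" by (simp add: k algebra_simps)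
      also have "\<dots> \<le> (K * Suc n) ^ k * (K * Suc n)"
        using K by (intro mult_right_mono power_mono mult_left_mono) auto
      finally show "(K * n) ^ m + K * (K * n) ^ k \<le> (K * Suc n) ^ m" by (simp add: k mult_ac)
    qed
    finally show ?thesis unfolding tail using iS by (simp add: K_def)
  qed
qed

end

section \<open>Square-integrable functions\<close>

text \<open>Genuine functions, not classes modulo null sets, so \<open>inner_L2\<close> is only a
  semidefinite form on this set.\<close>

definition L2 :: "'z measure \<Rightarrow> ('z \<Rightarrow> real) set" where
  "L2 \<nu> = {g \<in> borel_measurable \<nu>. integrable \<nu> (\<lambda>z. (g z)\<^sup>2)}"

lemma L2_measurable: "g \<in> L2 \<nu> \<Longrightarrow> g \<in> borel_measurable \<nu>"
  by (simp add: L2_def)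

lemma L2_mult_integrable:
  assumes "f \<in> L2 \<nu>" "g \<in> L2 \<nu>"
  shows "integrable \<nu> (\<lambda>z. f z * g z)"
proof (rule Bochner_Integration.integrable_bound)
  show "integrable \<nu> (\<lambda>z. (f z)\<^sup>2 + (g z)\<^sup>2)" using assms by (simp add: L2_def)
  show "(\<lambda>z. f z * g z) \<in> borel_measurable \<nu>" using assms by (auto simp: L2_def)
  show "AE z in \<nu>. norm (f z * g z) \<le> norm ((f z)\<^sup>2 + (g z)\<^sup>2)"
  proof (rule AE_I2)
    fix z
    have "0 \<le> (\<bar>f z\<bar> - \<bar>g z\<bar>)\<^sup>2" by simp
    then have "2 * (\<bar>f z\<bar> * \<bar>g z\<bar>) \<le> (f z)\<^sup>2 + (g z)\<^sup>2" by (simp add: power2_diff)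
    moreover have "0 \<le> \<bar>f z\<bar> * \<bar>g z\<bar>" by simp
    ultimately have "\<bar>f z\<bar> * \<bar>g z\<bar> \<le> (f z)\<^sup>2 + (g z)\<^sup>2" by linarith
    then show "norm (f z * g z) \<le> norm ((f z)\<^sup>2 + (g z)\<^sup>2)" by (simp add: abs_mult)
  qed
qed

lemma L2_add: "f \<in> L2 \<nu> \<Longrightarrow> g \<in> L2 \<nu> \<Longrightarrow> (\<lambda>z. f z + g z) \<in> L2 \<nu>"
  using L2_mult_integrable[of f \<nu> g] by (auto simp: L2_def power2_sum mult.assoc)

lemma L2_scale: "f \<in> L2 \<nu> \<Longrightarrow> (\<lambda>z. c * f z) \<in> L2 \<nu>"
  by (auto simp: L2_def power_mult_distrib)

lemma L2_diff: "f \<in> L2 \<nu> \<Longrightarrow> g \<in> L2 \<nu> \<Longrightarrow> (\<lambda>z. f z - g z) \<in> L2 \<nu>"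
  using L2_add[of f \<nu> "\<lambda>z. -1 * g z"] L2_scale[of g \<nu> "-1"] by simp

lemma L2_zero: "(\<lambda>z. 0) \<in> L2 \<nu>"
  by (auto simp: L2_def)

lemma L2_sum: "(\<And>i. i \<in> I \<Longrightarrow> f i \<in> L2 \<nu>) \<Longrightarrow> (\<lambda>z. \<Sum>i\<in>I. f i z) \<in> L2 \<nu>"
  by (induction I rule: infinite_finite_induct) (simp_all add: L2_add L2_zero)

lemma inner_L2_sym: "inner_L2 \<nu> f g = inner_L2 \<nu> g f"
  by (simp add: inner_L2_def mult.commute)

lemma inner_L2_add_left:
  "f \<in> L2 \<nu> \<Longrightarrow> g \<in> L2 \<nu> \<Longrightarrow> h \<in> L2 \<nu> \<Longrightarrow>
    inner_L2 \<nu> (\<lambda>z. f z + g z) h = inner_L2 \<nu> f h + inner_L2 \<nu> g h"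
  unfolding inner_L2_def by (simp add: distrib_right L2_mult_integrable)

lemma inner_L2_scale_left: "inner_L2 \<nu> (\<lambda>z. c * f z) h = c * inner_L2 \<nu> f h"
  unfolding inner_L2_def by (simp add: mult.assoc)

lemma inner_L2_diff_left:
  "f \<in> L2 \<nu> \<Longrightarrow> g \<in> L2 \<nu> \<Longrightarrow> h \<in> L2 \<nu> \<Longrightarrow>
    inner_L2 \<nu> (\<lambda>z. f z - g z) h = inner_L2 \<nu> f h - inner_L2 \<nu> g h"
  unfolding inner_L2_def by (simp add: left_diff_distrib L2_mult_integrable)

lemma inner_L2_sum_left:
  "(\<And>i. i \<in> I \<Longrightarrow> f i \<in> L2 \<nu>) \<Longrightarrow> h \<in> L2 \<nu> \<Longrightarrow>
    inner_L2 \<nu> (\<lambda>z. \<Sum>i\<in>I. f i z) h = (\<Sum>i\<in>I. inner_L2 \<nu> (f i) h)"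
  unfolding inner_L2_def by (simp add: sum_distrib_right L2_mult_integrable)

lemma inner_L2_add_right:
  "f \<in> L2 \<nu> \<Longrightarrow> g \<in> L2 \<nu> \<Longrightarrow> h \<in> L2 \<nu> \<Longrightarrow>
    inner_L2 \<nu> h (\<lambda>z. f z + g z) = inner_L2 \<nu> h f + inner_L2 \<nu> h g"
  using inner_L2_add_left[of f \<nu> g h]
  by (simp add: inner_L2_sym[of \<nu> _ h])

lemma inner_L2_diff_right:
  "f \<in> L2 \<nu> \<Longrightarrow> g \<in> L2 \<nu> \<Longrightarrow> h \<in> L2 \<nu> \<Longrightarrow>
    inner_L2 \<nu> h (\<lambda>z. f z - g z) = inner_L2 \<nu> h f - inner_L2 \<nu> h g"
  using inner_L2_diff_left[of f \<nu> g h]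
  by (simp add: inner_L2_sym[of \<nu> _ h])

lemma inner_L2_scale_right: "inner_L2 \<nu> h (\<lambda>z. c * f z) = c * inner_L2 \<nu> h f"
  using inner_L2_scale_left[of \<nu> c f h] by (simp add: inner_L2_sym[of \<nu> _ h])

lemma inner_L2_sum_right:
  "(\<And>i. i \<in> I \<Longrightarrow> f i \<in> L2 \<nu>) \<Longrightarrow> h \<in> L2 \<nu> \<Longrightarrow>
    inner_L2 \<nu> h (\<lambda>z. \<Sum>i\<in>I. f i z) = (\<Sum>i\<in>I. inner_L2 \<nu> h (f i))"
  using inner_L2_sum_left[of I f \<nu> h] by (simp add: inner_L2_sym[of \<nu> _ h])

lemma inner_L2_self_nonneg: "0 \<le> inner_L2 \<nu> f f"
  unfolding inner_L2_def by (intro integral_nonneg_AE) auto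

lemma inner_L2_Cauchy_Schwarz:
  assumes f: "f \<in> L2 \<nu>" and g: "g \<in> L2 \<nu>"
  shows "(inner_L2 \<nu> f g)\<^sup>2 \<le> inner_L2 \<nu> f f * inner_L2 \<nu> g g"
proof -
  let ?a = "inner_L2 \<nu> f f" and ?b = "inner_L2 \<nu> f g" and ?c = "inner_L2 \<nu> g g"
  have q: "0 \<le> ?a + 2 * s * ?b + s\<^sup>2 * ?c" for s
  proof -
    have "0 \<le> inner_L2 \<nu> (\<lambda>z. f z + s * g z) (\<lambda>z. f z + s * g z)" by (rule inner_L2_self_nonneg)
    also have "\<dots> = ?a + 2 * s * ?b + s\<^sup>2 * ?c"
      using f g by (simp add: inner_L2_add_left inner_L2_add_right L2_add L2_scale inner_L2_scale_left
          inner_L2_scale_right inner_L2_sym[of \<nu> g f] power2_eq_square algebra_simps)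
    finally show ?thesis .
  qed
  show ?thesis
  proof (cases "?c = 0")
    case True
    have "?b = 0"
    proof (rule ccontr)
      assume "?b \<noteq> 0"
      \<comment> \<open>At this point the quadratic, here affine in \<open>s\<close>, takes the
        value -1.\<close>
      with q[of "- (?a + 1) / (2 * ?b)"] True show False by (simp add: field_simps)
    qed
    with True show ?thesis by simp
  next
    case False
    then have c: "0 < ?c" using inner_L2_self_nonneg[of \<nu> g] by simp
    \<comment> \<open>The quadratic is evaluated at its minimiser.\<close>
    have "0 \<le> ?c * (?a + 2 * (- ?b / ?c) * ?b + (- ?b / ?c)\<^sup>2 * ?c)"
      by (rule mult_nonneg_nonneg[OF less_imp_le[OF c] q])
    also have "\<dots> = ?a * ?c - ?b\<^sup>2"
      using c by (simp add: field_simps power2_eq_square)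
    finally show ?thesis by simp
  qed
qed

lemma inner_L2_add_self_le:
  assumes f: "f \<in> L2 \<nu>" and g: "g \<in> L2 \<nu>"
  shows "inner_L2 \<nu> (\<lambda>z. f z + g z) (\<lambda>z. f z + g z) \<le> 2 * inner_L2 \<nu> f f + 2 * inner_L2 \<nu> g g"
proof -
  have "0 \<le> inner_L2 \<nu> (\<lambda>z. f z - g z) (\<lambda>z. f z - g z)" by (rule inner_L2_self_nonneg)
  then show ?thesis
    using f g by (simp add: inner_L2_add_left inner_L2_add_right inner_L2_diff_left inner_L2_diff_right
       L2_add L2_diff inner_L2_sym[of \<nu> g f])
qed

lemma inner_L2_diff_self_le:
  assumes f: "f \<in> L2 \<nu>" and g: "g \<in> L2 \<nu>"
  shows "inner_L2 \<nu> (\<lambda>z. f z - g z) (\<lambda>z. f z - g z) \<le> 2 * inner_L2 \<nu> f f + 2 * inner_L2 \<nu> g g"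
proof -
  have "0 \<le> inner_L2 \<nu> (\<lambda>z. f z + g z) (\<lambda>z. f z + g z)" by (rule inner_L2_self_nonneg)
  then show ?thesis
    using f g by (simp add: inner_L2_add_left inner_L2_add_right inner_L2_diff_left inner_L2_diff_right
       L2_add L2_diff inner_L2_sym[of \<nu> g f])
qed

section \<open>Ensemble error and bootstrap error as inner products\<close>

text \<open>In the application \<open>a\<close> is \<open>\<vartheta> - y\<close>, and \<open>u i = T\<^sub>i - \<vartheta>\<close>.\<close>

locale L2_sample =
  fixes \<nu> :: "'z measure" and a :: "'z \<Rightarrow> real" and t :: nat and u :: "nat \<Rightarrow> 'z \<Rightarrow> real"
  assumes a_L2: "a \<in> L2 \<nu>" and u_L2: "\<And>i. i < t \<Longrightarrow> u i \<in> L2 \<nu>" and t_pos: "0 < t"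
begin

abbreviation ip :: "('z \<Rightarrow> real) \<Rightarrow> ('z \<Rightarrow> real) \<Rightarrow> real" where "ip \<equiv> inner_L2 \<nu>"

definition ubar :: "'z \<Rightarrow> real" where "ubar = (\<lambda>z. 1 / t * (\<Sum>i<t. u i z))"
definition zeta' :: "nat \<Rightarrow> real" where "zeta' i = 2 * ip a (u i)"
definition zbar :: real where "zbar = (\<Sum>i<t. zeta' i) / t"
definition excess :: real where "excess = zbar + ip ubar ubar"
text \<open>The empirical counterpart of \<open>zeta'\<close>, with the ensemble average in the
  place of \<vartheta>: \<open>a + ubar\<close> stands for the average minus y, and
  \<open>u j - ubar\<close> for a member minus the average.\<close>

definition zhat :: "nat \<Rightarrow> real" where "zhat j = 2 * ip (\<lambda>z. a z + ubar z) (\<lambda>z. u j z - ubar z)"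
definition boot :: "(nat \<Rightarrow> nat) \<Rightarrow> real" where
  "boot J = ip (\<lambda>z. a z + 1 / t * (\<Sum>i<t. u (J i) z)) (\<lambda>z. a z + 1 / t * (\<Sum>i<t. u (J i) z))
     - ip (\<lambda>z. a z + ubar z) (\<lambda>z. a z + ubar z)"

lemma ubar_L2: "ubar \<in> L2 \<nu>"
  unfolding ubar_def using u_L2 by (intro L2_scale L2_sum) auto

lemma ip_ubar_right: "h \<in> L2 \<nu> \<Longrightarrow> ip h ubar = (\<Sum>i<t. ip h (u i)) / t"
proof -
  assume h: "h \<in> L2 \<nu>"
  have "ip h (\<lambda>z. \<Sum>i<t. u i z) = (\<Sum>i<t. ip h (u i))"
    by (rule inner_L2_sum_right[OF _ h]) (simp add: u_L2)
  then show ?thesis unfolding ubar_def inner_L2_scale_right by simp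
qed

lemma ip_ubar: "ip ubar ubar = (\<Sum>i<t. \<Sum>j<t. ip (u i) (u j)) / (real t)\<^sup>2"
proof -
  have "ip ubar (u i) = (\<Sum>j<t. ip (u i) (u j)) / t" if "i < t" for i
    using ip_ubar_right[OF u_L2[OF that]] by (simp add: inner_L2_sym[of \<nu> ubar])
  then show ?thesis
    by (simp add: ip_ubar_right[OF ubar_L2] sum_divide_distrib power2_eq_square)
qed

lemma zbar_eq: "zbar = 2 * ip a ubar"
  unfolding zbar_def zeta'_def ip_ubar_right[OF a_L2] by (simp add: sum_distrib_left)

lemma excess_eq: "excess = ip (\<lambda>z. a z + ubar z) (\<lambda>z. a z + ubar z) - ip a a"
  unfolding excess_def zbar_eq using a_L2 ubar_L2
  by (simp add: inner_L2_add_left inner_L2_add_right L2_add inner_L2_sym[of \<nu> ubar a])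

text \<open>Jensen's inequality for the squared norm: twice an inner product is at most the sum of
  the two squared norms, and this is summed over all pairs.\<close>

lemma ubar_le_avg: "ip ubar ubar \<le> (\<Sum>i<t. ip (u i) (u i)) / t"
proof -
  have "(\<Sum>i<t. \<Sum>j<t. ip (u i) (u j)) \<le> (\<Sum>i<t. \<Sum>j<t. (ip (u i) (u i) + ip (u j) (u j)) / 2)"
  proof (intro sum_mono)
    fix i j assume "i \<in> {..<t}" "j \<in> {..<t}"
    then have u: "u i \<in> L2 \<nu>" "u j \<in> L2 \<nu>" using u_L2 by auto
    have "0 \<le> ip (\<lambda>z. u i z - u j z) (\<lambda>z. u i z - u j z)" by (rule inner_L2_self_nonneg)
    then show "ip (u i) (u j) \<le> (ip (u i) (u i) + ip (u j) (u j)) / 2"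
      using u by (simp add: inner_L2_diff_left inner_L2_diff_right L2_diff inner_L2_sym[of \<nu> "u j" "u i"])
  qed
  also have "\<dots> = t * (\<Sum>i<t. ip (u i) (u i))"
    by (simp add: sum.distrib sum_divide_distrib[symmetric] sum_distrib_left[symmetric])
  finally show ?thesis unfolding ip_ubar using t_pos
    by (simp add: field_simps power2_eq_square)
qed

text \<open>Hence the resampled linear parts are exactly centred under the bootstrap
  distribution.\<close>

lemma zhat_sum: "(\<Sum>j<t. zhat j) = 0"
proof -
  let ?b = "\<lambda>z. a z + ubar z"
  have b: "?b \<in> L2 \<nu>" using a_L2 ubar_L2 by (rule L2_add)
  have "zhat j = 2 * (ip ?b (u j) - ip ?b ubar)" if "j < t" for j
    unfolding zhat_def using inner_L2_diff_right[OF u_L2[OF that] ubar_L2 b] by simp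
  then have "(\<Sum>j<t. zhat j) = 2 * ((\<Sum>j<t. ip ?b (u j)) - t * ip ?b ubar)"
    by (simp add: sum_subtractf sum_distrib_left)
  also have "t * ip ?b ubar = (\<Sum>j<t. ip ?b (u j))"
    using t_pos by (simp add: ip_ubar_right[OF b])
  finally show ?thesis by simp
qed

lemma boot_ge:
  assumes "\<And>i. i < t \<Longrightarrow> J i < t"
  shows "(\<Sum>i<t. zhat (J i)) / t \<le> boot J"
proof -
  let ?b = "\<lambda>z. a z + ubar z"
  define v where "v = (\<lambda>z. 1 / t * (\<Sum>i<t. u (J i) z - ubar z))"
  have b: "?b \<in> L2 \<nu>" using a_L2 ubar_L2 by (rule L2_add)
  have d: "(\<lambda>z. u (J i) z - ubar z) \<in> L2 \<nu>" if "i \<in> {..<t}" for i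
    using assms that u_L2 ubar_L2 by (intro L2_diff) auto
  have v: "v \<in> L2 \<nu>" unfolding v_def by (intro L2_scale L2_sum d)
  have "(\<lambda>z. a z + 1 / t * (\<Sum>i<t. u (J i) z)) = (\<lambda>z. ?b z + v z)"
    unfolding v_def using t_pos by (auto simp: sum_subtractf field_simps)
  then have "boot J = ip (\<lambda>z. ?b z + v z) (\<lambda>z. ?b z + v z) - ip ?b ?b" by (simp add: boot_def)
  also have "\<dots> = 2 * ip ?b v + ip v v"
    using b v by (simp add: inner_L2_add_left[OF b v] inner_L2_add_right[OF b v] L2_add inner_L2_sym[of \<nu> v ?b])
  also have "\<dots> \<ge> 2 * ip ?b v" using inner_L2_self_nonneg[of \<nu> v] by simp
  also have "2 * ip ?b v = (\<Sum>i<t. zhat (J i)) / t"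
  proof -
    have "ip ?b (\<lambda>z. \<Sum>i<t. u (J i) z - ubar z) = (\<Sum>i<t. ip ?b (\<lambda>z. u (J i) z - ubar z))"
      by (rule inner_L2_sum_right[OF d b])
    then show ?thesis
      unfolding v_def zhat_def inner_L2_scale_right sum_distrib_left[symmetric] by simp
  qed
  finally show ?thesis .
qed

text \<open>The perturbation in parentheses is of the order of the norm of \<open>ubar\<close>, so
  the second moments of \<open>zhat\<close> and \<open>zeta'\<close> over the sample are
  close.\<close>

lemma zhat_eq:
  assumes "j < t"
  shows "zhat j = zeta' j + (2 * ip ubar (\<lambda>z. u j z - ubar z) - zbar)"
proof -
  have d: "(\<lambda>z. u j z - ubar z) \<in> L2 \<nu>" by (rule L2_diff[OF u_L2[OF assms] ubar_L2])
  have "ip (\<lambda>z. a z + ubar z) (\<lambda>z. u j z - ubar z)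
      = ip a (\<lambda>z. u j z - ubar z) + ip ubar (\<lambda>z. u j z - ubar z)"
    by (rule inner_L2_add_left[OF a_L2 ubar_L2 d])
  moreover have "ip a (\<lambda>z. u j z - ubar z) = ip a (u j) - ip a ubar"
    by (rule inner_L2_diff_right[OF u_L2[OF assms] ubar_L2 a_L2])
  ultimately show ?thesis unfolding zhat_def zeta'_def zbar_eq by linarith
qed

text \<open>For the first bound, the squared norm of \<open>a + ubar\<close> is at most 2 * 8 b + 2
  * 4 b = 24 b, and 4 * 24 * 2 = 192. For the second, the two terms are squared separately and
  estimated by Cauchy-Schwarz, so that each keeps the small factor
  \<open>ip ubar ubar\<close>.\<close>

lemma zhat_bounds:
  assumes a: "ip a a \<le> 8 * b" and ub: "ip ubar ubar \<le> 4 * b" and j: "j < t"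
  shows "(zhat j)\<^sup>2 \<le> 192 * b * (ip (u j) (u j) + 4 * b)"
    and "(2 * ip ubar (\<lambda>z. u j z - ubar z) - zbar)\<^sup>2 \<le> 16 * ip ubar ubar * (ip (u j) (u j) + 8 * b)"
proof -
  note [simp] = a_L2 ubar_L2 u_L2[OF j]
  let ?q = "ip ubar ubar" and ?d = "\<lambda>z. u j z - ubar z"
  have d: "?d \<in> L2 \<nu>" by (rule L2_diff) auto
  have dd: "ip ?d ?d \<le> 2 * ip (u j) (u j) + 2 * ?q" by (rule inner_L2_diff_self_le) auto
  have q0: "0 \<le> ?q" "0 \<le> ip (u j) (u j)" "0 \<le> ip ?d ?d" by (auto intro: inner_L2_self_nonneg)
  have b0: "0 \<le> b" using q0 ub by linarith
  have "ip (\<lambda>z. a z + ubar z) (\<lambda>z. a z + ubar z) \<le> 2 * ip a a + 2 * ?q"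
    by (rule inner_L2_add_self_le) auto
  then have bb: "ip (\<lambda>z. a z + ubar z) (\<lambda>z. a z + ubar z) \<le> 24 * b" using a ub by linarith
  have "(zhat j)\<^sup>2 = 4 * (ip (\<lambda>z. a z + ubar z) ?d)\<^sup>2" by (simp add: zhat_def power_mult_distrib)
  also have "\<dots> \<le> 4 * (ip (\<lambda>z. a z + ubar z) (\<lambda>z. a z + ubar z) * ip ?d ?d)"
    by (intro mult_left_mono inner_L2_Cauchy_Schwarz L2_add d) auto
  also have "\<dots> \<le> 4 * (24 * b * (2 * ip (u j) (u j) + 8 * b))"
  proof (intro mult_left_mono mult_mono bb)
    show "ip ?d ?d \<le> 2 * ip (u j) (u j) + 8 * b" using dd ub by linarith
  qed (use q0 b0 in auto)
  finally show "(zhat j)\<^sup>2 \<le> 192 * b * (ip (u j) (u j) + 4 * b)" by (simp add: algebra_simps)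
  have "(2 * ip ubar ?d - zbar)\<^sup>2 \<le> 2 * (2 * ip ubar ?d)\<^sup>2 + 2 * zbar\<^sup>2"
    using zero_le_power2[of "2 * ip ubar ?d + zbar"] by (simp add: power2_sum power2_diff)
  also have "\<dots> = 8 * (ip ubar ?d)\<^sup>2 + 8 * (ip a ubar)\<^sup>2"
    by (simp add: zbar_eq power_mult_distrib)
  also have "\<dots> \<le> 8 * (?q * ip ?d ?d) + 8 * (ip a a * ?q)"
    by (intro add_mono mult_left_mono inner_L2_Cauchy_Schwarz d ubar_L2 a_L2) auto
  also have "\<dots> \<le> 8 * (?q * (2 * ip (u j) (u j) + 8 * b)) + 8 * (8 * b * ?q)"
  proof (intro add_mono mult_left_mono mult_right_mono a)
    show "ip ?d ?d \<le> 2 * ip (u j) (u j) + 8 * b" using dd ub by linarith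
  qed (use q0 in auto)
  also have "\<dots> = 16 * ?q * (ip (u j) (u j) + 8 * b)" by (simp add: algebra_simps)
  finally show "(2 * ip ubar ?d - zbar)\<^sup>2 \<le> 16 * ?q * (ip (u j) (u j) + 8 * b)" .
qed

end

section \<open>The bootstrap of a fixed sample\<close>

lemma abs_ln_le_two_abs:
  fixes x :: real assumes "\<bar>x - 1\<bar> \<le> 1/2" shows "\<bar>ln x\<bar> \<le> 2 * \<bar>x - 1\<bar>"
proof -
  have "\<bar>ln (1 + (x - 1)) - (x - 1)\<bar> \<le> 2 * (x - 1)\<^sup>2"
    by (rule abs_ln_one_plus_x_minus_x_bound[OF assms])
  also have "2 * (x - 1)\<^sup>2 = 2 * \<bar>x - 1\<bar> * \<bar>x - 1\<bar>" by (simp add: power2_eq_square)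
  also have "\<dots> \<le> 1 * \<bar>x - 1\<bar>" by (intro mult_right_mono) (use assms in auto)
  finally have "\<bar>ln x - (x - 1)\<bar> \<le> \<bar>x - 1\<bar>" by simp
  then have "\<bar>ln x\<bar> - \<bar>x - 1\<bar> \<le> \<bar>x - 1\<bar>" by (rule order.trans[OF abs_triangle_ineq2])
  then show ?thesis by simp
qed

text \<open>Arithmetic for the comparison of variances, with h = k / sqrt t, r = b / s and e =
  \<eta>. The cap on \<open>e\<close> makes each product term at most a tenth of
  \<open>80 * h * r\<close>.\<close>

lemma variance_ratio_bound:
  fixes h r e :: real
  assumes "0 \<le> h" "0 < r" "h * r\<^sup>2 \<le> 8 * e" "h * r \<le> 64 * e" "e \<le> 1 / 100000"
  shows "410 * h * r\<^sup>2 + 80 * h * r * (1 + 410 * h * r\<^sup>2) + 80 * h * r + (80 * h * r)\<^sup>2 \<le> 15000 * e"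
proof -
  have n: "0 \<le> h * r" "0 \<le> h * r\<^sup>2" using assms by auto
  have e0: "0 \<le> e" using n assms by linarith
  have hr: "80 * (h * r) \<le> 5120 * e" "80 * (h * r) \<le> 1/10" "410 * (h * r\<^sup>2) \<le> 3280 * e" "410 * (h * r\<^sup>2) \<le> 1/10"
    using assms by auto
  have "80 * (h * r) * (410 * (h * r\<^sup>2)) \<le> 80 * (h * r) * (1/10)"
    using n hr by (intro mult_left_mono) auto
  moreover have "(80 * (h * r))\<^sup>2 \<le> 80 * (h * r) * (1/10)"
    unfolding power2_eq_square using n hr by (intro mult_left_mono) auto
  ultimately have "410 * (h * r\<^sup>2) + 80 * (h * r) * (1 + 410 * (h * r\<^sup>2)) + 80 * (h * r) + (80 * (h * r))\<^sup>2
     \<le> 3280 * e + 2 * (5120 * e) + 2 * (512 * e)"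
    using hr unfolding distrib_left by linarith
  also have "\<dots> \<le> 15000 * e" using e0 by simp
  finally show ?thesis by (simp add: mult_ac)
qed

lemma indep_vars_PiM_coordinates:
  assumes "\<And>i. i \<in> I \<Longrightarrow> prob_space (M i)" "I \<noteq> {}"
  shows "prob_space.indep_vars (PiM I M) M (\<lambda>i \<omega>. \<omega> i) I"
proof -
  interpret P: prob_space "PiM I M" using assms by (intro prob_space_PiM) auto
  have "distr (PiM I M) (PiM I M) (\<lambda>x. \<lambda>i\<in>I. x i) = PiM I (\<lambda>i. distr (PiM I M) (M i) (\<lambda>x. x i))"
  proof -
    have "distr (PiM I M) (PiM I M) (\<lambda>x. \<lambda>i\<in>I. x i) = distr (PiM I M) (PiM I M) (\<lambda>x. x)"
      by (rule distr_cong) (auto simp: space_PiM PiE_restrict)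
    also have "\<dots> = PiM I M" by (simp add: distr_id2)
    also have "\<dots> = PiM I (\<lambda>i. distr (PiM I M) (M i) (\<lambda>x. x i))"
      using assms by (intro PiM_cong refl) (simp add: distr_PiM_component)
    finally show ?thesis .
  qed
  then show ?thesis
    using assms by (subst P.indep_vars_iff_distr_eq_PiM') auto
qed

lemma prob_space_uniform_lessThan: "0 < t \<Longrightarrow> prob_space (uniform_count_measure {..<t::nat})"
  by (rule prob_space_uniform_count_measure) auto

context L2_sample
begin

abbreviation "Unif \<equiv> uniform_count_measure {..<t}"

text \<open>Given the sample, the \<open>zhat (J i)\<close> are i.i.d. and centred with exact
  variance \<open>W\<close> and third absolute moment \<open>m3\<close>. Only an upper bound
  results, because \<open>boot_ge\<close> merely encloses the event in one about the linear
  part.\<close>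

lemma boot_berry_esseen:
  fixes W m3 :: real
  assumes W: "W = (\<Sum>i<t. (zhat i)\<^sup>2) / t" "0 < W" and m3: "m3 = (\<Sum>i<t. \<bar>zhat i\<bar> ^ 3) / t"
  shows "measure (PiM {..<t} (\<lambda>_. Unif)) {J \<in> space (PiM {..<t} (\<lambda>_. Unif)). boot J < excess}
     \<le> Phi (sqrt t * excess / sqrt W) + 120 * m3 / (sqrt W ^ 3 * sqrt t)"
proof -
  let ?M = "PiM {..<t} (\<lambda>_. Unif)"
  interpret U: prob_space Unif by (rule prob_space_uniform_lessThan[OF t_pos])
  interpret P: prob_space ?M by (intro prob_space_PiM) (rule U.prob_space_axioms)
  have ne: "{..<t} \<noteq> {}" using t_pos by auto
  define \<mu> where "\<mu> = distr Unif borel zhat"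
  have zm: "zhat \<in> borel_measurable Unif" by (simp add: measurable_def sets_uniform_count_measure space_uniform_count_measure)
  have int_U: "integrable Unif f" for f :: "nat \<Rightarrow> real"
    unfolding uniform_count_measure_def point_measure_def
    by (intro integrable_point_measure_finite[unfolded point_measure_def]) auto
  have e: "integrable \<mu> f" "(\<integral>x. f x \<partial>\<mu>) = (\<Sum>i<t. f (zhat i)) / t"
    if "f \<in> borel_measurable borel" for f :: "real \<Rightarrow> real"
    unfolding \<mu>_def using that zm int_U by (auto simp: integrable_distr_eq integral_distr integral_uniform_count_measure)
  have iv: "P.indep_vars (\<lambda>_. Unif) (\<lambda>i J. J i) {..<t}"
    by (rule indep_vars_PiM_coordinates) (use ne U.prob_space_axioms in auto)
  define w where "w = sqrt t * excess / sqrt W"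
  have "\<bar>P.prob {J \<in> space ?M. (\<Sum>i<t. zhat (J i)) \<le> w * (sqrt W * sqrt (card {..<t}))} - Phi w\<bar>
     \<le> 120 * (\<integral>x. \<bar>x\<bar> ^ 3 \<partial>\<mu>) / (sqrt W ^ 3 * sqrt (card {..<t}))"
  proof (rule P.berry_esseen_iid)
    show "P.indep_vars (\<lambda>_. borel) (\<lambda>i J. zhat (J i)) {..<t}"
      using P.indep_vars_compose2[OF iv, of "\<lambda>_. zhat" "\<lambda>_. borel"] zm by simp
    show "distr ?M borel (\<lambda>J. zhat (J i)) = \<mu>" if "i \<in> {..<t}" for i
    proof -
      have "\<mu> = distr (distr ?M Unif (\<lambda>J. J i)) borel zhat"
        unfolding \<mu>_def using that U.prob_space_axioms by (subst distr_PiM_component) auto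
      also have "\<dots> = distr ?M borel (\<lambda>J. zhat (J i))"
        using that zm by (subst distr_distr) (auto simp: comp_def)
      finally show ?thesis by simp
    qed
    show "(\<integral>x. x \<partial>\<mu>) = 0" using e(2)[of "\<lambda>x. x"] zhat_sum by simp
    show "(\<integral>x. x\<^sup>2 \<partial>\<mu>) = (sqrt W)\<^sup>2" using e(2)[of "\<lambda>x. x\<^sup>2"] W by simp
    show "integrable \<mu> (\<lambda>x. x)" "integrable \<mu> (\<lambda>x. x\<^sup>2)" "integrable \<mu> (\<lambda>x. \<bar>x\<bar> ^ 3)"
      by (rule e(1); simp)+
  qed (use ne W in auto)
  then have be: "P.prob {J \<in> space ?M. (\<Sum>i<t. zhat (J i)) \<le> w * (sqrt W * sqrt t)}
      \<le> Phi w + 120 * m3 / (sqrt W ^ 3 * sqrt t)"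
    using e(2)[of "\<lambda>x. \<bar>x\<bar> ^ 3"] by (simp add: m3)
  have "P.prob {J \<in> space ?M. boot J < excess} \<le> P.prob {J \<in> space ?M. (\<Sum>i<t. zhat (J i)) \<le> w * (sqrt W * sqrt t)}"
  proof (rule P.finite_measure_mono)
    show "{J \<in> space ?M. boot J < excess} \<subseteq> {J \<in> space ?M. (\<Sum>i<t. zhat (J i)) \<le> w * (sqrt W * sqrt t)}"
    proof safe
      fix J assume J: "J \<in> space ?M" and lt: "boot J < excess"
      have Jlt: "J i < t" if "i < t" for i
      proof -
        have "J \<in> (\<Pi>\<^sub>E i\<in>{..<t}. {..<t})" using J by (simp only: space_PiM space_uniform_count_measure)
        then show ?thesis using that by (metis PiE_mem lessThan_iff)
      qed
      from boot_ge[of J, OF Jlt] lt have "(\<Sum>i<t. zhat (J i)) / t \<le> excess" by linarith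
      then have "(\<Sum>i<t. zhat (J i)) \<le> excess * t" using t_pos by (simp add: pos_divide_le_eq)
      also have "\<dots> = w * (sqrt W * sqrt t)"
      proof -
        have "w * (sqrt W * sqrt t) = excess * (sqrt t * sqrt t)" using W(2) by (simp add: w_def)
        then show ?thesis by simp
      qed
      finally show "(\<Sum>i<t. zhat (J i)) \<le> w * (sqrt W * sqrt t)" .
    qed
    have "(\<lambda>J. \<Sum>i<t. zhat (J i)) \<in> borel_measurable ?M"
      by (intro borel_measurable_sum
          measurable_compose[OF measurable_component_singleton[of _ "{..<t}" "\<lambda>_. Unif"] zm])
    then show "{J \<in> space ?M. (\<Sum>i<t. zhat (J i)) \<le> w * (sqrt W * sqrt t)} \<in> P.events"
      by measurable
  qed
  with be show ?thesis unfolding w_def by linarith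
qed

text \<open>\<open>g1\<close>, \<open>g2\<close> and \<open>g3\<close> are what a good sample
  satisfies: a small quadratic part, a bounded average of the cubes of the normalised squared norms,
  and a second moment of \<open>zeta'\<close> over the sample close to
  \<open>s\<^sup>2\<close>.\<close>

context
  fixes b s k \<eta> :: real
  assumes b: "0 < b" and s: "0 < s" and k: "1 \<le> k" and aa: "ip a a \<le> 8 * b"
    and g1: "ip ubar ubar \<le> 33 * k\<^sup>2 * b / t"
    and g2: "(\<Sum>i<t. (ip (u i) (u i) / b) ^ 3) \<le> 3 * t"
    and g3: "\<bar>(\<Sum>i<t. (zeta' i)\<^sup>2) / t - s\<^sup>2\<bar> \<le> 410 * k * b\<^sup>2 / sqrt t"
    and eta: "\<eta> = k\<^sup>2 / sqrt t * (b / s) ^ 3" "\<eta> \<le> 1 / 100000" and rho: "1 / 8 \<le> b / s"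
begin

text \<open>From y \<le> 1 + y^3 the average in \<open>g2\<close> gives 1 + 3 = 4, and Jensen passes
  this on to \<open>ubar\<close>.\<close>

lemma avg_norm_le: "(\<Sum>i<t. ip (u i) (u i)) / t \<le> 4 * b" "ip ubar ubar \<le> 4 * b"
proof -
  have x: "y \<le> 1 + y ^ 3" if "0 \<le> y" for y :: real
    using that self_le_power[of y 3] by (cases "y \<le> 1") (auto simp: add_increasing2)
  have "(\<Sum>i<t. ip (u i) (u i) / b) \<le> (\<Sum>i<t. 1 + (ip (u i) (u i) / b) ^ 3)"
    by (intro sum_mono x divide_nonneg_nonneg inner_L2_self_nonneg) (use b in auto)
  also have "\<dots> \<le> 4 * t" using g2 by (simp add: sum.distrib)
  finally show *: "(\<Sum>i<t. ip (u i) (u i)) / t \<le> 4 * b"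
    using b t_pos by (simp add: sum_divide_distrib[symmetric] field_simps)
  with ubar_le_avg show "ip ubar ubar \<le> 4 * b" by linarith
qed

text \<open>Put y = \<bar>zhat i\<bar> / (14 b), where 14^2 = 196 exceeds the 192 of
  \<open>zhat_bounds\<close>. Then y^2 \<le> x + 4 and y^3 \<le> 1 + y^6 \<le> 257 + 4 x^3. On
  average this is at most 257 + 12 = 269, and 269 * 14^3 = 738136.\<close>

lemma third_moment_le: "(\<Sum>i<t. \<bar>zhat i\<bar> ^ 3) / t \<le> 10^6 * b ^ 3"
proof -
  define x where "x i = ip (u i) (u i) / b" for i
  have x0: "0 \<le> x i" for i unfolding x_def using b by (simp add: inner_L2_self_nonneg)
  have "\<bar>zhat i\<bar> ^ 3 \<le> (14 * b) ^ 3 * (257 + 4 * x i ^ 3)" if i: "i < t" for i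
  proof -
    define y where "y = \<bar>zhat i\<bar> / (14 * b)"
    have y0: "0 \<le> y" using b by (simp add: y_def)
    have "(zhat i)\<^sup>2 \<le> 192 * b * (ip (u i) (u i) + 4 * b)"
      by (rule zhat_bounds(1)[OF aa avg_norm_le(2) i])
    also have "\<dots> = 192 * b\<^sup>2 * (x i + 4)" using b by (simp add: x_def field_simps power2_eq_square)
    also have "\<dots> \<le> 196 * b\<^sup>2 * (x i + 4)" using x0[of i] by (intro mult_right_mono) auto
    finally have "y\<^sup>2 \<le> x i + 4" unfolding y_def using b by (simp add: power_divide power_mult_distrib field_simps)
    then have "(y\<^sup>2) ^ 3 \<le> (x i + 4) ^ 3" by (intro power_mono) auto
    \<comment> \<open>Convexity of the cube at the midpoint of \<open>x i\<close> and 4.\<close>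
    moreover have "(x i + 4) ^ 3 \<le> 4 * x i ^ 3 + 256"
    proof -
      have "0 \<le> 3 * (x i + 4) * (x i - 4)\<^sup>2" using x0[of i] by simp
      also have "\<dots> = 4 * x i ^ 3 + 256 - (x i + 4) ^ 3"
        by (simp add: power2_eq_square power3_eq_cube algebra_simps)
      finally show ?thesis by simp
    qed
    moreover have "y ^ 3 \<le> 1 + (y\<^sup>2) ^ 3"
    proof -
      have "y ^ 3 \<le> 1 \<or> y ^ 3 \<le> y ^ 3 * y ^ 3"
        by (metis linorder_le_cases mult_left_mono mult.right_neutral y0 zero_le_power)
      moreover have "(y\<^sup>2) ^ 3 = y ^ 3 * y ^ 3" by (simp flip: power_mult power_add)
      ultimately show ?thesis using y0 zero_le_power[OF y0, of 3] by (smt (verit) mult_nonneg_nonneg)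
    qed
    ultimately have "y ^ 3 \<le> 257 + 4 * x i ^ 3" by linarith
    then have "(14 * b) ^ 3 * y ^ 3 \<le> (14 * b) ^ 3 * (257 + 4 * x i ^ 3)" using b by (intro mult_left_mono) auto
    moreover have "\<bar>zhat i\<bar> = 14 * b * y" using b by (simp add: y_def)
    ultimately show ?thesis by (simp add: power_mult_distrib)
  qed
  then have "(\<Sum>i<t. \<bar>zhat i\<bar> ^ 3) \<le> (\<Sum>i<t. (14 * b) ^ 3 * (257 + 4 * x i ^ 3))" by (intro sum_mono) auto
  also have "\<dots> = (14 * b) ^ 3 * (257 * t + 4 * (\<Sum>i<t. x i ^ 3))"
    by (simp add: sum_distrib_left[symmetric] sum.distrib)
  also have "\<dots> \<le> (14 * b) ^ 3 * (257 * t + 4 * (3 * t))"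
    using g2 b unfolding x_def by (intro mult_left_mono add_left_mono) auto
  also have "\<dots> = 738136 * b ^ 3 * t" by (simp add: power_mult_distrib)
  also have "\<dots> \<le> 10^6 * b ^ 3 * t" using b by (intro mult_right_mono) auto
  finally show ?thesis using t_pos by (simp add: pos_divide_le_eq)
qed

text \<open>\<open>zhat\<close> differs from \<open>zeta'\<close> by \<open>y\<close>, whose mean
  square is at most \<open>\<tau>\<^sup>2\<close>. The cross term is split with weights that make it
  cost about \<open>2 * s * \<tau>\<close>, which is of first order in k / sqrt t.\<close>

lemma variance_close: "\<bar>(\<Sum>i<t. (zhat i)\<^sup>2) / t / s\<^sup>2 - 1\<bar> \<le> 15000 * \<eta>"
proof -
  define h r where "h = k / sqrt t" and "r = b / s"
  \<comment> \<open>192 * 33 = 6336 lies below 6400 = 80^2, which makes \<open>\<tau>\<close> a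
    bound for the root mean square of \<open>y\<close>.\<close>
  define \<tau> where "\<tau> = 80 * h * b"
  define V W where "V = (\<Sum>i<t. (zeta' i)\<^sup>2) / t" and "W = (\<Sum>i<t. (zhat i)\<^sup>2) / t"
  define y where "y i = 2 * ip ubar (\<lambda>z. u i z - ubar z) - zbar" for i
  have st: "0 < sqrt t" using t_pos by simp
  have h0: "0 < h" and r0: "0 < r" and tau: "0 < \<tau>" using k st b s by (auto simp: h_def r_def \<tau>_def)
  have sq: "h\<^sup>2 = k\<^sup>2 / t" using t_pos by (simp add: h_def power_divide)
  have Y: "(\<Sum>i<t. (y i)\<^sup>2) / t \<le> \<tau>\<^sup>2"
  proof -
    have "(\<Sum>i<t. (y i)\<^sup>2) \<le> (\<Sum>i<t. 16 * ip ubar ubar * (ip (u i) (u i) + 8 * b))"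
      unfolding y_def by (intro sum_mono zhat_bounds(2)[OF aa avg_norm_le(2)]) auto
    also have "\<dots> = 16 * ip ubar ubar * ((\<Sum>i<t. ip (u i) (u i)) + t * (8 * b))"
      by (simp add: sum_distrib_left[symmetric] sum.distrib)
    also have "\<dots> \<le> 16 * ip ubar ubar * (4 * b * t + t * (8 * b))"
      using avg_norm_le(1) t_pos
      by (intro mult_left_mono add_right_mono mult_nonneg_nonneg inner_L2_self_nonneg) (auto simp: pos_divide_le_eq)
    also have "\<dots> = 192 * b * t * ip ubar ubar" by simp
    also have "\<dots> \<le> 192 * b * t * (33 * k\<^sup>2 * b / t)" using g1 b by (intro mult_left_mono) auto
    finally have "(\<Sum>i<t. (y i)\<^sup>2) / t \<le> 192 * b * (33 * k\<^sup>2 * b / t)"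
      using t_pos by (simp add: field_simps)
    also have "\<dots> = 6336 * (h\<^sup>2 * b\<^sup>2)" unfolding sq by (simp add: power2_eq_square)
    also have "\<dots> \<le> 6400 * (h\<^sup>2 * b\<^sup>2)" by (intro mult_right_mono) auto
    finally show ?thesis by (simp add: \<tau>_def power_mult_distrib)
  qed
  have pt: "\<bar>(zhat i)\<^sup>2 - (zeta' i)\<^sup>2\<bar> \<le> \<tau> / s * (zeta' i)\<^sup>2 + (s / \<tau> + 1) * (y i)\<^sup>2" if "i < t" for i
  proof -
    \<comment> \<open>Young's inequality with weight \<open>\<tau> / s\<close>, which balances
      second moments of the sizes \<open>s\<^sup>2\<close> and
      \<open>\<tau>\<^sup>2\<close>.\<close>
    have "0 \<le> (sqrt (\<tau> / s) * \<bar>zeta' i\<bar> - sqrt (s / \<tau>) * \<bar>y i\<bar>)\<^sup>2" by simp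
    also have "\<dots> = \<tau> / s * (zeta' i)\<^sup>2 + s / \<tau> * (y i)\<^sup>2 - 2 * (sqrt (\<tau> / s) * sqrt (s / \<tau>)) * (\<bar>zeta' i\<bar> * \<bar>y i\<bar>)"
      using tau s by (simp add: power2_diff power_mult_distrib)
    also have "sqrt (\<tau> / s) * sqrt (s / \<tau>) = 1" using tau s by (simp flip: real_sqrt_mult)
    finally have "2 * \<bar>zeta' i * y i\<bar> \<le> \<tau> / s * (zeta' i)\<^sup>2 + s / \<tau> * (y i)\<^sup>2" by (simp add: abs_mult)
    moreover have "(zhat i)\<^sup>2 - (zeta' i)\<^sup>2 = 2 * (zeta' i * y i) + (y i)\<^sup>2"
      unfolding zhat_eq[OF that] y_def[symmetric] by (simp add: power2_sum)
    ultimately show ?thesis unfolding distrib_right mult_1 using zero_le_power2[of "y i"] by linarith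
  qed
  have "\<bar>W - V\<bar> = \<bar>\<Sum>i<t. (zhat i)\<^sup>2 - (zeta' i)\<^sup>2\<bar> / t"
    unfolding W_def V_def by (simp add: sum_subtractf diff_divide_distrib[symmetric] abs_divide)
  also have "\<dots> \<le> (\<Sum>i<t. \<tau> / s * (zeta' i)\<^sup>2 + (s / \<tau> + 1) * (y i)\<^sup>2) / t"
    by (intro divide_right_mono order.trans[OF sum_abs] sum_mono pt) auto
  also have "\<dots> = \<tau> / s * V + (s / \<tau> + 1) * ((\<Sum>i<t. (y i)\<^sup>2) / t)"
    unfolding V_def
    by (simp only: sum.distrib sum_distrib_left[symmetric] add_divide_distrib times_divide_eq_right)
  also have "\<dots> \<le> \<tau> / s * V + (s / \<tau> + 1) * \<tau>\<^sup>2"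
    using Y tau s by (intro add_left_mono mult_left_mono) auto
  also have "\<tau> / s * V \<le> \<tau> / s * (s\<^sup>2 + 410 * h * b\<^sup>2)"
    using g3 tau s unfolding V_def h_def by (intro mult_left_mono) (auto simp: abs_le_iff)
  finally have "\<bar>W - V\<bar> \<le> \<tau> / s * (s\<^sup>2 + 410 * h * b\<^sup>2) + (s / \<tau> + 1) * \<tau>\<^sup>2"
    by simp
  moreover have "\<bar>V - s\<^sup>2\<bar> \<le> 410 * h * b\<^sup>2" using g3 unfolding V_def h_def by simp
  ultimately have "\<bar>W - s\<^sup>2\<bar> \<le> 410 * h * b\<^sup>2 + \<tau> / s * (s\<^sup>2 + 410 * h * b\<^sup>2) + (s / \<tau> + 1) * \<tau>\<^sup>2" by linarith
  also have "\<dots> = s\<^sup>2 * (410 * h * r\<^sup>2 + 80 * h * r * (1 + 410 * h * r\<^sup>2) + 80 * h * r + (80 * h * r)\<^sup>2)"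
    unfolding \<tau>_def r_def using s h0 b by (simp add: field_simps power2_eq_square)
  also have "\<dots> \<le> s\<^sup>2 * (15000 * \<eta>)"
  proof (intro mult_left_mono variance_ratio_bound)
    have er: "\<eta> = k * h * r ^ 3" unfolding eta h_def r_def by (simp add: power2_eq_square)
    \<comment> \<open>Since \<open>8 * r\<close> and \<open>k\<close> are at least 1, lower powers
      of \<open>r\<close> can be raised to the cube contained in \<open>\<eta>\<close> at the price
      of factors 8.\<close>
    have r8: "1 \<le> 8 * r" using rho by (simp add: r_def mult.commute)
    have "h * r\<^sup>2 * 1 \<le> h * r\<^sup>2 * (k * (8 * r))"
      using h0 r0 k r8 mult_mono[OF k r8] by (intro mult_left_mono) auto
    then show "h * r\<^sup>2 \<le> 8 * \<eta>" unfolding er by (simp add: power2_eq_square power3_eq_cube mult_ac)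
    have "h * r * 1 \<le> h * r * (k * (8 * r * (8 * r)))"
      using h0 r0 k r8 mult_mono[OF k mult_mono[OF r8 r8]] by (intro mult_left_mono) auto
    then show "h * r \<le> 64 * \<eta>" unfolding er by (simp add: power3_eq_cube mult_ac)
  qed (use h0 r0 eta in auto)
  finally have "\<bar>W - s\<^sup>2\<bar> / s\<^sup>2 \<le> 15000 * \<eta>" using s by (simp add: pos_divide_le_eq mult_ac)
  also have "\<bar>W - s\<^sup>2\<bar> / s\<^sup>2 = \<bar>W / s\<^sup>2 - 1\<bar>"
  proof -
    have "W / s\<^sup>2 - 1 = (W - s\<^sup>2) / s\<^sup>2" using s by (simp add: diff_divide_distrib)
    then show ?thesis by (simp add: abs_divide)
  qed
  finally show ?thesis by (simp add: W_def)
qed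

text \<open>Three replacements follow the Berry-Esseen step: the third moment by its bound,
  \<open>sqrt W\<close> by \<open>s\<close> through \<open>Phi_scale\<close>, and
  \<open>excess\<close> by \<open>zbar\<close> through the Lipschitz bound. Each costs a multiple of
  \<open>\<eta>\<close>.\<close>

theorem boot_prob_le:
  "measure (PiM {..<t} (\<lambda>_. Unif)) {J \<in> space (PiM {..<t} (\<lambda>_. Unif)). boot J < excess}
     \<le> Phi (sqrt t * zbar / s) + 10^9 * \<eta>"
proof -
  define W where "W = (\<Sum>i<t. (zhat i)\<^sup>2) / t"
  define m3 where "m3 = (\<Sum>i<t. \<bar>zhat i\<bar> ^ 3) / t"
  have st: "0 < sqrt t" using t_pos by simp
  have e0: "0 < \<eta>" using k st b s unfolding eta by auto
  have vc: "\<bar>W / s\<^sup>2 - 1\<bar> \<le> 15000 * \<eta>" unfolding W_def by (rule variance_close)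
  then have vh: "\<bar>W / s\<^sup>2 - 1\<bar> \<le> 1/2" using eta(2) by linarith
  then have "1/2 \<le> W / s\<^sup>2" by linarith
  then have W2: "s\<^sup>2 \<le> 2 * W" using s by (simp add: field_simps)
  have W0: "0 < W" using W2 zero_less_power[OF s, of 2] by linarith
  \<comment> \<open>7/10 is a rational number below sqrt(1/2) whose cube 0.343 is above 1/4.\<close>
  have "(7/10 * s)\<^sup>2 = 49/100 * s\<^sup>2" by (simp add: power_mult_distrib power_divide)
  then have Ws: "(7/10 * s)\<^sup>2 \<le> W" using W2 zero_le_power2[of s] by linarith
  have sW: "7/10 * s \<le> sqrt W" using Ws by (rule real_le_rsqrt)
  have s3: "s ^ 3 / 4 \<le> sqrt W ^ 3"
  proof -
    have "s ^ 3 / 4 \<le> (7/10 * s) ^ 3" using s by (simp add: power_mult_distrib power3_eq_cube)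
    also have "\<dots> \<le> sqrt W ^ 3" using sW s by (intro power_mono) auto
    finally show ?thesis .
  qed
  have "measure (PiM {..<t} (\<lambda>_. Unif)) {J \<in> space (PiM {..<t} (\<lambda>_. Unif)). boot J < excess}
     \<le> Phi (sqrt t * excess / sqrt W) + 120 * m3 / (sqrt W ^ 3 * sqrt t)"
    by (rule boot_berry_esseen[OF W_def W0 m3_def])
  also have "120 * m3 / (sqrt W ^ 3 * sqrt t) \<le> 120 * (10^6 * b ^ 3) / (s ^ 3 / 4 * sqrt t)"
    using third_moment_le s3 s st b unfolding m3_def by (intro frac_le mult_left_mono mult_right_mono) auto
  also have "\<dots> = 480 * 10^6 * (1 / sqrt t * (b / s) ^ 3)" by (simp add: power_divide)
  also have "\<dots> \<le> 480 * 10^6 * \<eta>"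
  proof -
    have "1 \<le> k\<^sup>2" using k by (intro one_le_power)
    then have "1 / sqrt t * (b / s) ^ 3 \<le> \<eta>"
      unfolding eta using st b s by (intro mult_right_mono divide_right_mono) auto
    then show ?thesis by simp
  qed
  also have "Phi (sqrt t * excess / sqrt W) \<le> Phi (sqrt t * excess / s) + 15000 * \<eta>"
  proof -
    have "\<bar>Phi ((sqrt t * excess / s) / (sqrt W / s)) - Phi (sqrt t * excess / s)\<bar> \<le> \<bar>ln (sqrt W / s)\<bar>"
      by (rule Phi_scale) (use W0 s in auto)
    also have "sqrt W / s = sqrt (W / s\<^sup>2)" using s by (simp add: real_sqrt_divide)
    also have "\<bar>ln (sqrt (W / s\<^sup>2))\<bar> = \<bar>ln (W / s\<^sup>2)\<bar> / 2"
      using W0 s by (subst ln_sqrt) auto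
    also have "\<dots> \<le> \<bar>W / s\<^sup>2 - 1\<bar>" using abs_ln_le_two_abs[OF vh] by simp
    also have "\<dots> \<le> 15000 * \<eta>" by (rule vc)
    finally show ?thesis using s W0 by (simp add: real_sqrt_divide)
  qed
  also have "Phi (sqrt t * excess / s) \<le> Phi (sqrt t * zbar / s) + 2112 * \<eta>"
  proof -
    \<comment> \<open>The quadratic part shifts the argument by at most 33 k^2 b / (s sqrt t). Two
      factors \<open>8 * (b / s) \<ge> 1\<close> raise this to 33 * 64 = 2112 times
      \<open>\<eta>\<close>.\<close>
    have "sqrt t * excess / s = sqrt t * zbar / s + sqrt t * ip ubar ubar / s"
      by (simp add: excess_def distrib_left add_divide_distrib)
    moreover have "sqrt t * ip ubar ubar / s \<le> 2112 * \<eta>"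
    proof -
      have "sqrt t * ip ubar ubar / s \<le> sqrt t * (33 * k\<^sup>2 * b / t) / s"
        using g1 s by (intro divide_right_mono mult_left_mono) auto
      also have "\<dots> = 33 * (k\<^sup>2 * (sqrt t / t) * (b / s))" by simp
      also have "sqrt t / t = 1 / sqrt t" using t_pos by (simp add: field_simps)
      also have "33 * (k\<^sup>2 * (1 / sqrt t) * (b / s)) = 33 * (k\<^sup>2 / sqrt t * (b / s))" by simp
      also have "\<dots> \<le> 33 * (k\<^sup>2 / sqrt t * (b / s)) * (8 * (b / s))\<^sup>2"
      proof -
        have "1 \<le> (8 * (b / s))\<^sup>2" using rho by (intro one_le_power) (simp add: mult.commute)
        then have "33 * (k\<^sup>2 / sqrt t * (b / s)) * 1 \<le> 33 * (k\<^sup>2 / sqrt t * (b / s)) * (8 * (b / s))\<^sup>2"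
          using b s by (intro mult_left_mono) auto
        then show ?thesis by (simp only: mult_1_right)
      qed
      also have "\<dots> = 2112 * \<eta>" unfolding eta by (simp add: power2_eq_square power3_eq_cube)
      finally show ?thesis .
    qed
    ultimately show ?thesis
      using Phi_Lipschitz[of "sqrt t * excess / s" "sqrt t * zbar / s"]
        Phi_mono[of "sqrt t * excess / s" "sqrt t * zbar / s"] inner_L2_self_nonneg[of \<nu> ubar] st s
      by (smt (verit) divide_nonneg_pos mult_nonneg_nonneg)
  qed
  finally have "measure (PiM {..<t} (\<lambda>_. Unif)) {J \<in> space (PiM {..<t} (\<lambda>_. Unif)). boot J < excess}
     \<le> Phi (sqrt t * zbar / s) + 2112 * \<eta> + 15000 * \<eta> + 480 * 10^6 * \<eta>" by linarith
  also have "\<dots> \<le> Phi (sqrt t * zbar / s) + 10^9 * \<eta>" using e0 by simp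
  finally show ?thesis .
qed

end

end

section \<open>Good samples\<close>

lemma (in prob_space) prob_gt_le_power_moment:
  assumes "0 < l" and [measurable]: "Y \<in> borel_measurable M" and nn: "\<And>x. x \<in> space M \<Longrightarrow> 0 \<le> Y x"
    and int: "integrable M (\<lambda>x. Y x ^ k)" and le: "(\<integral>x. Y x ^ k \<partial>M) \<le> C" and k: "0 < k"
  shows "prob {x \<in> space M. l < (Y x :: real)} \<le> C / l ^ k"
proof -
  have "prob {x \<in> space M. l < Y x} \<le> prob {x \<in> space M. l ^ k \<le> Y x ^ k}"
    by (rule finite_measure_mono) (use assms(1) in \<open>auto intro!: power_mono\<close>)
  also have "\<dots> \<le> (\<integral>x. Y x ^ k \<partial>M) / l ^ k"
    using integral_Markov_inequality_measure[OF int, of "{}" "l ^ k"] assms(1) nn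
    by (simp add: AE_I2)
  also have "\<dots> \<le> C / l ^ k" using le assms(1) by (intro divide_right_mono) auto
  finally show ?thesis .
qed

lemma integrable_between:
  fixes f g :: "'a \<Rightarrow> real"
  assumes "integrable M g" "f \<in> borel_measurable M"
    and "\<And>x. x \<in> space M \<Longrightarrow> 0 \<le> f x" "\<And>x. x \<in> space M \<Longrightarrow> f x \<le> g x"
  shows "integrable M f"
proof (rule Bochner_Integration.integrable_bound[OF assms(1,2)])
  show "AE x in M. norm (f x) \<le> norm (g x)"
  proof (rule AE_I2)
    fix x assume "x \<in> space M"
    with assms(3,4)[of x] show "norm (f x) \<le> norm (g x)" by simp
  qed
qed

lemma power_le_one_add_power:
  fixes y :: real assumes "0 \<le> y" "i \<le> j" shows "y ^ i \<le> 1 + y ^ j"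
  using assms power_increasing[of i j y] power_le_one[of y i]
  by (cases "1 \<le> y") (auto simp: add_increasing2 add_increasing)

text \<open>Jensen through Bernoulli's inequality, that is, through the tangent at the mean
  \<open>m\<close>. The case \<open>m = 0\<close> is apart because the tangent is written with
  \<open>y i / m\<close>.\<close>

lemma avg_power_le:
  fixes y :: "nat \<Rightarrow> real"
  assumes "\<And>i. i < t \<Longrightarrow> 0 \<le> y i" "0 < t"
  shows "((\<Sum>i<t. y i) / t) ^ k \<le> (\<Sum>i<t. y i ^ k) / t"
proof -
  define m where "m = (\<Sum>i<t. y i) / t"
  have m0: "0 \<le> m" unfolding m_def using assms by (intro divide_nonneg_nonneg sum_nonneg) auto
  show ?thesis
  proof (cases "m = 0")
    case True
    show ?thesis
    proof (cases "k = 0")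
      case False
      have "0 \<le> (\<Sum>i<t. y i ^ k) / t" using assms by (intro divide_nonneg_nonneg sum_nonneg) auto
      then show ?thesis using True False unfolding m_def[symmetric] by (simp add: power_0_left)
    qed (use assms in simp)
  next
    case False
    then have m: "0 < m" using m0 by simp
    have "m ^ k * (1 + k * (y i / m - 1)) \<le> y i ^ k" if "i < t" for i
    proof -
      have "1 + k * (y i / m - 1) \<le> (1 + (y i / m - 1)) ^ k"
        by (rule Bernoulli_inequality) (use assms(1)[OF that] m in simp)
      then have "m ^ k * (1 + k * (y i / m - 1)) \<le> m ^ k * (y i / m) ^ k"
        using m by (intro mult_left_mono) auto
      also have "\<dots> = y i ^ k" using m by (simp add: power_divide)
      finally show ?thesis .
    qed
    then have "(\<Sum>i<t. m ^ k * (1 + k * (y i / m - 1))) \<le> (\<Sum>i<t. y i ^ k)"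
      by (intro sum_mono) auto
    also have "(\<Sum>i<t. m ^ k * (1 + k * (y i / m - 1))) = m ^ k * (t + k * ((\<Sum>i<t. y i) / m - t))"
      by (simp add: sum_distrib_left[symmetric] sum.distrib sum_subtractf sum_divide_distrib[symmetric])
    also have "(\<Sum>i<t. y i) / m = t"
      using False assms(2) by (simp add: m_def)
    finally show ?thesis using assms(2) by (simp add: m_def pos_le_divide_eq)
  qed
qed

text \<open>100/272 is below 1/e. The thresholds of the exceptional events are chosen so that
  Markov's inequality leaves the k-th power of a ratio below it: 12/33, 1/3 and
  61440/168100.\<close>

lemma exp_bound_ratio:
  fixes x :: real assumes "0 \<le> x" "x \<le> 100 / 272" shows "x ^ k \<le> exp (- real k)"
proof -
  have "x * exp 1 \<le> 100 / 272 * (272 / 100)"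
    using assms e_less_272 by (intro mult_mono) auto
  then have "x \<le> exp (-1)" by (simp add: exp_minus field_simps)
  then have "x ^ k \<le> exp (-1) ^ k" using assms by (intro power_mono)
  also have "\<dots> = exp (- real k)" by (simp flip: exp_of_nat_mult)
  finally show ?thesis .
qed

lemma Phi_measurable [measurable]: "Phi \<in> borel_measurable borel"
  by (rule borel_measurable_mono) (simp add: mono_def Phi_mono)

lemma Phi_surj: assumes "0 < y" "y < 1" obtains x where "Phi x = y"
proof -
  obtain l where l: "Phi l < y" using order_tendstoD(2)[OF Phi_at_bot assms(1)] by (metis eventually_at_bot_linorder order_refl)
  obtain r where r: "y < Phi r" using order_tendstoD(1)[OF Phi_at_top assms(2)] by (metis eventually_at_top_linorder order_refl)
  have "l \<le> r" using Phi_mono[of r l] l r by linarith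
  have "\<exists>x\<ge>l. x \<le> r \<and> Phi x = y"
    by (rule IVT) (use l r \<open>l \<le> r\<close> DERIV_isCont[OF Phi_deriv] in auto)
  then show ?thesis using that by blast
qed

text \<open>\<open>P\<close> is the law of one parameter, and \<open>b\<close> normalises the
  squared norms so that their moment of order 3k is at most 1. Centredness is required only in
  pairings with square-integrable functions, which avoids vector-valued integrals.\<close>

locale L2_ensemble = prob_space P for P :: "'r measure" +
  fixes \<nu> :: "'z measure" and a :: "'z \<Rightarrow> real" and U :: "'r \<Rightarrow> 'z \<Rightarrow> real" and t k :: nat and b s :: real
  assumes a_L2: "a \<in> L2 \<nu>" and U_L2: "\<And>r. r \<in> space P \<Longrightarrow> U r \<in> L2 \<nu>" and t_pos: "0 < t" and k_pos: "0 < k"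
    and gram_meas: "(\<lambda>z. inner_L2 \<nu> (U (fst z)) (U (snd z))) \<in> borel_measurable (P \<Otimes>\<^sub>M P)"
    and lin_meas [measurable]: "(\<lambda>r. inner_L2 \<nu> a (U r)) \<in> borel_measurable P"
    and centred: "\<And>g. g \<in> L2 \<nu> \<Longrightarrow> (\<integral>r. inner_L2 \<nu> g (U r) \<partial>P) = 0"
    and b_pos: "0 < b" and norm_a: "inner_L2 \<nu> a a \<le> 8 * b"
    and moment_int: "integrable P (\<lambda>r. (inner_L2 \<nu> (U r) (U r) / b) ^ (3 * k))"
    and moment_le: "(\<integral>r. (inner_L2 \<nu> (U r) (U r) / b) ^ (3 * k) \<partial>P) \<le> 1"
    and s_pos: "0 < s" and s_def: "s\<^sup>2 = (\<integral>r. (2 * inner_L2 \<nu> a (U r))\<^sup>2 \<partial>P)"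
begin

definition G :: "'r \<Rightarrow> 'r \<Rightarrow> real" where "G r r' = inner_L2 \<nu> (U r) (U r')"
definition \<zeta> :: "'r \<Rightarrow> real" where "\<zeta> r = 2 * inner_L2 \<nu> a (U r)"
definition \<rho> :: "'r \<Rightarrow> real" where "\<rho> r = G r r / b"
text \<open>The first term of \<open>delta\<close>, with \<open>b\<close> in the place of the
  moment.\<close>

definition \<eta> :: real where "\<eta> = (real k)\<^sup>2 / sqrt t * (b / s) ^ 3"

lemma gram_sum:
  fixes n :: nat
  assumes w: "\<And>i. i < n \<Longrightarrow> w i \<in> space P"
  shows "(\<Sum>i<n. \<Sum>j<n. G (w i) (w j)) = inner_L2 \<nu> (\<lambda>z. \<Sum>i<n. U (w i) z) (\<lambda>z. \<Sum>i<n. U (w i) z)"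
proof -
  have L: "U (w i) \<in> L2 \<nu>" if "i \<in> {..<n}" for i using U_L2[OF w] that by simp
  have S: "(\<lambda>z. \<Sum>i<n. U (w i) z) \<in> L2 \<nu>" by (rule L2_sum[OF L])
  have "inner_L2 \<nu> (\<lambda>z. \<Sum>i<n. U (w i) z) (\<lambda>z. \<Sum>i<n. U (w i) z)
      = (\<Sum>i<n. inner_L2 \<nu> (U (w i)) (\<lambda>z. \<Sum>i<n. U (w i) z))"
    by (rule inner_L2_sum_left[OF L S])
  also have "\<dots> = (\<Sum>i<n. \<Sum>j<n. inner_L2 \<nu> (U (w i)) (U (w j)))"
    by (intro sum.cong refl inner_L2_sum_right[OF L L])
  finally show ?thesis unfolding G_def by simp
qed

sublocale K: moment_kernel P G
proof
  show "(\<lambda>z. G (fst z) (snd z)) \<in> borel_measurable (P \<Otimes>\<^sub>M P)" unfolding G_def by (rule gram_meas)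
  show "G r s = G s r" for r s unfolding G_def by (rule inner_L2_sym)
  fix w and n :: nat assume w: "\<And>i. i < n \<Longrightarrow> w i \<in> space P"
  have gs: "(\<Sum>i<n. \<Sum>j<n. G (w i) (w j)) = inner_L2 \<nu> (\<lambda>z. \<Sum>i<n. U (w i) z) (\<lambda>z. \<Sum>i<n. U (w i) z)"
    by (rule gram_sum) (rule w)
  show "0 \<le> (\<Sum>i<n. \<Sum>j<n. G (w i) (w j))" unfolding gs by (rule inner_L2_self_nonneg)
  fix r assume r: "r \<in> space P"
  have L: "U (w i) \<in> L2 \<nu>" if "i \<in> {..<n}" for i using U_L2 w that by simp
  have LS: "(\<lambda>z. \<Sum>i<n. U (w i) z) \<in> L2 \<nu>" by (rule L2_sum) (rule L)
  have "(\<Sum>i<n. G (w i) r) = inner_L2 \<nu> (\<lambda>z. \<Sum>i<n. U (w i) z) (U r)"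
    unfolding G_def by (rule inner_L2_sum_left[OF L U_L2[OF r], symmetric])
  then show "(\<Sum>i<n. G (w i) r)\<^sup>2 \<le> (\<Sum>i<n. \<Sum>j<n. G (w i) (w j)) * G r r"
    unfolding gs unfolding G_def using inner_L2_Cauchy_Schwarz[OF LS U_L2[OF r]] by simp
next
  show "(\<integral>s. G r s \<partial>P) = 0" if "r \<in> space P" for r
    unfolding G_def by (rule centred[OF U_L2[OF that]])
qed

abbreviation "Pt \<equiv> PiM {..<t} (\<lambda>_::nat. P)"

sublocale Pt: prob_space Pt
  by (rule prob_space_PiM) (rule prob_space_axioms)

lemma zeta_meas [measurable]: "\<zeta> \<in> borel_measurable P"
  unfolding \<zeta>_def by measurable

lemma rho_meas [measurable]: "\<rho> \<in> borel_measurable P"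
  unfolding \<rho>_def by measurable

lemma rho_nonneg: "0 \<le> \<rho> r"
  unfolding \<rho>_def G_def using b_pos by (simp add: inner_L2_self_nonneg)

lemma rho_moment:
  assumes "j \<le> 3 * k"
  shows "integrable P (\<lambda>r. \<rho> r ^ j)" "(\<integral>r. \<rho> r ^ j \<partial>P) \<le> 2"
proof -
  have i: "integrable P (\<lambda>r. 1 + \<rho> r ^ (3 * k))" using moment_int by (simp add: \<rho>_def G_def)
  show int: "integrable P (\<lambda>r. \<rho> r ^ j)"
  proof (rule Bochner_Integration.integrable_bound[OF i])
    show "AE r in P. norm (\<rho> r ^ j) \<le> norm (1 + \<rho> r ^ (3 * k))"
      using power_le_one_add_power[OF rho_nonneg assms] rho_nonneg by (intro AE_I2) (simp add: abs_of_nonneg add_nonneg_nonneg)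
  qed measurable
  have "(\<integral>r. \<rho> r ^ j \<partial>P) \<le> (\<integral>r. 1 + \<rho> r ^ (3 * k) \<partial>P)"
    by (intro integral_mono int i power_le_one_add_power rho_nonneg assms)
  also have "\<dots> \<le> 1 + 1"
    using moment_int moment_le prob_space by (simp add: \<rho>_def G_def)
  finally show "(\<integral>r. \<rho> r ^ j \<partial>P) \<le> 2" by simp
qed

lemma zeta_sq_le:
  assumes "r \<in> space P" shows "(\<zeta> r)\<^sup>2 \<le> 32 * b\<^sup>2 * \<rho> r"
proof -
  have "(\<zeta> r)\<^sup>2 = 4 * (inner_L2 \<nu> a (U r))\<^sup>2" by (simp add: \<zeta>_def power_mult_distrib)
  also have "\<dots> \<le> 4 * (inner_L2 \<nu> a a * inner_L2 \<nu> (U r) (U r))"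
    by (intro mult_left_mono inner_L2_Cauchy_Schwarz a_L2 U_L2 assms) auto
  also have "\<dots> \<le> 4 * (8 * b * inner_L2 \<nu> (U r) (U r))"
    by (intro mult_left_mono mult_right_mono norm_a inner_L2_self_nonneg) auto
  also have "\<dots> = 32 * b\<^sup>2 * \<rho> r" using b_pos by (simp add: \<rho>_def G_def power2_eq_square)
  finally show ?thesis .
qed

lemma zeta_sq_integrable: "integrable P (\<lambda>r. (\<zeta> r)\<^sup>2)"
proof (rule Bochner_Integration.integrable_bound)
  show "integrable P (\<lambda>r. 32 * b\<^sup>2 * \<rho> r)" using rho_moment(1)[of 1] k_pos by simp
  show "AE r in P. norm ((\<zeta> r)\<^sup>2) \<le> norm (32 * b\<^sup>2 * \<rho> r)"
    using zeta_sq_le rho_nonneg by (intro AE_I2) simp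
qed measurable

text \<open>Cauchy-Schwarz and the bound 8 b for the squared norm of \<open>a\<close> give \<zeta>^2
  \<le> 32 b^2 \<rho>, and \<rho> has mean at most 2. The resulting lower bound on
  \<open>b / s\<close> is what allows errors with lower powers of it to be absorbed in
  \<open>\<eta>\<close>.\<close>

lemma s_le: "s\<^sup>2 \<le> 64 * b\<^sup>2" and ratio_ge: "1 / 8 \<le> b / s"
proof -
  have "s\<^sup>2 = (\<integral>r. (\<zeta> r)\<^sup>2 \<partial>P)" unfolding s_def \<zeta>_def ..
  also have "\<dots> \<le> (\<integral>r. 32 * b\<^sup>2 * \<rho> r \<partial>P)"
    using rho_moment(1)[of 1] k_pos by (intro integral_mono zeta_sq_integrable zeta_sq_le) auto
  also have "\<dots> = 32 * b\<^sup>2 * (\<integral>r. \<rho> r ^ 1 \<partial>P)" by simp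
  also have "\<dots> \<le> 32 * b\<^sup>2 * 2" using k_pos by (intro mult_left_mono rho_moment) auto
  finally show *: "s\<^sup>2 \<le> 64 * b\<^sup>2" by simp
  then have "s\<^sup>2 \<le> (8 * b)\<^sup>2" by (simp add: power_mult_distrib)
  then have "s \<le> 8 * b" by (rule power2_le_imp_le) (use b_pos in simp)
  then show "1 / 8 \<le> b / s" using s_pos by (simp add: field_simps)
qed

text \<open>The complements of \<open>bad1\<close>, \<open>bad2\<close> and \<open>bad3\<close> are
  the three conditions on a good sample, partly multiplied out or squared; 168100 is 410^2.\<close>

definition "bad1 = {w \<in> space Pt. 33 * (real k)\<^sup>2 * t * b < K.Q t w}"
definition "bad2 = {w \<in> space Pt. 3 < (\<Sum>i<t. \<rho> (w i) ^ 3) / t}"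
definition "bad3 = {w \<in> space Pt. 168100 * (real k)\<^sup>2 * t * b ^ 4 < (\<Sum>i<t. (\<zeta> (w i))\<^sup>2 - s\<^sup>2)\<^sup>2}"

lemma sum_comp_meas:
  fixes f :: "'r \<Rightarrow> real"
  assumes "f \<in> borel_measurable P" shows "(\<lambda>w. \<Sum>i<t. f (w i)) \<in> borel_measurable Pt"
  by (intro borel_measurable_sum measurable_compose[OF measurable_component_singleton[of _ "{..<t}" "\<lambda>_. P"] assms])

lemma bad_sets: "bad1 \<in> sets Pt" "bad2 \<in> sets Pt" "bad3 \<in> sets Pt"
proof -
  have [measurable]: "(\<lambda>w. \<Sum>i<t. \<rho> (w i) ^ 3) \<in> borel_measurable Pt"
    "(\<lambda>w. \<Sum>i<t. (\<zeta> (w i))\<^sup>2 - s\<^sup>2) \<in> borel_measurable Pt"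
    using sum_comp_meas[of "\<lambda>r. \<rho> r ^ 3"] sum_comp_meas[of "\<lambda>r. (\<zeta> r)\<^sup>2 - s\<^sup>2"] by auto
  show "bad1 \<in> sets Pt" "bad2 \<in> sets Pt" "bad3 \<in> sets Pt"
    unfolding bad1_def bad2_def bad3_def by measurable
qed

lemma in_space_Pt: "w \<in> space Pt \<Longrightarrow> i < t \<Longrightarrow> w i \<in> space P"
  unfolding space_PiM by (auto dest: PiE_mem)

lemma bad1_le: "Pt.prob bad1 \<le> 2 * exp (- real k)"
proof -
  have "integrable P (\<lambda>r. G r r ^ k) \<and> (\<integral>r. G r r ^ k \<partial>P) \<le> 2 * b ^ k"
  proof -
    have eq: "G r r ^ k = b ^ k * \<rho> r ^ k" for r using b_pos by (simp add: \<rho>_def power_divide)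
    show ?thesis unfolding eq using rho_moment[of k] b_pos by simp
  qed
  then have m: "integrable Pt (\<lambda>w. K.Q t w ^ k)" "(\<integral>w. K.Q t w ^ k \<partial>Pt) \<le> 2 * b ^ k * (12 * (real k)\<^sup>2 * t) ^ k"
    using K.moment_bound[of k "2 * b ^ k" t] k_pos by auto
  have "Pt.prob bad1 \<le> 2 * b ^ k * (12 * (real k)\<^sup>2 * t) ^ k / (33 * (real k)\<^sup>2 * t * b) ^ k"
    unfolding bad1_def
  proof (rule Pt.prob_gt_le_power_moment[OF _ _ _ m k_pos])
    show "0 \<le> K.Q t w" if "w \<in> space Pt" for w
      unfolding K.Q_def by (rule K.G_psd) (use in_space_Pt[OF that] in auto)
  qed (use k_pos t_pos b_pos in auto)
  also have "\<dots> = 2 * (12 / 33) ^ k"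
  proof -
    define d where "d = (real k)\<^sup>2 * t * b"
    have d: "0 < d" using k_pos t_pos b_pos by (simp add: d_def)
    have "2 * b ^ k * (12 * (real k)\<^sup>2 * t) ^ k / (33 * (real k)\<^sup>2 * t * b) ^ k = 2 * ((12 * d) ^ k / (33 * d) ^ k)"
      using k_pos unfolding d_def by (simp add: power_mult_distrib mult_ac)
    also have "(12 * d) ^ k / (33 * d) ^ k = (12 * d / (33 * d)) ^ k" by (simp only: power_divide)
    also have "12 * d / (33 * d) = 12 / 33" using d by simp
    finally show ?thesis .
  qed
  also have "\<dots> \<le> 2 * exp (- real k)" by (intro mult_left_mono exp_bound_ratio) auto
  finally show ?thesis .
qed

lemma integral_component:
  fixes f :: "'r \<Rightarrow> real"
  assumes "f \<in> borel_measurable P" "i < t"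
  shows "(\<integral>w. f (w i) \<partial>Pt) = (\<integral>r. f r \<partial>P)" "integrable Pt (\<lambda>w. f (w i)) \<longleftrightarrow> integrable P f"
proof -
  have d: "distr Pt P (\<lambda>w. w i) = P"
    using assms prob_space_axioms by (intro distr_PiM_component) auto
  have m: "(\<lambda>w. w i) \<in> measurable Pt P" using assms by (intro measurable_component_singleton) auto
  show "(\<integral>w. f (w i) \<partial>Pt) = (\<integral>r. f r \<partial>P)"
    using integral_distr[OF m assms(1)] unfolding d by simp
  show "integrable Pt (\<lambda>w. f (w i)) \<longleftrightarrow> integrable P f"
    using integrable_distr_eq[OF m assms(1)] unfolding d by simp
qed

text \<open>The k-th power of an average of cubes is at most the average of the powers of order 3k,
  whose integrals are bounded by assumption. This fixes the order of the moment in the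
  theorem.\<close>

lemma bad2_le: "Pt.prob bad2 \<le> exp (- real k)"
proof -
  let ?Y = "\<lambda>w. (\<Sum>i<t. \<rho> (w i) ^ 3) / t"
  have Ym [measurable]: "?Y \<in> borel_measurable Pt"
    using sum_comp_meas[of "\<lambda>r. \<rho> r ^ 3"] by auto
  have Y0: "0 \<le> ?Y w" for w by (intro divide_nonneg_nonneg sum_nonneg zero_le_power rho_nonneg) auto
  have le: "?Y w ^ k \<le> (\<Sum>i<t. \<rho> (w i) ^ (3 * k)) / t" for w
    using avg_power_le[of t "\<lambda>i. \<rho> (w i) ^ 3" k] rho_nonneg t_pos by (simp add: power_mult)
  have c: "integrable Pt (\<lambda>w. \<rho> (w i) ^ (3 * k))" "(\<integral>w. \<rho> (w i) ^ (3 * k) \<partial>Pt) \<le> 1" if "i < t" for i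
    using integral_component[of "\<lambda>r. \<rho> r ^ (3 * k)" i] that moment_int moment_le by (simp_all add: \<rho>_def[symmetric] G_def[symmetric])
  have i2: "integrable Pt (\<lambda>w. (\<Sum>i<t. \<rho> (w i) ^ (3 * k)) / t)"
    by (intro integrable_divide Bochner_Integration.integrable_sum c) auto
  have i1: "integrable Pt (\<lambda>w. ?Y w ^ k)"
    by (rule integrable_between[OF i2]) (measurable, intro zero_le_power Y0, rule le)
  have "(\<integral>w. ?Y w ^ k \<partial>Pt) \<le> (\<integral>w. (\<Sum>i<t. \<rho> (w i) ^ (3 * k)) / t \<partial>Pt)"
    by (intro integral_mono i1 i2 le)
  also have "\<dots> = (\<Sum>i<t. \<integral>w. \<rho> (w i) ^ (3 * k) \<partial>Pt) / t"
    using c(1) by simp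
  also have "\<dots> \<le> (\<Sum>i<t. 1) / t"
    by (intro divide_right_mono sum_mono c) auto
  also have "\<dots> = 1" using t_pos by simp
  finally have "Pt.prob bad2 \<le> 1 / 3 ^ k"
    unfolding bad2_def by (intro Pt.prob_gt_le_power_moment i1 Y0 Ym k_pos) auto
  also have "\<dots> = (1 / 3) ^ k" by (simp add: power_divide)
  also have "\<dots> \<le> exp (- real k)" by (rule exp_bound_ratio) auto
  finally show ?thesis .
qed

text \<open>The moment bound is applied to the scalar kernel \<open>f r * f r'\<close> of the
  centred squares f = \<zeta>^2 - s^2, whose \<open>Q\<close> is the square of their sum. Since f^2
  \<le> 5120 b^4 max(1, \<rho>^2), its k-th power is controlled by the moment of order 3k, and 12 *
  5120 = 61440.\<close>

lemma bad3_le: "Pt.prob bad3 \<le> 3 * exp (- real k)"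
proof -
  define f where "f r = (\<zeta> r)\<^sup>2 - s\<^sup>2" for r
  have [measurable]: "f \<in> borel_measurable P" unfolding f_def by measurable
  have f0: "(\<integral>r. f r \<partial>P) = 0"
    using zeta_sq_integrable prob_space unfolding f_def s_def \<zeta>_def by simp
  interpret F: moment_kernel P "\<lambda>r r'. f r * f r'"
  proof
    have sum_eq: "(\<Sum>i<n. \<Sum>j<n. f (w i) * f (w j)) = (\<Sum>i<n. f (w i))\<^sup>2" for w and n :: nat
      by (simp add: power2_eq_square sum_product)
    show "0 \<le> (\<Sum>i<n. \<Sum>j<n. f (w i) * f (w j))" for w and n :: nat unfolding sum_eq by simp
    show "(\<Sum>i<n. f (w i) * f r)\<^sup>2 \<le> (\<Sum>i<n. \<Sum>j<n. f (w i) * f (w j)) * (f r * f r)" for w r and n :: nat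
      unfolding sum_eq by (simp add: sum_distrib_right[symmetric] power_mult_distrib power2_eq_square[of "f r"])
    show "(\<integral>s. f r * f s \<partial>P) = 0" for r using f0 by simp
  qed (auto simp: mult.commute)
  have Q_eq: "F.Q t w = (\<Sum>i<t. f (w i))\<^sup>2" for w
    unfolding F.Q_def by (simp add: power2_eq_square sum_product)
  define c where "c = 3 * (5120 * b ^ 4) ^ k"
  have fle: "(f r * f r) ^ k \<le> (5120 * b ^ 4) ^ k * (2 + \<rho> r ^ (3 * k))" if r: "r \<in> space P" for r
  proof -
    have z: "((\<zeta> r)\<^sup>2)\<^sup>2 \<le> (32 * b\<^sup>2 * \<rho> r)\<^sup>2" "(s\<^sup>2)\<^sup>2 \<le> (64 * b\<^sup>2)\<^sup>2"
      by (intro power_mono zeta_sq_le r s_le zero_le_power2)+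
    have "f r * f r = ((\<zeta> r)\<^sup>2)\<^sup>2 + (s\<^sup>2)\<^sup>2 - 2 * ((\<zeta> r)\<^sup>2 * s\<^sup>2)"
      unfolding f_def by (simp add: power2_eq_square[of "_ - _", symmetric] power2_diff)
    also have "\<dots> \<le> (32 * b\<^sup>2 * \<rho> r)\<^sup>2 + (64 * b\<^sup>2)\<^sup>2"
      using z mult_nonneg_nonneg[OF zero_le_power2[of "\<zeta> r"] zero_le_power2[of s]] by linarith
    also have "\<dots> = 1024 * b ^ 4 * ((\<rho> r)\<^sup>2 + 4)"
      by (simp add: power_mult_distrib power_mult[symmetric] algebra_simps)
    also have "\<dots> \<le> 1024 * b ^ 4 * (5 * max 1 ((\<rho> r)\<^sup>2))" by (intro mult_left_mono) auto
    also have "\<dots> = 5120 * b ^ 4 * max 1 ((\<rho> r)\<^sup>2)" by simp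
    finally have "(f r * f r) ^ k \<le> (5120 * b ^ 4 * max 1 ((\<rho> r)\<^sup>2)) ^ k"
      by (intro power_mono) auto
    also have "\<dots> = (5120 * b ^ 4) ^ k * max 1 ((\<rho> r)\<^sup>2) ^ k" by (rule power_mult_distrib)
    also have "\<dots> \<le> (5120 * b ^ 4) ^ k * (2 + \<rho> r ^ (3 * k))"
    proof (rule mult_left_mono)
      have "max 1 ((\<rho> r)\<^sup>2) ^ k \<le> 1 + \<rho> r ^ (2 * k)"
        by (auto simp: max_def power_mult add_increasing2 add_increasing)
      also have "\<rho> r ^ (2 * k) \<le> 1 + \<rho> r ^ (3 * k)" by (rule power_le_one_add_power[OF rho_nonneg]) simp
      finally show "max 1 ((\<rho> r)\<^sup>2) ^ k \<le> 2 + \<rho> r ^ (3 * k)" by simp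
    qed simp
    finally show ?thesis .
  qed
  have i3: "integrable P (\<lambda>r. (5120 * b ^ 4) ^ k * (2 + \<rho> r ^ (3 * k)))"
    using rho_moment(1)[of "3 * k"] by simp
  have i2: "integrable P (\<lambda>r. (f r * f r) ^ k)"
  proof (rule integrable_between[OF i3])
    show "(f r * f r) ^ k \<le> (5120 * b ^ 4) ^ k * (2 + \<rho> r ^ (3 * k))" if "r \<in> space P" for r
      by (rule fle[OF that])
  qed auto
  have "(\<integral>r. (f r * f r) ^ k \<partial>P) \<le> (\<integral>r. (5120 * b ^ 4) ^ k * (2 + \<rho> r ^ (3 * k)) \<partial>P)"
    by (intro integral_mono i2 i3 fle)
  also have "\<dots> = (5120 * b ^ 4) ^ k * (2 + (\<integral>r. \<rho> r ^ (3 * k) \<partial>P))"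
    using rho_moment(1)[of "3 * k"] prob_space by simp
  also have "\<dots> \<le> (5120 * b ^ 4) ^ k * (2 + 1)"
    using moment_le unfolding \<rho>_def G_def by (intro mult_left_mono add_left_mono) auto
  finally have "(\<integral>r. (f r * f r) ^ k \<partial>P) \<le> c" by (simp add: c_def)
  then have m: "integrable Pt (\<lambda>w. F.Q t w ^ k)" "(\<integral>w. F.Q t w ^ k \<partial>Pt) \<le> c * (12 * (real k)\<^sup>2 * t) ^ k"
    using F.moment_bound[of k c t] i2 k_pos by auto
  have "Pt.prob {w \<in> space Pt. 168100 * (real k)\<^sup>2 * t * b ^ 4 < F.Q t w}
      \<le> c * (12 * (real k)\<^sup>2 * t) ^ k / (168100 * (real k)\<^sup>2 * t * b ^ 4) ^ k"
    by (rule Pt.prob_gt_le_power_moment[OF _ _ _ m k_pos]) (use k_pos t_pos b_pos in \<open>auto simp: Q_eq\<close>)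
  also have "\<dots> = 3 * (61440 / 168100) ^ k"
  proof -
    define d where "d = (real k)\<^sup>2 * t * b ^ 4"
    have d: "0 < d" using k_pos t_pos b_pos by (simp add: d_def)
    have "c * (12 * (real k)\<^sup>2 * t) ^ k = 3 * (61440 * d) ^ k"
      unfolding c_def d_def mult.assoc power_mult_distrib[symmetric] by (simp add: mult_ac)
    moreover have "168100 * (real k)\<^sup>2 * t * b ^ 4 = 168100 * d"
      by (simp add: d_def mult_ac)
    ultimately have "c * (12 * (real k)\<^sup>2 * t) ^ k / (168100 * (real k)\<^sup>2 * t * b ^ 4) ^ k
        = 3 * ((61440 * d) ^ k / (168100 * d) ^ k)" by (simp only: times_divide_eq_right)
    also have "(61440 * d) ^ k / (168100 * d) ^ k = (61440 * d / (168100 * d)) ^ k" by (rule power_divide[symmetric])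
    also have "61440 * d / (168100 * d) = 61440 / 168100" using d by simp
    finally show ?thesis .
  qed
  also have "\<dots> \<le> 3 * exp (- real k)" by (intro mult_left_mono exp_bound_ratio) auto
  finally show ?thesis unfolding bad3_def unfolding Q_eq unfolding f_def .
qed

section \<open>Normal approximation of the linear part\<close>

lemma eta_pos: "0 < \<eta>"
  unfolding \<eta>_def using k_pos t_pos b_pos s_pos by auto

lemma zeta_third_moment: "integrable P (\<lambda>r. \<bar>\<zeta> r\<bar> ^ 3)" "(\<integral>r. \<bar>\<zeta> r\<bar> ^ 3 \<partial>P) \<le> 648 * b ^ 3"
proof -
  have le: "\<bar>\<zeta> r\<bar> ^ 3 \<le> 216 * b ^ 3 * (1 + \<rho> r ^ 3)" if r: "r \<in> space P" for r
  proof -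
    \<comment> \<open>6^2 = 36 exceeds the 32 of \<open>zeta_sq_le\<close>, and 6^3 * (1 + 2) =
      648.\<close>
    define y where "y = \<bar>\<zeta> r\<bar> / (6 * b)"
    have y0: "0 \<le> y" using b_pos by (simp add: y_def)
    have "(\<zeta> r)\<^sup>2 \<le> 36 * b\<^sup>2 * \<rho> r"
      by (rule order.trans[OF zeta_sq_le[OF r]]) (intro mult_right_mono rho_nonneg, auto)
    then have "y\<^sup>2 \<le> \<rho> r" unfolding y_def using b_pos by (simp add: power_divide power_mult_distrib field_simps)
    then have "(y\<^sup>2) ^ 3 \<le> \<rho> r ^ 3" by (intro power_mono) auto
    moreover have "y ^ 3 \<le> 1 + (y\<^sup>2) ^ 3"
      using power_le_one_add_power[OF y0, of 3 6] by (simp flip: power_mult)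
    ultimately have "y ^ 3 \<le> 1 + \<rho> r ^ 3" by linarith
    then have "216 * b ^ 3 * y ^ 3 \<le> 216 * b ^ 3 * (1 + \<rho> r ^ 3)" using b_pos by (intro mult_left_mono) auto
    moreover have "\<bar>\<zeta> r\<bar> = 6 * b * y" using b_pos by (simp add: y_def)
    ultimately show ?thesis by (simp add: power_mult_distrib)
  qed
  have r3: "integrable P (\<lambda>r. \<rho> r ^ 3)" "(\<integral>r. \<rho> r ^ 3 \<partial>P) \<le> 2" using rho_moment[of 3] k_pos by auto
  then have i: "integrable P (\<lambda>r. 216 * b ^ 3 * (1 + \<rho> r ^ 3))" by simp
  show j: "integrable P (\<lambda>r. \<bar>\<zeta> r\<bar> ^ 3)"
  proof (rule integrable_between[OF i])
    show "\<bar>\<zeta> r\<bar> ^ 3 \<le> 216 * b ^ 3 * (1 + \<rho> r ^ 3)" if "r \<in> space P" for r by (rule le[OF that])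
  qed auto
  have "(\<integral>r. \<bar>\<zeta> r\<bar> ^ 3 \<partial>P) \<le> (\<integral>r. 216 * b ^ 3 * (1 + \<rho> r ^ 3) \<partial>P)" by (intro integral_mono i j le)
  also have "\<dots> = 216 * b ^ 3 * (1 + (\<integral>r. \<rho> r ^ 3 \<partial>P))" using r3 prob_space by simp
  also have "\<dots> \<le> 216 * b ^ 3 * (1 + 2)" using r3 b_pos by (intro mult_left_mono) auto
  finally show "(\<integral>r. \<bar>\<zeta> r\<bar> ^ 3 \<partial>P) \<le> 648 * b ^ 3" by simp
qed

text \<open>120 * 648 = 77760, and k^2 \<ge> 1 brings the error into the form of
  \<open>\<eta>\<close>.\<close>

lemma zeta_berry_esseen:
  "\<bar>Pt.prob {w \<in> space Pt. (\<Sum>i<t. \<zeta> (w i)) \<le> u * (s * sqrt t)} - Phi u\<bar> \<le> 77760 * \<eta>"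
proof -
  have ne: "{..<t} \<noteq> {}" using t_pos by auto
  define \<mu> where "\<mu> = distr P borel \<zeta>"
  have iv: "Pt.indep_vars (\<lambda>_. P) (\<lambda>i w. w i) {..<t}"
    by (rule indep_vars_PiM_coordinates) (use ne prob_space_axioms in auto)
  have e: "integrable \<mu> f \<longleftrightarrow> integrable P (\<lambda>r. f (\<zeta> r))" "(\<integral>x. f x \<partial>\<mu>) = (\<integral>r. f (\<zeta> r) \<partial>P)"
    if "f \<in> borel_measurable borel" for f :: "real \<Rightarrow> real"
    unfolding \<mu>_def using that by (auto simp: integrable_distr_eq integral_distr)
  have i1: "integrable P \<zeta>"
  proof (rule Bochner_Integration.integrable_bound)
    show "integrable P (\<lambda>r. 1 + (\<zeta> r)\<^sup>2)" using zeta_sq_integrable by simp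
    show "AE r in P. norm (\<zeta> r) \<le> norm (1 + (\<zeta> r)\<^sup>2)"
    proof (rule AE_I2)
      fix r
      show "norm (\<zeta> r) \<le> norm (1 + (\<zeta> r)\<^sup>2)"
        using power_le_one_add_power[of "\<bar>\<zeta> r\<bar>" 1 2] by simp
    qed
  qed measurable
  have "\<bar>Pt.prob {w \<in> space Pt. (\<Sum>i<t. \<zeta> (w i)) \<le> u * (s * sqrt (card {..<t}))} - Phi u\<bar>
     \<le> 120 * (\<integral>x. \<bar>x\<bar> ^ 3 \<partial>\<mu>) / (s ^ 3 * sqrt (card {..<t}))"
  proof (rule Pt.berry_esseen_iid)
    show "Pt.indep_vars (\<lambda>_. borel) (\<lambda>i w. \<zeta> (w i)) {..<t}"
      using Pt.indep_vars_compose2[OF iv, of "\<lambda>_. \<zeta>" "\<lambda>_. borel"] by simp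
    show "distr Pt borel (\<lambda>w. \<zeta> (w i)) = \<mu>" if "i \<in> {..<t}" for i
    proof -
      have "\<mu> = distr (distr Pt P (\<lambda>w. w i)) borel \<zeta>"
        unfolding \<mu>_def using that prob_space_axioms by (subst distr_PiM_component) auto
      also have "\<dots> = distr Pt borel (\<lambda>w. \<zeta> (w i))"
        using that by (subst distr_distr) (auto simp: comp_def)
      finally show ?thesis by simp
    qed
    show "(\<integral>x. x \<partial>\<mu>) = 0" using e(2)[of "\<lambda>x. x"] centred[OF a_L2] by (simp add: \<zeta>_def)
    show "(\<integral>x. x\<^sup>2 \<partial>\<mu>) = s\<^sup>2" using e(2)[of "\<lambda>x. x\<^sup>2"] by (simp add: s_def \<zeta>_def)
    show "integrable \<mu> (\<lambda>x. x)" using e(1)[of "\<lambda>x. x"] i1 by simp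
    show "integrable \<mu> (\<lambda>x. x\<^sup>2)" using e(1)[of "\<lambda>x. x\<^sup>2"] zeta_sq_integrable by simp
    show "integrable \<mu> (\<lambda>x. \<bar>x\<bar> ^ 3)" using e(1)[of "\<lambda>x. \<bar>x\<bar> ^ 3"] zeta_third_moment by simp
  qed (use ne s_pos in auto)
  also have "(\<integral>x. \<bar>x\<bar> ^ 3 \<partial>\<mu>) = (\<integral>r. \<bar>\<zeta> r\<bar> ^ 3 \<partial>P)" by (rule e(2)) simp
  also have "120 * (\<integral>r. \<bar>\<zeta> r\<bar> ^ 3 \<partial>P) / (s ^ 3 * sqrt (card {..<t})) \<le> 120 * (648 * b ^ 3) / (s ^ 3 * sqrt (card {..<t}))"
    using zeta_third_moment(2) s_pos by (intro divide_right_mono mult_left_mono) auto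
  also have "\<dots> = 77760 * (1 / sqrt t * (b / s) ^ 3)" by (simp add: power_divide)
  also have "\<dots> \<le> 77760 * \<eta>"
  proof -
    have "1 \<le> (real k)\<^sup>2" using k_pos by (intro one_le_power) simp
    then show ?thesis unfolding \<eta>_def using b_pos s_pos
      by (intro mult_left_mono mult_right_mono divide_right_mono) auto
  qed
  finally show ?thesis by simp
qed

definition zb :: "(nat \<Rightarrow> 'r) \<Rightarrow> real" where "zb w = (\<Sum>i<t. \<zeta> (w i)) / t"

lemma zb_meas [measurable]: "zb \<in> borel_measurable Pt"
  unfolding zb_def using sum_comp_meas[OF zeta_meas] by simp

text \<open>Probability integral transform: \<open>Phi\<close> of a nearly normal variable is nearly
  uniform, and the Berry-Esseen error is the deviation from uniformity.\<close>

lemma prob_Phi_zb_ge: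
  assumes "v \<le> 1"
  shows "Pt.prob {w \<in> space Pt. v \<le> Phi (sqrt t * zb w / s)} \<le> 1 - v + 77761 * \<eta>"
proof (cases "v - \<eta> \<le> 0")
  case True
  then show ?thesis using Pt.prob_le_1[of "{w \<in> space Pt. v \<le> Phi (sqrt t * zb w / s)}"] eta_pos by linarith
next
  case pos: False
  \<comment> \<open>Aiming at \<open>v - \<eta>\<close> keeps the value strictly inside (0,1) even
    for \<open>v = 1\<close> and makes the comparison below strict. It adds one
    \<open>\<eta>\<close> to the 77760.\<close>
  obtain u where u: "Phi u = v - \<eta>" using Phi_surj[of "v - \<eta>"] pos assms eta_pos by auto
    let ?A = "{w \<in> space Pt. (\<Sum>i<t. \<zeta> (w i)) \<le> u * (s * sqrt t)}"
    have A: "?A \<in> sets Pt" using sum_comp_meas[OF zeta_meas] by simp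
    have "Pt.prob {w \<in> space Pt. v \<le> Phi (sqrt t * zb w / s)} \<le> Pt.prob (space Pt - ?A)"
    proof (rule Pt.finite_measure_mono)
      show "{w \<in> space Pt. v \<le> Phi (sqrt t * zb w / s)} \<subseteq> space Pt - ?A"
      proof safe
        fix w assume v: "v \<le> Phi (sqrt t * zb w / s)" and le: "(\<Sum>i<t. \<zeta> (w i)) \<le> u * (s * sqrt t)"
        have "sqrt t * zb w / s = (\<Sum>i<t. \<zeta> (w i)) / (s * sqrt t)"
          unfolding zb_def using t_pos s_pos by (simp add: field_simps)
        also have "\<dots> \<le> u" using le s_pos t_pos by (simp add: pos_divide_le_eq)
        finally have "Phi (sqrt t * zb w / s) \<le> v - \<eta>" using Phi_mono u by metis
        with v eta_pos show False by linarith
      qed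
    qed (use A in auto)
    also have "\<dots> = 1 - Pt.prob ?A" by (rule Pt.prob_compl[OF A])
    also have "\<dots> \<le> 1 - v + 77761 * \<eta>" using zeta_berry_esseen[of u] u by linarith
    finally show ?thesis .
qed

text \<open>The last set holds the samples for which the bound on the bootstrap probability of
  falling below \<open>excess\<close> reaches \<open>v\<close>.\<close>

definition "bad v = bad1 \<union> bad2 \<union> bad3 \<union> {w \<in> space Pt. v \<le> Phi (sqrt t * zb w / s) + 10^9 * \<eta>}"

lemma bad_meas: "bad v \<in> sets Pt"
  unfolding bad_def by (intro sets.Un bad_sets) measurable

text \<open>The exceptional events give 2 + 1 + 3 = 6; the two normal approximations give 10^9 and
  77761.\<close>

lemma prob_bad_le:
  assumes "v \<le> 1"
  shows "Pt.prob (bad v) \<le> 1 - v + 6 * exp (- real k) + 2 * 10^9 * \<eta>"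
proof -
  let ?E = "{w \<in> space Pt. v \<le> Phi (sqrt t * zb w / s) + 10^9 * \<eta>}"
  have E: "?E \<in> sets Pt" by measurable
  have "Pt.prob (bad v) \<le> Pt.prob bad1 + Pt.prob bad2 + Pt.prob bad3 + Pt.prob ?E"
    unfolding bad_def using bad_sets E
    by (intro order.trans[OF measure_Un_le] add_mono order.refl sets.Un) auto
  also have "?E = {w \<in> space Pt. v - 10^9 * \<eta> \<le> Phi (sqrt t * zb w / s)}" by auto
  also have "Pt.prob \<dots> \<le> 1 - (v - 10^9 * \<eta>) + 77761 * \<eta>"
    by (rule prob_Phi_zb_ge) (use assms eta_pos in simp)
  finally show ?thesis using bad1_le bad2_le bad3_le eta_pos by simp
qed

lemma L2_sample_comp:
  assumes "w \<in> space Pt" shows "L2_sample \<nu> a t (\<lambda>i. U (w i))"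
  by unfold_locales (use a_L2 U_L2 in_space_Pt[OF assms] t_pos in auto)

theorem boot_prob_less:
  assumes w: "w \<in> space Pt" "w \<notin> bad v" and eta_le: "\<eta> \<le> 1 / 100000"
  shows "measure (PiM {..<t} (\<lambda>_. uniform_count_measure {..<t}))
     {J \<in> space (PiM {..<t} (\<lambda>_. uniform_count_measure {..<t})).
        L2_sample.boot \<nu> a t (\<lambda>i. U (w i)) J < L2_sample.excess \<nu> a t (\<lambda>i. U (w i))} < v"
proof -
  interpret S: L2_sample \<nu> a t "\<lambda>i. U (w i)" by (rule L2_sample_comp[OF w(1)])
  have st: "0 < sqrt t" using t_pos by simp
  have "measure (PiM {..<t} (\<lambda>_. uniform_count_measure {..<t}))
     {J \<in> space (PiM {..<t} (\<lambda>_. uniform_count_measure {..<t})). S.boot J < S.excess}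
     \<le> Phi (sqrt t * S.zbar / s) + 10^9 * \<eta>"
  proof (rule S.boot_prob_le[where b = b and k = "real k"])
    have "K.Q t w \<le> 33 * (real k)\<^sup>2 * t * b" using w unfolding bad_def bad1_def by auto
    then show "S.ip S.ubar S.ubar \<le> 33 * (real k)\<^sup>2 * b / t"
      unfolding S.ip_ubar K.Q_def G_def using t_pos by (simp add: field_simps power2_eq_square)
    have "(\<Sum>i<t. \<rho> (w i) ^ 3) / t \<le> 3" using w unfolding bad_def bad2_def by auto
    then show "(\<Sum>i<t. (S.ip (U (w i)) (U (w i)) / b) ^ 3) \<le> 3 * t"
      unfolding \<rho>_def G_def using t_pos by (simp add: pos_divide_le_eq)
    have "(\<Sum>i<t. (\<zeta> (w i))\<^sup>2 - s\<^sup>2)\<^sup>2 \<le> 168100 * (real k)\<^sup>2 * t * b ^ 4"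
      using w unfolding bad_def bad3_def by auto
    also have "\<dots> = (410 * k * b\<^sup>2 * sqrt t)\<^sup>2"
      by (simp add: power_mult_distrib flip: power_mult)
    finally have "\<bar>\<Sum>i<t. (\<zeta> (w i))\<^sup>2 - s\<^sup>2\<bar> \<le> 410 * k * b\<^sup>2 * sqrt t"
      by (simp add: abs_le_square_iff[symmetric])
    then have "\<bar>\<Sum>i<t. (\<zeta> (w i))\<^sup>2 - s\<^sup>2\<bar> / t \<le> 410 * k * b\<^sup>2 * sqrt t / t"
      by (intro divide_right_mono) auto
    also have "410 * k * b\<^sup>2 * sqrt t / t = 410 * k * b\<^sup>2 / sqrt t"
      using t_pos by (simp add: field_simps)
    also have "\<bar>\<Sum>i<t. (\<zeta> (w i))\<^sup>2 - s\<^sup>2\<bar> / t = \<bar>(\<Sum>i<t. (\<zeta> (w i))\<^sup>2) / t - s\<^sup>2\<bar>"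
    proof -
      have "(\<Sum>i<t. (\<zeta> (w i))\<^sup>2) / t - s\<^sup>2 = (\<Sum>i<t. (\<zeta> (w i))\<^sup>2 - s\<^sup>2) / t"
        using t_pos by (simp add: sum_subtractf diff_divide_distrib)
      then show ?thesis by (simp add: abs_divide)
    qed
    finally show "\<bar>(\<Sum>i<t. (S.zeta' i)\<^sup>2) / t - s\<^sup>2\<bar> \<le> 410 * real k * b\<^sup>2 / sqrt t"
      unfolding S.zeta'_def \<zeta>_def by simp
  qed (use b_pos s_pos k_pos norm_a eta_le ratio_ge in \<open>auto simp: \<eta>_def\<close>)
  also have "S.zbar = zb w" unfolding S.zbar_def S.zeta'_def zb_def \<zeta>_def ..
  also have "Phi (sqrt t * zb w / s) + 10^9 * \<eta> < v" using w unfolding bad_def by auto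
  finally show ?thesis .
qed

end

section \<open>Empirical frequencies\<close>

text \<open>On a finite discrete product every set is a finite union of singletons, and these are
  boxes.\<close>

lemma sets_PiM_finite_discrete:
  assumes I: "finite I" and M: "\<And>i. i \<in> I \<Longrightarrow> sets (M i) = Pow A" and A: "finite A" and S: "S \<subseteq> PiE I (\<lambda>_. A)"
  shows "S \<in> sets (PiM I M)"
proof -
  have fin: "finite S" using finite_PiE[OF I, of "\<lambda>_. A"] A S by (auto intro: finite_subset)
  have "{x} \<in> sets (PiM I M)" if "x \<in> S" for x
  proof -
    have x: "x \<in> PiE I (\<lambda>_. A)" using S that by auto
    have "PiE I (\<lambda>i. {x i}) \<in> sets (PiM I M)"
    proof (rule sets_PiM_I_finite[OF I])
      fix i assume i: "i \<in> I"
      then have "x i \<in> A" using x by (rule PiE_mem[rotated])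
      then show "{x i} \<in> sets (M i)" using M[OF i] by simp
    qed
    also have "PiE I (\<lambda>i. {x i}) = {x}"
      using x by (metis PiE_singleton PiE_iff)
    finally show ?thesis .
  qed
  then have "(\<Union>x\<in>S. {x}) \<in> sets (PiM I M)" using fin by (intro sets.finite_UN) auto
  then show ?thesis by simp
qed

text \<open>Hoeffding's inequality with deviation \<epsilon> = sqrt(ln B / B) gives exp(-2 B
  \<epsilon>^2) = 1 / B^2. This is at most \<epsilon> for B \<ge> 2, but not for B = 1, where
  \<epsilon> is 0. The same \<epsilon> is the margin between the success probability and
  \<open>q\<close>.\<close>

lemma prob_many_successes_le:
  fixes N :: "'j measure" and B :: nat and q :: real and T :: "'i set"
  assumes N: "prob_space N" and A: "A \<in> sets (PiM T (\<lambda>_. N))" and T: "T \<noteq> {}" and B: "2 \<le> B"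
    and p: "measure (PiM T (\<lambda>_. N)) A \<le> q - sqrt (ln B / B)"
  shows "measure (PiM ({..<B} \<times> T) (\<lambda>_. N))
      {J \<in> space (PiM ({..<B} \<times> T) (\<lambda>_. N)). q * B \<le> card {b \<in> {..<B}. (\<lambda>i\<in>T. J (b, i)) \<in> A}}
     \<le> sqrt (ln B / B)"
proof -
  let ?M = "PiM ({..<B} \<times> T) (\<lambda>_. N)" and ?N = "PiM T (\<lambda>_. N)"
  interpret N: prob_space N by fact
  interpret M: prob_space ?M by (intro prob_space_PiM) (rule N)
  define X where "X b J = (indicator A (\<lambda>i\<in>T. J (b, i)) :: real)" for b :: nat and J :: "nat \<times> 'i \<Rightarrow> 'j"
  define p where "p = measure ?N A"
  define \<epsilon> where "\<epsilon> = sqrt (ln B / B)"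
  have e2: "\<epsilon>\<^sup>2 = ln B / B" and e0: "0 \<le> \<epsilon>" using B by (auto simp: \<epsilon>_def)
  have m: "(\<lambda>J. \<lambda>i\<in>T. J (b, i)) \<in> measurable ?M ?N" if "b < B" for b
    by (rule measurable_restrict) (rule measurable_component_singleton, use that in simp)
  have d: "distr ?M ?N (\<lambda>J. \<lambda>i\<in>T. J (b, i)) = ?N" if "b < B" for b
    by (rule distr_PiM_reindex[of "{..<B} \<times> T" "\<lambda>_. N" "Pair b" T]) (use that N in \<open>auto simp: inj_on_def\<close>)
  have iv: "M.indep_vars (\<lambda>_. borel) X {..<B}"
  proof -
    have c: "M.indep_vars (\<lambda>_. N) (\<lambda>x J. J x) ({..<B} \<times> T)"
      by (rule indep_vars_PiM_coordinates) (use N T B in \<open>auto simp: lessThan_empty_iff\<close>)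
    \<comment> \<open>The indicator of a block reads only the coordinates in
      \<open>{b} \<times> T\<close>, and these blocks are disjoint.\<close>
    have "M.indep_vars (\<lambda>b. PiM ({b} \<times> T) (\<lambda>_. N)) (\<lambda>b J. restrict (\<lambda>x. J x) ({b} \<times> T)) {..<B}"
      by (rule M.indep_vars_restrict[OF c]) (auto simp: disjoint_family_on_def)
    then have "M.indep_vars (\<lambda>_. borel) (\<lambda>b J. X b (restrict (\<lambda>x. J x) ({b} \<times> T))) {..<B}"
    proof (rule M.indep_vars_compose2)
      fix b assume "b \<in> {..<B}"
      have "(\<lambda>J. \<lambda>i\<in>T. J (b, i)) \<in> measurable (PiM ({b} \<times> T) (\<lambda>_. N)) ?N"
        by (rule measurable_restrict) (rule measurable_component_singleton, simp)
      then show "X b \<in> borel_measurable (PiM ({b} \<times> T) (\<lambda>_. N))"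
        unfolding X_def by (rule measurable_compose[OF _ borel_measurable_indicator[OF A]])
    qed
    moreover have "X b (restrict (\<lambda>x. J x) ({b} \<times> T)) = X b J" for b J
      unfolding X_def by (intro arg_cong[where f = "indicator A"]) (auto simp: restrict_def)
    ultimately show ?thesis by simp
  qed
  have Xm: "X b \<in> borel_measurable ?M" if "b < B" for b
    unfolding X_def using m[OF that] by (rule measurable_compose[OF _ borel_measurable_indicator[OF A]])
  have EX: "M.expectation (X b) = p" if "b < B" for b
  proof -
    have "M.expectation (X b) = (\<integral>x. indicator A x \<partial>distr ?M ?N (\<lambda>J. \<lambda>i\<in>T. J (b, i)))"
      unfolding X_def using A by (subst integral_distr[OF m[OF that]]) auto
    also have "\<dots> = p" unfolding d[OF that] p_def using A by simp
    finally show ?thesis .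
  qed
  interpret H: Hoeffding_ineq ?M "{..<B}" X "\<lambda>_. 0" "\<lambda>_. 1" "\<Sum>b<B. M.expectation (X b)"
    by unfold_locales (use iv in \<open>auto simp: X_def indicator_def\<close>)
  have "M.prob {J \<in> space ?M. q * B \<le> card {b \<in> {..<B}. (\<lambda>i\<in>T. J (b, i)) \<in> A}}
     \<le> M.prob {J \<in> space ?M. (\<Sum>b<B. M.expectation (X b)) + B * \<epsilon> \<le> (\<Sum>b<B. X b J)}"
  proof (rule M.finite_measure_mono)
    show "{J \<in> space ?M. q * B \<le> card {b \<in> {..<B}. (\<lambda>i\<in>T. J (b, i)) \<in> A}}
      \<subseteq> {J \<in> space ?M. (\<Sum>b<B. M.expectation (X b)) + B * \<epsilon> \<le> (\<Sum>b<B. X b J)}"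
    proof safe
      fix J assume c: "q * B \<le> card {b \<in> {..<B}. (\<lambda>i\<in>T. J (b, i)) \<in> A}"
      have "real (card {b \<in> {..<B}. (\<lambda>i\<in>T. J (b, i)) \<in> A}) = (\<Sum>b<B. X b J)"
        unfolding X_def by (simp add: indicator_def sum.If_cases Int_def)
      with c have "q * B \<le> (\<Sum>b<B. X b J)" by linarith
      moreover have "(\<Sum>b<B. M.expectation (X b)) + B * \<epsilon> = (p + \<epsilon>) * B"
        using EX by (simp add: algebra_simps)
      moreover have "(p + \<epsilon>) * B \<le> q * B"
        using assms(5) by (intro mult_right_mono) (auto simp: p_def \<epsilon>_def)
      ultimately show "(\<Sum>b<B. M.expectation (X b)) + B * \<epsilon> \<le> (\<Sum>b<B. X b J)" by linarith
    qed
    have "(\<lambda>J. \<Sum>b<B. X b J) \<in> borel_measurable ?M"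
      by (rule borel_measurable_sum) (rule Xm, simp)
    then show "{J \<in> space ?M. (\<Sum>b<B. M.expectation (X b)) + B * \<epsilon> \<le> (\<Sum>b<B. X b J)} \<in> M.events"
      by measurable
  qed
  also have "\<dots> \<le> exp (- 2 * (B * \<epsilon>)\<^sup>2 / (\<Sum>b<B. (1 - 0)\<^sup>2))"
    by (rule H.Hoeffding_ineq_ge) (use B e0 in auto)
  also have "- 2 * (B * \<epsilon>)\<^sup>2 / (\<Sum>b<B. (1 - 0)\<^sup>2) = - 2 * ln B"
  proof -
    have "(B * \<epsilon>)\<^sup>2 = B * ln B"
      unfolding power_mult_distrib e2 using B by (simp add: power2_eq_square)
    then show ?thesis using B by simp
  qed
  also have "exp (- 2 * ln B) \<le> \<epsilon>"
  proof -
    have "exp (- 2 * ln B) = (1 / B)\<^sup>2"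
      using B by (simp add: exp_minus exp_of_nat_mult[of 2 "ln (real B)", simplified] power2_eq_square field_simps)
    also have "\<dots> \<le> \<epsilon>"
      unfolding \<epsilon>_def
    proof (rule real_le_rsqrt)
      have l: "1 / 2 \<le> ln (real B)"
      proof -
        have "1 - 1 / real B \<le> ln (real B)"
          using ln_le_minus_one[of "1 / real B"] B by (simp add: ln_div)
        moreover have "1 / real B \<le> 1 / 2" using B by (simp add: field_simps)
        ultimately show ?thesis by linarith
      qed
      have "((1 / real B)\<^sup>2)\<^sup>2 = 1 / real B * (1 / real B) ^ 3" by (simp add: power2_eq_square power3_eq_cube)
      also have "\<dots> \<le> 1 / real B * (1 / 2) ^ 3"
        using B by (intro mult_left_mono power_mono) (auto simp: field_simps)
      also have "\<dots> \<le> 1 / real B * ln (real B)" using l by (intro mult_left_mono) (auto simp: power3_eq_cube)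
      finally show "((1 / real B)\<^sup>2)\<^sup>2 \<le> ln (real B) / real B" by simp
    qed
    finally show ?thesis .
  qed
  finally show ?thesis unfolding \<epsilon>_def .
qed

section \<open>A fixed training set\<close>

lemma ennroot_power: "0 < m \<Longrightarrow> ennroot m x ^ m = x"
  by (cases x) (auto simp: ennroot_def ennreal_power real_root_pow_pos2 power_eq_top_ennreal_iff top_power_ennreal infinity_ennreal_def)

lemma ennroot_le_iff:
  assumes "0 < m" "0 \<le> c" shows "ennroot m x \<le> ennreal c \<longleftrightarrow> x \<le> ennreal (c ^ m)"
proof (cases x)
  case (real r)
  have "root m r \<le> c \<longleftrightarrow> r \<le> c ^ m"
    using assms real by (metis real_root_le_iff real_root_power_cancel)
  then show ?thesis using real assms by (simp add: ennroot_def infinity_ennreal_def)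
qed (simp add: ennroot_def infinity_ennreal_def top_unique)

text \<open>The even exponent removes the square root, so \<open>beta\<close> is a moment of the
  squared norm.\<close>

lemma norm_L2_power: "norm_L2 \<nu> g ^ (2 * m) = (\<integral>\<^sup>+z. ennreal ((g z)\<^sup>2) \<partial>\<nu>) ^ m"
  by (simp add: norm_L2_def power_mult ennroot_power power2_eq_square[of "g _"])

lemma psi_eq_inner: "psi \<nu> f = inner_L2 \<nu> (\<lambda>z. f (fst z) - snd z) (\<lambda>z. f (fst z) - snd z)"
  unfolding psi_def inner_L2_def by (intro Bochner_Integration.integral_cong refl) (simp add: power2_eq_square algebra_simps)

text \<open>\<open>b\<close> is any positive real above the moment and not the moment itself: that
  \<open>beta\<close> is positive follows only from the estimates.\<close>

locale fixed_training = P: prob_space P + N: prob_space \<nu>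
  for P :: "'r measure" and \<nu> :: "('x \<times> real) measure" +
  fixes MX :: "'x measure" and \<phi> :: "'d \<Rightarrow> 'r \<Rightarrow> 'x \<Rightarrow> real" and d :: 'd and t k :: nat and b :: real
  assumes sets_nu [measurable_cong]: "sets \<nu> = sets (MX \<Otimes>\<^sub>M borel)"
    and phi_meas: "(\<lambda>z. \<phi> d (fst z) (snd z)) \<in> borel_measurable (P \<Otimes>\<^sub>M MX)"
    and t_pos: "0 < t" and k_pos: "0 < k"
    and b_pos: "0 < b" and beta_le: "beta \<nu> P \<phi> (3 * k) d \<le> ennreal b"
    and sigma_nz: "sigma_D \<nu> P \<phi> d \<noteq> 0"
begin

abbreviation "\<theta> \<equiv> theta P \<phi> d"

lemma phi_comp [measurable (raw)]:
  "f \<in> measurable L P \<Longrightarrow> g \<in> measurable L MX \<Longrightarrow> (\<lambda>x. \<phi> d (f x) (g x)) \<in> borel_measurable L"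
  using measurable_compose[OF measurable_Pair phi_meas, of f L g] by simp

lemma theta_meas [measurable]: "\<theta> \<in> borel_measurable MX"
  unfolding theta_def by measurable

lemma fst_nu [measurable]: "fst \<in> measurable \<nu> MX" and snd_nu [measurable]: "snd \<in> borel_measurable \<nu>"
  using measurable_cong_sets[OF sets_nu refl] by auto

definition dev :: "'r \<Rightarrow> 'x \<times> real \<Rightarrow> real" where "dev r z = \<phi> d r (fst z) - \<theta> (fst z)"
definition res :: "'r \<Rightarrow> 'x \<times> real \<Rightarrow> real" where "res r z = \<phi> d r (fst z) - snd z"
definition a :: "'x \<times> real \<Rightarrow> real" where "a z = \<theta> (fst z) - snd z"
definition devnorm :: "'r \<Rightarrow> ennreal" where "devnorm r = (\<integral>\<^sup>+z. ennreal ((dev r z)\<^sup>2) \<partial>\<nu>)"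
definition resnorm :: "'r \<Rightarrow> ennreal" where "resnorm r = (\<integral>\<^sup>+z. ennreal ((res r z)\<^sup>2) \<partial>\<nu>)"

text \<open>Set to zero where the norm is infinite, so that all values lie in \<open>L2 \<nu>\<close>.\<close>

definition U :: "'r \<Rightarrow> 'x \<times> real \<Rightarrow> real" where "U r z = (if devnorm r < \<infinity> then dev r z else 0)"

lemma dev_meas [measurable]: "(\<lambda>z. dev (fst z) (snd z)) \<in> borel_measurable (P \<Otimes>\<^sub>M \<nu>)"
  unfolding dev_def by measurable

lemma res_meas [measurable]: "(\<lambda>z. res (fst z) (snd z)) \<in> borel_measurable (P \<Otimes>\<^sub>M \<nu>)"
  unfolding res_def by measurable

lemma dev_meas' [measurable]: "r \<in> space P \<Longrightarrow> dev r \<in> borel_measurable \<nu>"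
  unfolding dev_def by measurable

lemma res_meas' [measurable]: "r \<in> space P \<Longrightarrow> res r \<in> borel_measurable \<nu>"
  unfolding res_def by measurable

lemma devnorm_meas [measurable]: "devnorm \<in> borel_measurable P"
  unfolding devnorm_def[abs_def] by (rule N.borel_measurable_nn_integral) (simp add: split_beta')

lemma resnorm_meas [measurable]: "resnorm \<in> borel_measurable P"
  unfolding resnorm_def[abs_def] by (rule N.borel_measurable_nn_integral) (simp add: split_beta')

lemma U_meas [measurable]: "(\<lambda>z. U (fst z) (snd z)) \<in> borel_measurable (P \<Otimes>\<^sub>M \<nu>)"
  unfolding U_def by measurable

lemma nn_moments: "(\<integral>\<^sup>+r. resnorm r ^ (3 * k) \<partial>P) \<le> ennreal (b ^ (3 * k))"
  "(\<integral>\<^sup>+r. devnorm r ^ (3 * k) \<partial>P) \<le> ennreal (b ^ (3 * k))"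
proof -
  have r: "norm_L2 \<nu> (\<lambda>(x, y). \<phi> d r x - y) ^ (2 * (3 * k)) = resnorm r ^ (3 * k)"
    and u: "norm_L2 \<nu> (\<lambda>(x, y). \<phi> d r x - \<theta> x) ^ (2 * (3 * k)) = devnorm r ^ (3 * k)" for r
    unfolding norm_L2_power resnorm_def devnorm_def res_def dev_def by (simp_all add: split_beta')
  have "max (ennroot (3 * k) (\<integral>\<^sup>+r. resnorm r ^ (3 * k) \<partial>P)) (ennroot (3 * k) (\<integral>\<^sup>+r. devnorm r ^ (3 * k) \<partial>P)) \<le> ennreal b"
    using beta_le unfolding beta_def r u .
  then show "(\<integral>\<^sup>+r. resnorm r ^ (3 * k) \<partial>P) \<le> ennreal (b ^ (3 * k))"
    "(\<integral>\<^sup>+r. devnorm r ^ (3 * k) \<partial>P) \<le> ennreal (b ^ (3 * k))"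
    using k_pos b_pos by (simp_all add: ennroot_le_iff)
qed

lemma AE_finite: "AE r in P. resnorm r < \<infinity>" "AE r in P. devnorm r < \<infinity>"
proof -
  have *: "AE r in P. h r < \<infinity>" if [measurable]: "h \<in> borel_measurable P"
    and le: "(\<integral>\<^sup>+r. h r ^ (3 * k) \<partial>P) \<le> ennreal (b ^ (3 * k))" for h
  proof -
    have "(\<integral>\<^sup>+r. h r ^ (3 * k) \<partial>P) \<noteq> \<infinity>" using le by (auto simp: top_unique)
    then have "AE r in P. h r ^ (3 * k) \<noteq> \<infinity>" by (intro nn_integral_noteq_infinite) auto
    then show ?thesis
      by eventually_elim (use k_pos in \<open>auto simp: power_eq_top_ennreal_iff less_top infinity_ennreal_def\<close>)
  qed
  show "AE r in P. resnorm r < \<infinity>" "AE r in P. devnorm r < \<infinity>"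
    by (intro * nn_moments; measurable)+
qed

lemma U_L2: "r \<in> space P \<Longrightarrow> U r \<in> L2 \<nu>"
proof (cases "devnorm r < \<infinity>")
  case True
  assume [measurable]: "r \<in> space P"
  have "integrable \<nu> (\<lambda>z. (dev r z)\<^sup>2)"
    by (rule integrableI_bounded) (use True in \<open>auto simp: devnorm_def\<close>)
  moreover have "U r = dev r" using True by (auto simp: U_def)
  ultimately show ?thesis unfolding L2_def by simp
next
  case False
  then have "U r = (\<lambda>z. 0)" by (auto simp: U_def)
  then show ?thesis using L2_zero by simp
qed

lemma U_norm: "ennreal (inner_L2 \<nu> (U r) (U r)) = (if devnorm r < \<infinity> then devnorm r else 0)"
  if [measurable]: "r \<in> space P"
proof (cases "devnorm r < \<infinity>")
  case True
  then have U: "U r = dev r" by (auto simp: U_def)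
  have "integrable \<nu> (\<lambda>z. dev r z * dev r z)" using L2_mult_integrable[OF U_L2 U_L2, OF that that] U by simp
  then have "ennreal (inner_L2 \<nu> (U r) (U r)) = (\<integral>\<^sup>+z. ennreal (dev r z * dev r z) \<partial>\<nu>)"
    unfolding U inner_L2_def by (intro nn_integral_eq_integral[symmetric]) auto
  then show ?thesis using True by (simp add: devnorm_def power2_eq_square)
next
  case False
  then have "U r = (\<lambda>z. 0)" by (auto simp: U_def)
  then show ?thesis using False by (simp add: inner_L2_def)
qed

lemma res_L2: "r \<in> space P \<Longrightarrow> resnorm r < \<infinity> \<Longrightarrow> res r \<in> L2 \<nu>"
  unfolding L2_def resnorm_def by (auto intro!: integrableI_bounded)

lemma gram_meas: "(\<lambda>z. inner_L2 \<nu> (U (fst z)) (U (snd z))) \<in> borel_measurable (P \<Otimes>\<^sub>M P)"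
proof -
  have 1: "(\<lambda>w. U (fst (fst w)) (snd w)) \<in> borel_measurable ((P \<Otimes>\<^sub>M P) \<Otimes>\<^sub>M \<nu>)"
    using measurable_compose[OF _ U_meas, of "\<lambda>w. (fst (fst w), snd w)" "(P \<Otimes>\<^sub>M P) \<Otimes>\<^sub>M \<nu>"] by simp
  have 2: "(\<lambda>w. U (snd (fst w)) (snd w)) \<in> borel_measurable ((P \<Otimes>\<^sub>M P) \<Otimes>\<^sub>M \<nu>)"
    using measurable_compose[OF _ U_meas, of "\<lambda>w. (snd (fst w), snd w)" "(P \<Otimes>\<^sub>M P) \<Otimes>\<^sub>M \<nu>"] by simp
  show ?thesis unfolding inner_L2_def
    by (rule N.borel_measurable_lebesgue_integral) (use borel_measurable_times[OF 1 2] in \<open>simp add: split_beta'\<close>)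
qed

lemma norm_meas [measurable]: "(\<lambda>r. inner_L2 \<nu> (U r) (U r)) \<in> borel_measurable P"
  using measurable_compose[OF measurable_Pair gram_meas, of "\<lambda>r. r" P "\<lambda>r. r"] by simp

lemma inner_meas: "g \<in> L2 \<nu> \<Longrightarrow> (\<lambda>r. inner_L2 \<nu> g (U r)) \<in> borel_measurable P"
proof -
  assume "g \<in> L2 \<nu>"
  then have [measurable]: "g \<in> borel_measurable \<nu>" by (rule L2_measurable)
  show ?thesis unfolding inner_L2_def
    by (rule N.borel_measurable_lebesgue_integral) (use U_meas in \<open>simp add: split_beta'\<close>)
qed

lemma moment: "integrable P (\<lambda>r. (inner_L2 \<nu> (U r) (U r) / b) ^ (3 * k))"
    "(\<integral>r. (inner_L2 \<nu> (U r) (U r) / b) ^ (3 * k) \<partial>P) \<le> 1"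
proof -
  let ?x = "\<lambda>r. inner_L2 \<nu> (U r) (U r)"
  have "(\<integral>\<^sup>+r. ennreal (?x r ^ (3 * k)) \<partial>P) \<le> (\<integral>\<^sup>+r. devnorm r ^ (3 * k) \<partial>P)"
  proof (rule nn_integral_mono)
    fix r assume "r \<in> space P"
    then show "ennreal (?x r ^ (3 * k)) \<le> devnorm r ^ (3 * k)"
      using U_norm[of r] by (simp add: inner_L2_self_nonneg flip: ennreal_power) (auto intro!: power_mono)
  qed
  also have "\<dots> \<le> ennreal (b ^ (3 * k))" by (rule nn_moments)
  finally have le: "(\<integral>\<^sup>+r. ennreal (?x r ^ (3 * k)) \<partial>P) \<le> ennreal (b ^ (3 * k))" .
  have i: "integrable P (\<lambda>r. ?x r ^ (3 * k))"
    by (rule integrableI_bounded) (use le in \<open>auto simp: inner_L2_self_nonneg abs_of_nonneg intro: le_less_trans\<close>)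
  then show "integrable P (\<lambda>r. (?x r / b) ^ (3 * k))" by (simp add: power_divide)
  have "ennreal (\<integral>r. ?x r ^ (3 * k) \<partial>P) = (\<integral>\<^sup>+r. ennreal (?x r ^ (3 * k)) \<partial>P)"
    by (rule nn_integral_eq_integral[OF i, symmetric]) (simp add: inner_L2_self_nonneg)
  then have "ennreal (\<integral>r. ?x r ^ (3 * k) \<partial>P) \<le> ennreal (b ^ (3 * k))" using le by (simp only:)
  then have "(\<integral>r. ?x r ^ (3 * k) \<partial>P) \<le> b ^ (3 * k)"
    by (rule ennreal_le_iff[THEN iffD1, rotated]) (use b_pos in simp)
  then show "(\<integral>r. (?x r / b) ^ (3 * k) \<partial>P) \<le> 1" using b_pos by (simp add: power_divide)
qed

lemma nn_first_moments: "(\<integral>\<^sup>+r. resnorm r \<partial>P) \<le> ennreal (2 * b)" "(\<integral>\<^sup>+r. devnorm r \<partial>P) \<le> ennreal (2 * b)"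
proof -
  have *: "(\<integral>\<^sup>+r. h r \<partial>P) \<le> ennreal (2 * b)" if [measurable]: "h \<in> borel_measurable P"
    and le: "(\<integral>\<^sup>+r. h r ^ (3 * k) \<partial>P) \<le> ennreal (b ^ (3 * k))" for h
  proof -
    \<comment> \<open>With this scaling the pointwise bound is x / b \<le> 1 + (x / b)^(3k),
      multiplied by \<open>b\<close>.\<close>
    define c where "c = b / b ^ (3 * k)"
    have c0: "0 < c" using b_pos by (simp add: c_def)
    have pt: "h r \<le> ennreal b + ennreal c * h r ^ (3 * k)" for r
    proof (cases "h r")
      case (real x)
      have "x / b \<le> 1 + (x / b) ^ (3 * k)"
        using power_le_one_add_power[of "x / b" 1 "3 * k"] real b_pos k_pos by simp
      then have "x \<le> b + c * x ^ (3 * k)"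
        using b_pos by (simp add: c_def power_divide field_simps)
      then have "ennreal x \<le> ennreal (b + c * x ^ (3 * k))" by (rule ennreal_leI)
      also have "\<dots> = ennreal b + ennreal c * ennreal x ^ (3 * k)"
        using real b_pos c0 by (simp add: ennreal_plus ennreal_mult ennreal_power)
      finally show ?thesis using real by simp
    next
      case top
      then show ?thesis using k_pos c0 by (simp add: top_power_ennreal ennreal_mult_top)
    qed
    have "(\<integral>\<^sup>+r. h r \<partial>P) \<le> (\<integral>\<^sup>+r. ennreal b + ennreal c * h r ^ (3 * k) \<partial>P)"
      by (intro nn_integral_mono pt)
    also have "\<dots> = ennreal b + ennreal c * (\<integral>\<^sup>+r. h r ^ (3 * k) \<partial>P)"
      by (simp add: nn_integral_add nn_integral_cmult P.emeasure_space_1)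
    also have "\<dots> \<le> ennreal b + ennreal c * ennreal (b ^ (3 * k))"
      by (intro add_left_mono mult_left_mono le) auto
    also have "\<dots> = ennreal (2 * b)"
      using b_pos c0 by (simp add: c_def ennreal_mult[symmetric] ennreal_plus[symmetric] del: ennreal_plus)
    finally show ?thesis .
  qed
  show "(\<integral>\<^sup>+r. resnorm r \<partial>P) \<le> ennreal (2 * b)" "(\<integral>\<^sup>+r. devnorm r \<partial>P) \<le> ennreal (2 * b)"
    by (intro * nn_moments; measurable)+
qed

text \<open>Almost every parameter has finite residual and deviation norms, so one such
  \<open>r\<close> exists, and \<open>a\<close> is the difference of its residual and its
  deviation.\<close>

lemma a_L2: "a \<in> L2 \<nu>"
proof -
  have "\<exists>r\<in>space P. resnorm r < \<infinity> \<and> devnorm r < \<infinity>"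
  proof (rule ccontr)
    assume n: "\<not> ?thesis"
    have "AE r in P. False" using AE_finite AE_space by eventually_elim (use n in blast)
    then show False by simp
  qed
  then obtain r where r: "r \<in> space P" "resnorm r < \<infinity>" "devnorm r < \<infinity>" by blast
  have "a = (\<lambda>z. res r z - U r z)" using r by (auto simp: a_def res_def U_def dev_def)
  then show ?thesis using L2_diff[OF res_L2 U_L2] r by simp
qed

text \<open>For every parameter, \<open>a\<close> is the residual minus the deviation, so its
  squared norm is at most twice the sum of theirs. Averaging over the parameter leaves
  \<open>a\<close> unchanged, and both mean squares are at most 2 b, whence 8 b.\<close>

lemma norm_a: "inner_L2 \<nu> a a \<le> 8 * b"
proof -
  have am [measurable]: "a \<in> borel_measurable \<nu>" using a_L2 by (rule L2_measurable)
  have "ennreal (inner_L2 \<nu> a a) = (\<integral>\<^sup>+z. ennreal (a z * a z) \<partial>\<nu>)"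
    unfolding inner_L2_def by (intro nn_integral_eq_integral[symmetric] L2_mult_integrable a_L2) auto
  also have "\<dots> = (\<integral>\<^sup>+r. (\<integral>\<^sup>+z. ennreal (a z * a z) \<partial>\<nu>) \<partial>P)"
    by (simp add: P.emeasure_space_1)
  also have "\<dots> \<le> (\<integral>\<^sup>+r. 2 * resnorm r + 2 * devnorm r \<partial>P)"
  proof (rule nn_integral_mono)
    fix r assume [measurable]: "r \<in> space P"
    have pt: "ennreal (a z * a z) \<le> 2 * ennreal ((res r z)\<^sup>2) + 2 * ennreal ((dev r z)\<^sup>2)" for z
    proof -
      have "a z * a z = (res r z - dev r z)\<^sup>2" by (simp add: a_def res_def dev_def power2_eq_square)
      also have "\<dots> \<le> 2 * (res r z)\<^sup>2 + 2 * (dev r z)\<^sup>2"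
        using zero_le_power2[of "res r z + dev r z"] unfolding power2_sum power2_diff by linarith
      finally have "a z * a z \<le> 2 * (res r z)\<^sup>2 + 2 * (dev r z)\<^sup>2" .
      then have "ennreal (a z * a z) \<le> ennreal (2 * (res r z)\<^sup>2 + 2 * (dev r z)\<^sup>2)" by (rule ennreal_leI)
      also have "\<dots> = 2 * ennreal ((res r z)\<^sup>2) + 2 * ennreal ((dev r z)\<^sup>2)"
        by (simp add: ennreal_plus ennreal_mult)
      finally show ?thesis .
    qed
    have "(\<integral>\<^sup>+z. ennreal (a z * a z) \<partial>\<nu>) \<le> (\<integral>\<^sup>+z. 2 * ennreal ((res r z)\<^sup>2) + 2 * ennreal ((dev r z)\<^sup>2) \<partial>\<nu>)"
      by (intro nn_integral_mono pt)
    also have "\<dots> = 2 * resnorm r + 2 * devnorm r"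
      unfolding resnorm_def devnorm_def by (simp add: nn_integral_add nn_integral_cmult)
    finally show "(\<integral>\<^sup>+z. ennreal (a z * a z) \<partial>\<nu>) \<le> 2 * resnorm r + 2 * devnorm r" .
  qed
  also have "\<dots> = 2 * (\<integral>\<^sup>+r. resnorm r \<partial>P) + 2 * (\<integral>\<^sup>+r. devnorm r \<partial>P)"
    by (simp add: nn_integral_add nn_integral_cmult)
  also have "\<dots> \<le> 2 * ennreal (2 * b) + 2 * ennreal (2 * b)"
    by (intro add_mono mult_left_mono nn_first_moments) auto
  also have "\<dots> = ennreal (8 * b)"
    using b_pos by (simp add: ennreal_plus[symmetric] ennreal_mult[symmetric] ennreal_numeral[symmetric] del: ennreal_plus ennreal_numeral)
  finally show ?thesis using b_pos by simp
qed

text \<open>True also without integrability in the parameter: then both \<open>\<theta> x\<close>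
  and the integral of the difference take the default value 0.\<close>

lemma integral_dev: "(\<integral>r. \<phi> d r x - \<theta> x \<partial>P) = 0"
proof (cases "integrable P (\<lambda>r. \<phi> d r x)")
  case True
  then show ?thesis using P.prob_space by (simp add: theta_def)
next
  case False
  then have "\<theta> x = 0" by (simp add: theta_def not_integrable_integral_eq)
  then show ?thesis using False by (simp add: not_integrable_integral_eq)
qed

text \<open>Fubini: at every test point the integral over the parameter vanishes. Integrability on
  the product follows from \<bar>g U\<bar> \<le> g^2 + U^2.\<close>

lemma centred:
  assumes g: "g \<in> L2 \<nu>" shows "(\<integral>r. inner_L2 \<nu> g (U r) \<partial>P) = 0"
proof -
  interpret PN: pair_prob_space P \<nu> ..
  have gm [measurable]: "g \<in> borel_measurable \<nu>" using g by (rule L2_measurable)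
  have Um: "(\<lambda>w. g (snd w) * U (fst w) (snd w)) \<in> borel_measurable (P \<Otimes>\<^sub>M \<nu>)" by measurable
  have "(\<integral>\<^sup>+w. ennreal (norm (g (snd w) * U (fst w) (snd w))) \<partial>(P \<Otimes>\<^sub>M \<nu>))
      = (\<integral>\<^sup>+r. \<integral>\<^sup>+z. ennreal (norm (g z * U r z)) \<partial>\<nu> \<partial>P)"
    by (subst N.nn_integral_fst[symmetric]) (use Um in auto)
  also have "\<dots> \<le> (\<integral>\<^sup>+r. ennreal (inner_L2 \<nu> g g) + devnorm r \<partial>P)"
  proof (rule nn_integral_mono)
    fix r assume r: "r \<in> space P"
    have Ur: "U r \<in> L2 \<nu>" by (rule U_L2[OF r])
    have [measurable]: "U r \<in> borel_measurable \<nu>" using Ur by (rule L2_measurable)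
    have pt: "ennreal (norm (g z * U r z)) \<le> ennreal (g z * g z) + ennreal (U r z * U r z)" for z
    proof -
      have "0 \<le> (\<bar>g z\<bar> - \<bar>U r z\<bar>)\<^sup>2" by simp
      then have "2 * (\<bar>g z\<bar> * \<bar>U r z\<bar>) \<le> (g z)\<^sup>2 + (U r z)\<^sup>2" by (simp add: power2_diff)
      then have "2 * (\<bar>g z\<bar> * \<bar>U r z\<bar>) \<le> g z * g z + U r z * U r z" unfolding power2_eq_square .
      then have "norm (g z * U r z) \<le> g z * g z + U r z * U r z"
        using mult_nonneg_nonneg[OF abs_ge_zero abs_ge_zero, of "g z" "U r z"]
        unfolding real_norm_def abs_mult by linarith
      then show ?thesis by (simp add: ennreal_leI flip: ennreal_plus)
    qed
    have "(\<integral>\<^sup>+z. ennreal (norm (g z * U r z)) \<partial>\<nu>) \<le> (\<integral>\<^sup>+z. ennreal (g z * g z) + ennreal (U r z * U r z) \<partial>\<nu>)"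
      by (intro nn_integral_mono pt)
    also have "\<dots> = (\<integral>\<^sup>+z. ennreal (g z * g z) \<partial>\<nu>) + (\<integral>\<^sup>+z. ennreal (U r z * U r z) \<partial>\<nu>)"
      by (rule nn_integral_add) measurable
    also have "\<dots> = ennreal (inner_L2 \<nu> g g) + ennreal (inner_L2 \<nu> (U r) (U r))"
      unfolding inner_L2_def
      by (intro arg_cong2[where f = "(+)"] nn_integral_eq_integral L2_mult_integrable g Ur) auto
    also have "\<dots> \<le> ennreal (inner_L2 \<nu> g g) + devnorm r"
      unfolding U_norm[OF r] by (intro add_left_mono) auto
    finally show "(\<integral>\<^sup>+z. ennreal (norm (g z * U r z)) \<partial>\<nu>) \<le> ennreal (inner_L2 \<nu> g g) + devnorm r" .
  qed
  also have "\<dots> = ennreal (inner_L2 \<nu> g g) + (\<integral>\<^sup>+r. devnorm r \<partial>P)"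
    by (simp add: nn_integral_add P.emeasure_space_1)
  also have "\<dots> < \<infinity>" using nn_first_moments(2) by (auto simp: less_top[symmetric] top_unique)
  finally have int: "integrable (P \<Otimes>\<^sub>M \<nu>) (\<lambda>w. g (snd w) * U (fst w) (snd w))"
    using Um by (intro integrableI_bounded) auto
  have "(\<integral>r. inner_L2 \<nu> g (U r) \<partial>P) = (\<integral>r. \<integral>z. g z * U r z \<partial>\<nu> \<partial>P)" unfolding inner_L2_def ..
  also have "\<dots> = (\<integral>z. \<integral>r. g z * U r z \<partial>P \<partial>\<nu>)"
    using PN.Fubini_integral[of "\<lambda>r z. g z * U r z"] int by (simp add: split_beta')
  also have "\<dots> = (\<integral>z. 0 \<partial>\<nu>)"
  proof (rule Bochner_Integration.integral_cong[OF refl])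
    fix z assume z: "z \<in> space \<nu>"
    have zx: "fst z \<in> space MX" using measurable_space[OF fst_nu z] .
    have "(\<integral>r. U r z \<partial>P) = (\<integral>r. \<phi> d r (fst z) - \<theta> (fst z) \<partial>P)"
    proof (rule integral_cong_AE)
      show "(\<lambda>r. U r z) \<in> borel_measurable P"
        using measurable_compose[OF measurable_Pair U_meas, of "\<lambda>r. r" P "\<lambda>_. z"] z by simp
      show "(\<lambda>r. \<phi> d r (fst z) - \<theta> (fst z)) \<in> borel_measurable P" using zx by measurable
      show "AE r in P. U r z = \<phi> d r (fst z) - \<theta> (fst z)"
        using AE_finite(2) by eventually_elim (simp add: U_def dev_def)
    qed
    also have "\<dots> = 0" by (rule integral_dev)
    finally show "(\<integral>r. g z * U r z \<partial>P) = 0" by simp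
  qed
  finally show ?thesis by simp
qed

abbreviation "s \<equiv> sigma_D \<nu> P \<phi> d"

lemma zeta_eq: "r \<in> space P \<Longrightarrow> devnorm r < \<infinity> \<Longrightarrow> zeta \<nu> P \<phi> d r = 2 * inner_L2 \<nu> a (U r)"
  unfolding zeta_def inner_L2_def a_def U_def dev_def by (simp add: split_beta')

text \<open>The variance is a plain second moment, because \<open>zeta\<close> agrees almost
  everywhere with a pairing with \<open>U\<close>, which is centred.\<close>

lemma s_sq: "s\<^sup>2 = (\<integral>r. (2 * inner_L2 \<nu> a (U r))\<^sup>2 \<partial>P)"
proof -
  have zm: "zeta \<nu> P \<phi> d \<in> borel_measurable P"
  proof -
    have "(\<lambda>w. a (snd w) * dev (fst w) (snd w)) \<in> borel_measurable (P \<Otimes>\<^sub>M \<nu>)"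
      using L2_measurable[OF a_L2] by measurable
    then have "(\<lambda>r. \<integral>z. a z * dev r z \<partial>\<nu>) \<in> borel_measurable P"
      by (intro N.borel_measurable_lebesgue_integral) (simp add: split_beta')
    then show ?thesis unfolding zeta_def inner_L2_def a_def dev_def by (simp add: split_beta')
  qed
  have im: "(\<lambda>r. inner_L2 \<nu> a (U r)) \<in> borel_measurable P" by (rule inner_meas[OF a_L2])
  have eq: "AE r in P. zeta \<nu> P \<phi> d r = 2 * inner_L2 \<nu> a (U r)"
    using AE_finite(2) AE_space by eventually_elim (rule zeta_eq)
  have "(\<integral>r. zeta \<nu> P \<phi> d r \<partial>P) = (\<integral>r. 2 * inner_L2 \<nu> a (U r) \<partial>P)"
    using eq zm im by (intro integral_cong_AE) auto
  also have "\<dots> = 0" using centred[OF a_L2] by simp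
  finally have z0: "(\<integral>r. zeta \<nu> P \<phi> d r \<partial>P) = 0" .
  have "s\<^sup>2 = (\<integral>r. (zeta \<nu> P \<phi> d r)\<^sup>2 \<partial>P)"
    unfolding sigma_D_def z0 by (simp add: integral_nonneg_AE)
  also have "\<dots> = (\<integral>r. (2 * inner_L2 \<nu> a (U r))\<^sup>2 \<partial>P)"
  proof (rule integral_cong_AE)
    show "AE r in P. (zeta \<nu> P \<phi> d r)\<^sup>2 = (2 * inner_L2 \<nu> a (U r))\<^sup>2"
      using eq by eventually_elim simp
  qed (use zm im in auto)
  finally show ?thesis .
qed

lemma s_pos: "0 < s"
proof -
  have "0 \<le> s" unfolding sigma_D_def by (simp add: integral_nonneg_AE)
  then show ?thesis using sigma_nz by simp
qed

sublocale E: L2_ensemble P \<nu> a U t k b s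
proof
  show "(\<lambda>r. inner_L2 \<nu> a (U r)) \<in> borel_measurable P" by (rule inner_meas[OF a_L2])
  show "(\<integral>r. inner_L2 \<nu> g (U r) \<partial>P) = 0" if "g \<in> L2 \<nu>" for g by (rule centred[OF that])
qed (fact a_L2 U_L2 t_pos k_pos gram_meas b_pos norm_a moment s_pos s_sq)+

end

text \<open>The quantile is below \<open>S\<close> iff some level below \<open>S\<close> already
  carries the fraction \<open>p\<close>. There are finitely many samples, so the largest one below
  \<open>S\<close> is such a level; this handles the strict inequality. Positivity of
  \<open>p\<close> bounds the set of levels from below, and \<open>p \<le> 1\<close> makes it
  nonempty.\<close>

lemma less_emp_quantile_iff:
  assumes "0 < p" "p \<le> 1" "0 < B"
  shows "S \<le> emp_quantile B G p \<longleftrightarrow> \<not> p * B \<le> card {b \<in> {..<B}. G b < S}"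
proof -
  let ?Q = "{s. emp_cdf B G s \<ge> p}"
  have Q: "s \<in> ?Q \<longleftrightarrow> p * B \<le> card {b \<in> {..<B}. G b \<le> s}" for s
    using assms(3) by (simp add: emp_cdf_def pos_le_divide_eq)
  have pB: "0 < p * B" using assms by simp
  have bdd: "bdd_below ?Q"
  proof (rule bdd_belowI)
    fix s assume "s \<in> ?Q"
    then have "card {b \<in> {..<B}. G b \<le> s} \<noteq> 0" using Q[of s] pB by linarith
    then have "{b \<in> {..<B}. G b \<le> s} \<noteq> {}" by (metis card.empty)
    then obtain b where b: "b < B" "G b \<le> s" by auto
    then have "Min (G ` {..<B}) \<le> G b" by (intro Min_le) auto
    with b show "Min (G ` {..<B}) \<le> s" by linarith
  qed
  have "emp_quantile B G p < S \<longleftrightarrow> p * B \<le> card {b \<in> {..<B}. G b < S}"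
  proof
    assume l: "emp_quantile B G p < S"
    have "{b \<in> {..<B}. G b \<le> Max (G ` {..<B})} = {..<B}" by auto
    then have "Max (G ` {..<B}) \<in> ?Q" unfolding Q using assms by simp
    then have ne: "?Q \<noteq> {}" by blast
    obtain s where s: "s \<in> ?Q" "s < S"
      using cInf_lessD[OF ne] l unfolding emp_quantile_def by blast
    have "card {b \<in> {..<B}. G b \<le> s} \<le> card {b \<in> {..<B}. G b < S}"
      using s by (intro card_mono) auto
    then show "p * B \<le> card {b \<in> {..<B}. G b < S}" using s Q[of s] by linarith
  next
    assume l: "p * B \<le> card {b \<in> {..<B}. G b < S}"
    let ?C = "{b \<in> {..<B}. G b < S}"
    have "card ?C \<noteq> 0" using l pB by linarith
    then have "?C \<noteq> {}" by (metis card.empty)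
    define m where "m = Max (G ` ?C)"
    have m: "m < S" unfolding m_def using \<open>?C \<noteq> {}\<close> by (subst Max_less_iff) auto
    have "G b \<le> m" if "b \<in> ?C" for b unfolding m_def using that by (intro Max_ge) auto
    then have "card ?C \<le> card {b \<in> {..<B}. G b \<le> m}" by (intro card_mono) auto
    then have "m \<in> ?Q" unfolding Q using l by linarith
    then have "emp_quantile B G p \<le> m" unfolding emp_quantile_def by (rule cInf_lower[OF _ bdd])
    with m show "emp_quantile B G p < S" by linarith
  qed
  then show ?thesis by linarith
qed

lemma pair_prob_le_sections:
  assumes "prob_space M" "prob_space N" and E: "E \<in> sets (M \<Otimes>\<^sub>M N)" and A: "A \<in> sets M" and e: "0 \<le> e"
    and le: "AE x in M. x \<notin> A \<longrightarrow> measure N (Pair x -` E) \<le> e"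
  shows "measure (M \<Otimes>\<^sub>M N) E \<le> measure M A + e"
proof -
  interpret M: prob_space M by fact
  interpret N: prob_space N by fact
  interpret pair_prob_space M N ..
  have "emeasure (M \<Otimes>\<^sub>M N) E = (\<integral>\<^sup>+x. emeasure N (Pair x -` E) \<partial>M)"
    by (rule N.emeasure_pair_measure_alt[OF E])
  also have "\<dots> \<le> (\<integral>\<^sup>+x. indicator A x + ennreal e \<partial>M)"
  proof (rule nn_integral_mono_AE)
    show "AE x in M. emeasure N (Pair x -` E) \<le> indicator A x + ennreal e"
      using le
    proof eventually_elim
      fix x assume *: "x \<notin> A \<longrightarrow> measure N (Pair x -` E) \<le> e"
      show "emeasure N (Pair x -` E) \<le> indicator A x + ennreal e"
      proof (cases "x \<in> A")
        case True
        have "emeasure N (Pair x -` E) \<le> 1 + 0" using N.measure_le_1 by simp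
        also have "\<dots> \<le> 1 + ennreal e" by (intro add_left_mono) simp
        finally show ?thesis using True by simp
      next
        case False
        then show ?thesis using * e by (simp add: N.emeasure_eq_measure ennreal_leI)
      qed
    qed
  qed
  also have "\<dots> = emeasure M A + ennreal e"
    using A by (subst nn_integral_add) (auto simp: M.emeasure_space_1)
  also have "\<dots> = ennreal (measure M A + e)"
    using e by (simp add: M.emeasure_eq_measure ennreal_plus)
  finally show ?thesis
    using e by (simp add: emeasure_eq_measure del: ennreal_plus)
qed

section \<open>Probability that the quantile falls short of the excess\<close>

context fixed_training
begin

abbreviation "Unif \<equiv> uniform_count_measure {..<t}"
abbreviation "Jt B \<equiv> PiM ({..<B::nat} \<times> {..<t}) (\<lambda>_. Unif)"

text \<open>Failure of coverage at level \<open>q\<close>, in the counting form of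
  \<open>less_emp_quantile_iff\<close>. The first component of \<open>z\<close> holds the
  parameters, the second the resampled indices.\<close>

definition miss :: "real \<Rightarrow> nat \<Rightarrow> (nat \<Rightarrow> 'r) \<times> (nat \<times> nat \<Rightarrow> nat) \<Rightarrow> bool" where
  "miss q B z \<longleftrightarrow> q * B \<le> card {b \<in> {..<B}.
     boot_sample \<nu> t (\<lambda>i. \<phi> d (fst z i)) (\<lambda>i. snd z (b, i)) < MSE \<nu> t (\<lambda>i. \<phi> d (fst z i)) - mse_inf \<nu> P \<phi> d}"

lemma prob_space_Jt: "prob_space (Jt B)"
  by (intro prob_space_PiM prob_space_uniform_lessThan t_pos)

lemma AE_good: "AE w in E.Pt. \<forall>i\<in>{..<t}. devnorm (w i) < \<infinity>"
proof (rule AE_finite_allI)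
  show "AE w in E.Pt. devnorm (w i) < \<infinity>" if "i \<in> {..<t}" for i
    by (rule AE_PiM_component[of "{..<t}" "\<lambda>_. P" i "\<lambda>r. devnorm r < \<infinity>"])
      (use that AE_finite P.prob_space_axioms in auto)
qed simp

context
  fixes w :: "nat \<Rightarrow> 'r"
  assumes w: "w \<in> space E.Pt" and fin: "\<And>i. i < t \<Longrightarrow> devnorm (w i) < \<infinity>"
begin

interpretation S: L2_sample \<nu> a t "\<lambda>i. U (w i)"
  by (rule E.L2_sample_comp[OF w])

text \<open>As all deviation norms are finite, \<open>U\<close> is the true deviation, and an
  average of members minus y is \<open>a\<close> plus an average of \<open>U\<close>. The map
  \<open>g\<close> is the identity or a resampling.\<close>

lemma psi_avg:
  assumes g: "\<And>i. i < t \<Longrightarrow> g i < t"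
  shows "psi \<nu> (ens_avg t (\<lambda>i. \<phi> d (w (g i))))
    = inner_L2 \<nu> (\<lambda>z. a z + 1 / t * (\<Sum>i<t. U (w (g i)) z)) (\<lambda>z. a z + 1 / t * (\<Sum>i<t. U (w (g i)) z))"
proof -
  have "ens_avg t (\<lambda>i. \<phi> d (w (g i))) (fst z) - snd z = a z + 1 / t * (\<Sum>i<t. U (w (g i)) z)" for z
  proof -
    have "(\<Sum>i<t. U (w (g i)) z) = (\<Sum>i<t. \<phi> d (w (g i)) (fst z) - \<theta> (fst z))"
      by (intro sum.cong refl) (use fin g in \<open>auto simp: U_def dev_def\<close>)
    also have "\<dots> = (\<Sum>i<t. \<phi> d (w (g i)) (fst z)) - t * \<theta> (fst z)" by (simp add: sum_subtractf)
    finally show ?thesis using t_pos by (simp add: ens_avg_def a_def field_simps)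
  qed
  then show ?thesis unfolding psi_eq_inner by simp
qed

lemma psi_avg_id:
  "psi \<nu> (ens_avg t (\<lambda>i. \<phi> d (w i)))
    = inner_L2 \<nu> (\<lambda>z. a z + 1 / t * (\<Sum>i<t. U (w i) z)) (\<lambda>z. a z + 1 / t * (\<Sum>i<t. U (w i) z))"
  by (rule psi_avg[of "\<lambda>i. i"])

lemma boot_eq:
  assumes "\<And>i. i < t \<Longrightarrow> J i < t"
  shows "boot_sample \<nu> t (\<lambda>i. \<phi> d (w i)) J = S.boot J"
proof -
  have "psi \<nu> (ens_avg t (\<lambda>i. \<phi> d (w (J i))))
    = inner_L2 \<nu> (\<lambda>z. a z + 1 / t * (\<Sum>i<t. U (w (J i)) z)) (\<lambda>z. a z + 1 / t * (\<Sum>i<t. U (w (J i)) z))"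
    by (rule psi_avg[of J]) (rule assms)
  then show ?thesis unfolding boot_sample_def S.boot_def S.ubar_def psi_avg_id by (rule arg_cong)
qed

lemma excess_eq: "MSE \<nu> t (\<lambda>i. \<phi> d (w i)) - mse_inf \<nu> P \<phi> d = S.excess"
proof -
  have "mse_inf \<nu> P \<phi> d = inner_L2 \<nu> a a"
    unfolding mse_inf_def psi_eq_inner a_def ..
  then show ?thesis
    unfolding MSE_def S.excess_eq S.ubar_def psi_avg_id by (rule arg_cong)
qed

text \<open>Off the exceptional set a single bootstrap sample falls below \<open>excess\<close> with
  probability under \<open>q - sqrt (ln B / B)\<close>, the margin that the binomial estimate
  needs.\<close>

lemma miss_section_le:
  assumes B: "2 \<le> B" and nbad: "w \<notin> E.bad (q - sqrt (ln B / B))" and eta: "E.\<eta> \<le> 1 / 100000"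
  shows "measure (Jt B) {J \<in> space (Jt B). miss q B (w, J)} \<le> sqrt (ln B / B)"
proof -
  let ?N = "PiM {..<t} (\<lambda>_. Unif)"
  define A where "A = {J \<in> space ?N. S.boot J < S.excess}"
  have sp: "space ?N = ({..<t} \<rightarrow>\<^sub>E {..<t})" by (simp only: space_PiM space_uniform_count_measure)
  have "A \<in> sets ?N"
    by (rule sets_PiM_finite_discrete[of _ _ "{..<t}"]) (auto simp: A_def sp sets_uniform_count_measure)
  moreover have "measure ?N A \<le> q - sqrt (ln B / B)"
    unfolding A_def using E.boot_prob_less[OF w nbad eta] by simp
  ultimately have "measure (Jt B)
      {J \<in> space (Jt B). q * B \<le> card {b \<in> {..<B}. (\<lambda>i\<in>{..<t}. J (b, i)) \<in> A}} \<le> sqrt (ln B / B)"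
    using t_pos B by (intro prob_many_successes_le prob_space_uniform_lessThan) (auto simp: lessThan_empty_iff)
  moreover have "{J \<in> space (Jt B). miss q B (w, J)}
     = {J \<in> space (Jt B). q * B \<le> card {b \<in> {..<B}. (\<lambda>i\<in>{..<t}. J (b, i)) \<in> A}}"
  proof (rule Collect_cong, rule conj_cong[OF refl])
    fix J assume J: "J \<in> space (Jt B)"
    have Jlt: "J (b, i) < t" if "b < B" "i < t" for b i
    proof -
      have "J \<in> ({..<B} \<times> {..<t}) \<rightarrow>\<^sub>E {..<t}" using J by (simp only: space_PiM space_uniform_count_measure)
      then have "J (b, i) \<in> {..<t}" by (rule PiE_mem) (use that in simp)
      then show ?thesis by simp
    qed
    have iff: "(boot_sample \<nu> t (\<lambda>i. \<phi> d (w i)) (\<lambda>i. J (b, i)) < MSE \<nu> t (\<lambda>i. \<phi> d (w i)) - mse_inf \<nu> P \<phi> d)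
      \<longleftrightarrow> (\<lambda>i\<in>{..<t}. J (b, i)) \<in> A" if b: "b < B" for b
    proof -
      have "S.boot (\<lambda>i\<in>{..<t}. J (b, i)) = S.boot (\<lambda>i. J (b, i))"
        unfolding S.boot_def by simp
      moreover have "(\<lambda>i\<in>{..<t}. J (b, i)) \<in> space ?N"
        unfolding sp using Jlt[OF b] by (intro restrict_PiE_iff[THEN iffD2]) auto
      ultimately show ?thesis
        unfolding A_def excess_eq using boot_eq[of "\<lambda>i. J (b, i)"] Jlt[OF b] by simp
    qed
    have "{b \<in> {..<B}. boot_sample \<nu> t (\<lambda>i. \<phi> d (w i)) (\<lambda>i. J (b, i)) < MSE \<nu> t (\<lambda>i. \<phi> d (w i)) - mse_inf \<nu> P \<phi> d}
      = {b \<in> {..<B}. (\<lambda>i\<in>{..<t}. J (b, i)) \<in> A}"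
      by (rule Collect_cong, rule conj_cong[OF refl], rule iff, simp)
    then show "miss q B (w, J) = (q * B \<le> card {b \<in> {..<B}. (\<lambda>i\<in>{..<t}. J (b, i)) \<in> A})"
      unfolding miss_def fst_conv snd_conv by simp
  qed
  ultimately show ?thesis by simp
qed

end

text \<open>If \<eta> exceeds 1/100000, then 10^10 \<eta> alone exceeds 1. Otherwise the level v = 1
  - \<alpha> - \<epsilon> with \<epsilon> = sqrt(ln B / B) costs \<epsilon> twice, once in the level
  and once in the binomial fluctuation, and 10^10 covers the factors 2, 6 and 2 * 10^9.\<close>

theorem miss_prob_le:
  assumes B: "2 \<le> B" and \<alpha>: "0 < \<alpha>" "\<alpha> < 1"
    and meas: "{z \<in> space (E.Pt \<Otimes>\<^sub>M Jt B). miss (1 - \<alpha>) B z} \<in> sets (E.Pt \<Otimes>\<^sub>M Jt B)"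
  shows "measure (E.Pt \<Otimes>\<^sub>M Jt B) {z \<in> space (E.Pt \<Otimes>\<^sub>M Jt B). miss (1 - \<alpha>) B z}
    \<le> \<alpha> + 10^10 * (E.\<eta> + exp (- (real k / 2)) + sqrt (ln B / B))"
proof (cases "E.\<eta> \<le> 1 / 100000")
  case False
  interpret J: prob_space "Jt B" by (rule prob_space_Jt)
  interpret PJ: pair_prob_space E.Pt "Jt B" ..
  have "PJ.prob {z \<in> space (E.Pt \<Otimes>\<^sub>M Jt B). miss (1 - \<alpha>) B z} \<le> 1" by (rule PJ.prob_le_1)
  also have "1 \<le> 10^10 * E.\<eta>" using False by simp
  finally have "PJ.prob {z \<in> space (E.Pt \<Otimes>\<^sub>M Jt B). miss (1 - \<alpha>) B z} \<le> 10^10 * E.\<eta>" .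
  moreover have "0 \<le> 10^10 * sqrt (ln B / B)" "0 \<le> 10^10 * exp (- (real k / 2))" using B by simp_all
  ultimately show ?thesis using \<alpha> unfolding distrib_left by linarith
next
  case True
  define \<epsilon> where "\<epsilon> = sqrt (ln B / B)"
  have e0: "0 \<le> \<epsilon>" using B by (simp add: \<epsilon>_def)
  let ?v = "1 - \<alpha> - \<epsilon>"
  have "measure (E.Pt \<Otimes>\<^sub>M Jt B) {z \<in> space (E.Pt \<Otimes>\<^sub>M Jt B). miss (1 - \<alpha>) B z} \<le> E.Pt.prob (E.bad ?v) + \<epsilon>"
  proof (rule pair_prob_le_sections[OF E.Pt.prob_space_axioms prob_space_Jt meas E.bad_meas e0])
    show "AE w in E.Pt. w \<notin> E.bad ?v \<longrightarrow>
        measure (Jt B) (Pair w -` {z \<in> space (E.Pt \<Otimes>\<^sub>M Jt B). miss (1 - \<alpha>) B z}) \<le> \<epsilon>"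
      using AE_good AE_space
    proof eventually_elim
      case (elim w)
      show ?case
      proof
        assume nbad: "w \<notin> E.bad ?v"
        have "Pair w -` {z \<in> space (E.Pt \<Otimes>\<^sub>M Jt B). miss (1 - \<alpha>) B z} = {J \<in> space (Jt B). miss (1 - \<alpha>) B (w, J)}"
          unfolding space_pair_measure using elim(2) by blast
        also have "measure (Jt B) \<dots> \<le> \<epsilon>"
          unfolding \<epsilon>_def by (rule miss_section_le) (use elim nbad B True in \<open>auto simp: \<epsilon>_def\<close>)
        finally show "measure (Jt B) (Pair w -` {z \<in> space (E.Pt \<Otimes>\<^sub>M Jt B). miss (1 - \<alpha>) B z}) \<le> \<epsilon>" .
      qed
    qed
  qed
  also have "E.Pt.prob (E.bad ?v) \<le> 1 - ?v + 6 * exp (- real k) + 2 * 10^9 * E.\<eta>"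
    by (rule E.prob_bad_le) (use \<alpha> e0 in simp)
  finally have "measure (E.Pt \<Otimes>\<^sub>M Jt B) {z \<in> space (E.Pt \<Otimes>\<^sub>M Jt B). miss (1 - \<alpha>) B z}
     \<le> \<alpha> + 2 * \<epsilon> + 6 * exp (- real k) + 2 * 10^9 * E.\<eta>" by linarith
  also have "\<dots> \<le> \<alpha> + 10^10 * \<epsilon> + 10^10 * exp (- (real k / 2)) + 10^10 * E.\<eta>"
  proof -
    have "6 * exp (- real k) \<le> 10^10 * exp (- (real k / 2))" by (intro mult_mono) auto
    moreover have "2 * \<epsilon> \<le> 10^10 * \<epsilon>" using e0 by simp
    moreover have "2 * 10^9 * E.\<eta> \<le> 10^10 * E.\<eta>" using E.eta_pos by simp
    ultimately show ?thesis by linarith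
  qed
  finally show ?thesis unfolding \<epsilon>_def by (simp add: distrib_left)
qed

end

section \<open>Conditioning on the training set\<close>

lemma (in prob_space) distr_Pair_indep_rv:
  assumes "indep_rv M S X S' Y"
  shows "distr M (S \<Otimes>\<^sub>M S') (\<lambda>\<omega>. (X \<omega>, Y \<omega>)) = distr M S X \<Otimes>\<^sub>M distr M S' Y"
proof -
  have [measurable]: "X \<in> measurable M S" "Y \<in> measurable M S'" using assms by (auto simp: indep_rv_def)
  interpret X: prob_space "distr M S X" by (rule prob_space_distr) measurable
  interpret Y: prob_space "distr M S' Y" by (rule prob_space_distr) measurable
  show ?thesis
  proof (rule pair_measure_eqI[symmetric])
    show "sigma_finite_measure (distr M S X)" "sigma_finite_measure (distr M S' Y)" by unfold_locales
    show "sets (distr M S X \<Otimes>\<^sub>M distr M S' Y) = sets (distr M (S \<Otimes>\<^sub>M S') (\<lambda>\<omega>. (X \<omega>, Y \<omega>)))"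
      by (simp cong: sets_pair_measure_cong)
    fix A B assume "A \<in> sets (distr M S X)" "B \<in> sets (distr M S' Y)"
    then have [measurable]: "A \<in> sets S" "B \<in> sets S'" by auto
    have "prob ((X -` A \<inter> space M) \<inter> (Y -` B \<inter> space M)) = prob (X -` A \<inter> space M) * prob (Y -` B \<inter> space M)"
      by (rule indep_setD[of "{X -` A \<inter> space M |A. A \<in> sets S}" "{Y -` A \<inter> space M |A. A \<in> sets S'}"])
        (use assms in \<open>auto simp: indep_rv_def\<close>)
    moreover have "(\<lambda>\<omega>. (X \<omega>, Y \<omega>)) -` (A \<times> B) \<inter> space M = (X -` A \<inter> space M) \<inter> (Y -` B \<inter> space M)" by auto
    ultimately show "emeasure (distr M S X) A * emeasure (distr M S' Y) B
        = emeasure (distr M (S \<Otimes>\<^sub>M S') (\<lambda>\<omega>. (X \<omega>, Y \<omega>))) (A \<times> B)"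
      by (simp add: emeasure_distr emeasure_eq_measure ennreal_mult)
  qed
qed

text \<open>Since the joint law is a product, freezing \<open>D\<close> gives a version of the
  conditional probability. On a set \<open>C\<close> pulled back from \<open>C'\<close> the
  characterising identity is Fubini.\<close>

lemma (in prob_space) real_cond_exp_indep:
  assumes D [measurable]: "D \<in> measurable M S" and Y [measurable]: "Y \<in> measurable M N"
    and law: "distr M (S \<Otimes>\<^sub>M N) (\<lambda>\<omega>. (D \<omega>, Y \<omega>)) = distr M S D \<Otimes>\<^sub>M L" and L: "prob_space L" "sets L = sets N"
    and E [measurable]: "E \<in> sets (S \<Otimes>\<^sub>M N)"
  shows "AE \<omega> in M. real_cond_exp M (vimage_algebra (space M) D S)
      (indicator {\<omega> \<in> space M. (D \<omega>, Y \<omega>) \<in> E}) \<omega> = measure L (Pair (D \<omega>) -` E)"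
proof -
  let ?F = "vimage_algebra (space M) D S" and ?A = "{\<omega> \<in> space M. (D \<omega>, Y \<omega>) \<in> E}"
  note [measurable_cong] = L(2)
  interpret L: prob_space L by fact
  interpret DS: prob_space "distr M S D" by (rule prob_space_distr) measurable
  interpret DL: pair_prob_space "distr M S D" L ..
  have "subalgebra M ?F"
    unfolding subalgebra_def using measurable_space[OF D] D
    by (auto simp: sets_vimage_algebra2 measurable_sets)
  then interpret finite_measure_subalgebra M ?F by unfold_locales
  define h where "h d = measure L (Pair d -` E)" for d
  have hS [measurable]: "h \<in> borel_measurable S"
    unfolding h_def measure_def using L.measurable_emeasure_Pair[of E S] E
    by (simp cong: sets_pair_measure_cong)
  have A [measurable]: "?A \<in> sets M" by measurable
  have DF: "D \<in> measurable ?F S" using measurable_space[OF D] by (intro measurable_vimage_algebra1) auto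
  have h1: "\<bar>h d\<bar> \<le> 1" for d unfolding h_def by simp
  show ?thesis
    unfolding h_def[symmetric]
  proof (rule real_cond_exp_charact)
    show "integrable M (indicator ?A :: _ \<Rightarrow> real)" using A by (simp add: emeasure_eq_measure)
    show "integrable M (\<lambda>\<omega>. h (D \<omega>))" by (rule integrable_const_bound[of _ 1]) (use h1 in auto)
    show "(\<lambda>\<omega>. h (D \<omega>)) \<in> borel_measurable ?F" by (rule measurable_compose[OF DF hS])
    fix C assume "C \<in> sets ?F"
    then obtain C' where C' [measurable]: "C' \<in> sets S" and C: "C = D -` C' \<inter> space M"
      using measurable_space[OF D] by (auto simp: sets_vimage_algebra2)
    define f where "f p = indicator C' (fst p) * (indicator E p :: real)" for p
    have fm [measurable]: "f \<in> borel_measurable (S \<Otimes>\<^sub>M N)" unfolding f_def by measurable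
    have fi: "integrable (distr M S D \<Otimes>\<^sub>M L) f"
    proof (rule DL.integrable_const_bound[of _ 1])
      show "AE p in distr M S D \<Otimes>\<^sub>M L. norm (f p) \<le> 1" by (simp add: f_def indicator_def)
      show "f \<in> borel_measurable (distr M S D \<Otimes>\<^sub>M L)" using fm by measurable
    qed
    have "(LINT \<omega>:C|M. indicator ?A \<omega>) = (\<integral>\<omega>. f (D \<omega>, Y \<omega>) \<partial>M)"
      unfolding set_lebesgue_integral_def f_def C
      by (intro Bochner_Integration.integral_cong refl) (simp add: indicator_def)
    also have "\<dots> = (\<integral>p. f p \<partial>distr M (S \<Otimes>\<^sub>M N) (\<lambda>\<omega>. (D \<omega>, Y \<omega>)))"
      by (rule integral_distr[symmetric]) measurable
    also have "\<dots> = (\<integral>d. \<integral>y. f (d, y) \<partial>L \<partial>distr M S D)"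
      unfolding law by (rule DL.integral_fst'[OF fi, symmetric])
    also have "\<dots> = (\<integral>d. indicator C' d * h d \<partial>distr M S D)"
    proof (rule Bochner_Integration.integral_cong[OF refl])
      fix d assume "d \<in> space (distr M S D)"
      have E': "Pair d -` E \<in> sets L" using sets_Pair1[OF E, of d] L(2) by simp
      have "(\<integral>y. f (d, y) \<partial>L) = (\<integral>y. indicator C' d * indicator (Pair d -` E) y \<partial>L)"
        by (rule Bochner_Integration.integral_cong[OF refl]) (simp add: f_def indicator_def)
      also have "\<dots> = indicator C' d * h d" unfolding h_def using E' by simp
      finally show "(\<integral>y. f (d, y) \<partial>L) = indicator C' d * h d" .
    qed
    also have "\<dots> = (\<integral>\<omega>. indicator C' (D \<omega>) * h (D \<omega>) \<partial>M)"
      by (rule integral_distr) measurable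
    also have "\<dots> = (LINT \<omega>:C|M. h (D \<omega>))"
      unfolding set_lebesgue_integral_def C
      by (intro Bochner_Integration.integral_cong refl) (simp add: indicator_def)
    finally show "(LINT \<omega>:C|M. indicator ?A \<omega>) = (LINT \<omega>:C|M. h (D \<omega>))" .
  qed
qed

section \<open>Joint law and coverage event\<close>

context bootstrapped_ensemble
begin

abbreviation "TS \<equiv> train_space MX n"
abbreviation "SR \<equiv> PiM {..<t} (\<lambda>_. R)"
abbreviation "SJ \<equiv> PiM ({..<B} \<times> {..<t}) (\<lambda>_. count_space {..<t})"
abbreviation "Unif \<equiv> uniform_count_measure {..<t}"
abbreviation "Law \<equiv> PiM {..<t} (\<lambda>_. P) \<Otimes>\<^sub>M PiM ({..<B} \<times> {..<t}) (\<lambda>_. Unif)"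

definition Xi :: "'w \<Rightarrow> nat \<Rightarrow> 'r" where "Xi \<omega> = (\<lambda>i\<in>{..<t}. \<xi> i \<omega>)"
definition Idx :: "'w \<Rightarrow> nat \<times> nat \<Rightarrow> nat" where "Idx \<omega> = (\<lambda>(b, i)\<in>{..<B} \<times> {..<t}. J b i \<omega>)"

context
  assumes t1: "1 \<le> t" and B1: "1 \<le> B"
begin

lemma P_facts: "prob_space P" "sets P = sets R"
proof -
  have 0: "0 < t" using t1 by simp
  have "\<xi> 0 \<in> measurable M R" using xi_indep 0 unfolding indep_vars_def by auto
  then show "prob_space P" unfolding xi_law[OF 0, symmetric] by (rule prob_space_distr)
  show "sets P = sets R" unfolding xi_law[OF 0, symmetric] by simp
qed

lemma rv: "D \<in> measurable M TS" "Xi \<in> measurable M SR" "Idx \<in> measurable M SJ"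
  using D_xi_indep J_D_xi_indep unfolding indep_rv_def Xi_def[abs_def] Idx_def[abs_def] by auto

lemma distr_Xi: "distr M SR Xi = PiM {..<t} (\<lambda>_. P)"
proof -
  have ne: "{..<t} \<noteq> {}" using t1 by (auto simp: lessThan_empty_iff)
  have "distr M SR (\<lambda>\<omega>. \<lambda>i\<in>{..<t}. \<xi> i \<omega>) = PiM {..<t} (\<lambda>i. distr M R (\<xi> i))"
    by (rule indep_vars_iff_distr_eq_PiM'[THEN iffD1, OF ne _ xi_indep])
      (use xi_indep in \<open>auto simp: indep_vars_def\<close>)
  also have "\<dots> = PiM {..<t} (\<lambda>_. P)" by (rule PiM_cong) (auto simp: xi_law)
  finally show ?thesis unfolding Xi_def[abs_def] .
qed

lemma distr_Idx: "distr M SJ Idx = PiM ({..<B} \<times> {..<t}) (\<lambda>_. Unif)"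
proof -
  have ne: "{..<B} \<times> {..<t} \<noteq> {}" using t1 B1 by (auto simp: lessThan_empty_iff)
  have "distr M SJ (\<lambda>\<omega>. \<lambda>p\<in>{..<B} \<times> {..<t}. (case p of (b, i) \<Rightarrow> J b i) \<omega>)
      = PiM ({..<B} \<times> {..<t}) (\<lambda>p. distr M (count_space {..<t}) (case p of (b, i) \<Rightarrow> J b i))"
    by (rule indep_vars_iff_distr_eq_PiM'[THEN iffD1, OF ne _ J_indep])
      (use J_indep in \<open>auto simp: indep_vars_def\<close>)
  also have "\<dots> = PiM ({..<B} \<times> {..<t}) (\<lambda>_. Unif)" by (rule PiM_cong) (auto simp: J_uniform)
  also have "(\<lambda>\<omega>. \<lambda>p\<in>{..<B} \<times> {..<t}. (case p of (b, i) \<Rightarrow> J b i) \<omega>) = Idx"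
    unfolding Idx_def[abs_def] by (intro ext) (auto simp: restrict_def)
  finally show ?thesis .
qed

text \<open>The two independence assumptions give a product law for the pair of
  \<open>(D \<omega>, Xi \<omega>)\<close> and \<open>Idx \<omega>\<close>. Comparing masses of
  rectangles then moves the brackets, so that \<open>D\<close> stands alone in the first
  component.\<close>

lemma joint_law: "distr M (TS \<Otimes>\<^sub>M (SR \<Otimes>\<^sub>M SJ)) (\<lambda>\<omega>. (D \<omega>, (Xi \<omega>, Idx \<omega>))) = distr M TS D \<Otimes>\<^sub>M Law"
proof -
  note [measurable] = rv
  interpret P: prob_space P by (rule P_facts)
  interpret D: prob_space "distr M TS D" by (rule prob_space_distr) measurable
  interpret X: prob_space "PiM {..<t} (\<lambda>_. P)" by (intro prob_space_PiM P.prob_space_axioms)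
  interpret J: prob_space "PiM ({..<B} \<times> {..<t}) (\<lambda>_. Unif)"
    using t1 by (intro prob_space_PiM prob_space_uniform_lessThan) simp
  interpret XJ: pair_prob_space "PiM {..<t} (\<lambda>_. P)" "PiM ({..<B} \<times> {..<t}) (\<lambda>_. Unif)" ..
  have 1: "distr M (TS \<Otimes>\<^sub>M SR) (\<lambda>\<omega>. (D \<omega>, Xi \<omega>)) = distr M TS D \<Otimes>\<^sub>M PiM {..<t} (\<lambda>_. P)"
    using distr_Pair_indep_rv[OF D_xi_indep] distr_Xi unfolding Xi_def[abs_def] by simp
  have 2: "distr M ((TS \<Otimes>\<^sub>M SR) \<Otimes>\<^sub>M SJ) (\<lambda>\<omega>. ((D \<omega>, Xi \<omega>), Idx \<omega>))
      = (distr M TS D \<Otimes>\<^sub>M PiM {..<t} (\<lambda>_. P)) \<Otimes>\<^sub>M PiM ({..<B} \<times> {..<t}) (\<lambda>_. Unif)"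
    using distr_Pair_indep_rv[OF J_D_xi_indep] distr_Idx 1 unfolding Xi_def[abs_def] Idx_def[abs_def] by simp
  have sets_eq: "sets (PiM {..<t} (\<lambda>_. P)) = sets SR" "sets (PiM ({..<B} \<times> {..<t}) (\<lambda>_. Unif)) = sets SJ"
    by (auto intro!: sets_PiM_cong simp: P_facts sets_uniform_count_measure)
  show ?thesis
  proof (rule pair_measure_eqI[symmetric])
    show "sigma_finite_measure (distr M TS D)" "sigma_finite_measure Law" by unfold_locales
    show "sets (distr M TS D \<Otimes>\<^sub>M Law) = sets (distr M (TS \<Otimes>\<^sub>M (SR \<Otimes>\<^sub>M SJ)) (\<lambda>\<omega>. (D \<omega>, (Xi \<omega>, Idx \<omega>))))"
      by (simp add: sets_eq cong: sets_pair_measure_cong)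
    fix A C assume "A \<in> sets (distr M TS D)" and C: "C \<in> sets Law"
    then have A [measurable]: "A \<in> sets TS" by simp
    have C' [measurable]: "C \<in> sets (SR \<Otimes>\<^sub>M SJ)" using C sets_pair_measure_cong[OF sets_eq] by simp
    define g where "g p = indicator A (fst (fst p)) * (indicator C (snd (fst p), snd p) :: ennreal)" for p
    have gm [measurable]: "g \<in> borel_measurable ((TS \<Otimes>\<^sub>M SR) \<Otimes>\<^sub>M SJ)" unfolding g_def by measurable
    have gm': "g \<in> borel_measurable ((distr M TS D \<Otimes>\<^sub>M PiM {..<t} (\<lambda>_. P)) \<Otimes>\<^sub>M PiM ({..<B} \<times> {..<t}) (\<lambda>_. Unif))"
      using gm sets_eq by (simp cong: measurable_cong_sets sets_pair_measure_cong)
    interpret DX: pair_prob_space "distr M TS D" "PiM {..<t} (\<lambda>_. P)" ..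
    have "emeasure (distr M (TS \<Otimes>\<^sub>M (SR \<Otimes>\<^sub>M SJ)) (\<lambda>\<omega>. (D \<omega>, (Xi \<omega>, Idx \<omega>)))) (A \<times> C)
       = emeasure M ((\<lambda>\<omega>. (D \<omega>, (Xi \<omega>, Idx \<omega>))) -` (A \<times> C) \<inter> space M)"
      by (rule emeasure_distr) measurable
    also have "\<dots> = (\<integral>\<^sup>+\<omega>. g ((D \<omega>, Xi \<omega>), Idx \<omega>) \<partial>M)"
    proof -
      have "(\<lambda>\<omega>. (D \<omega>, (Xi \<omega>, Idx \<omega>))) -` (A \<times> C) \<inter> space M \<in> sets M"
        by (rule measurable_sets[where A = "TS \<Otimes>\<^sub>M (SR \<Otimes>\<^sub>M SJ)"]) measurable
      then have "emeasure M ((\<lambda>\<omega>. (D \<omega>, (Xi \<omega>, Idx \<omega>))) -` (A \<times> C) \<inter> space M)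
         = (\<integral>\<^sup>+\<omega>. indicator ((\<lambda>\<omega>. (D \<omega>, (Xi \<omega>, Idx \<omega>))) -` (A \<times> C) \<inter> space M) \<omega> \<partial>M)" by simp
      also have "\<dots> = (\<integral>\<^sup>+\<omega>. g ((D \<omega>, Xi \<omega>), Idx \<omega>) \<partial>M)"
        by (rule nn_integral_cong) (simp add: g_def indicator_def)
      finally show ?thesis .
    qed
    also have "\<dots> = (\<integral>\<^sup>+p. g p \<partial>distr M ((TS \<Otimes>\<^sub>M SR) \<Otimes>\<^sub>M SJ) (\<lambda>\<omega>. ((D \<omega>, Xi \<omega>), Idx \<omega>)))"
      by (rule nn_integral_distr[symmetric]) measurable
    also have "\<dots> = (\<integral>\<^sup>+q. \<integral>\<^sup>+j. g (q, j) \<partial>PiM ({..<B} \<times> {..<t}) (\<lambda>_. Unif) \<partial>(distr M TS D \<Otimes>\<^sub>M PiM {..<t} (\<lambda>_. P)))"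
      unfolding 2 by (rule J.nn_integral_fst[OF gm', symmetric])
    also have "\<dots> = (\<integral>\<^sup>+d. \<integral>\<^sup>+x. \<integral>\<^sup>+j. g ((d, x), j) \<partial>PiM ({..<B} \<times> {..<t}) (\<lambda>_. Unif) \<partial>PiM {..<t} (\<lambda>_. P) \<partial>distr M TS D)"
      by (rule X.nn_integral_fst[symmetric]) (rule J.borel_measurable_nn_integral_fst[OF gm'])
    also have "\<dots> = (\<integral>\<^sup>+d. indicator A d * emeasure Law C \<partial>distr M TS D)"
    proof (rule nn_integral_cong)
      fix d
      have Cm: "(\<lambda>p. indicator C p :: ennreal) \<in> borel_measurable Law" using C by simp
      have "(\<integral>\<^sup>+x. \<integral>\<^sup>+j. indicator C (x, j) \<partial>PiM ({..<B} \<times> {..<t}) (\<lambda>_. Unif) \<partial>PiM {..<t} (\<lambda>_. P)) = emeasure Law C"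
        using J.nn_integral_fst[OF Cm] C by simp
      moreover have "(\<integral>\<^sup>+x. \<integral>\<^sup>+j. g ((d, x), j) \<partial>PiM ({..<B} \<times> {..<t}) (\<lambda>_. Unif) \<partial>PiM {..<t} (\<lambda>_. P))
        = indicator A d * (\<integral>\<^sup>+x. \<integral>\<^sup>+j. indicator C (x, j) \<partial>PiM ({..<B} \<times> {..<t}) (\<lambda>_. Unif) \<partial>PiM {..<t} (\<lambda>_. P))"
        by (cases "d \<in> A") (simp_all add: g_def)
      ultimately show "(\<integral>\<^sup>+x. \<integral>\<^sup>+j. g ((d, x), j) \<partial>PiM ({..<B} \<times> {..<t}) (\<lambda>_. Unif) \<partial>PiM {..<t} (\<lambda>_. P))
        = indicator A d * emeasure Law C" by simp
    qed
    also have "\<dots> = emeasure (distr M TS D) A * emeasure Law C"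
      by (subst nn_integral_multc) auto
    finally show "emeasure (distr M TS D) A * emeasure Law C
      = emeasure (distr M (TS \<Otimes>\<^sub>M (SR \<Otimes>\<^sub>M SJ)) (\<lambda>\<omega>. (D \<omega>, (Xi \<omega>, Idx \<omega>)))) (A \<times> C)" by simp
  qed
qed

lemma fst_nu: "fst \<in> measurable \<nu> MX" and snd_nu: "snd \<in> borel_measurable \<nu>"
  using measurable_cong_sets[OF sets_nu refl] by auto

lemma phi_comp:
  assumes "f \<in> measurable L TS" "g \<in> measurable L R" "x \<in> measurable L MX"
  shows "(\<lambda>p. \<phi> (f p) (g p) (x p)) \<in> borel_measurable L"
  using measurable_compose[OF measurable_Pair[OF assms(1) measurable_Pair[OF assms(2,3)]] phi_measurable] by simp

lemma psi_avg_meas: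
  assumes f: "f \<in> measurable L TS" and g: "\<And>i. i < t \<Longrightarrow> g i \<in> measurable L R"
  shows "(\<lambda>p. psi \<nu> (ens_avg t (\<lambda>i. \<phi> (f p) (g i p)))) \<in> borel_measurable L"
proof -
  interpret N: prob_space \<nu> by (rule prob_nu)
  have "(\<lambda>q. \<phi> (f (fst q)) (g i (fst q)) (fst (snd q))) \<in> borel_measurable (L \<Otimes>\<^sub>M \<nu>)" if "i < t" for i
    by (intro phi_comp measurable_compose[OF measurable_fst] measurable_compose[OF measurable_snd] f g that fst_nu)
  then have "(\<lambda>q. (\<Sum>i<t. \<phi> (f (fst q)) (g i (fst q)) (fst (snd q)))) \<in> borel_measurable (L \<Otimes>\<^sub>M \<nu>)"
    by (intro borel_measurable_sum) auto
  moreover have "(\<lambda>q. snd (snd q)) \<in> borel_measurable (L \<Otimes>\<^sub>M \<nu>)"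
    by (rule measurable_compose[OF measurable_snd snd_nu])
  ultimately have "(\<lambda>q. (snd (snd q) - (\<Sum>i<t. \<phi> (f (fst q)) (g i (fst q)) (fst (snd q))) / t)\<^sup>2) \<in> borel_measurable (L \<Otimes>\<^sub>M \<nu>)"
    by simp
  then show ?thesis unfolding psi_def ens_avg_def
    by (intro N.borel_measurable_lebesgue_integral) (simp add: split_beta')
qed

lemma mse_inf_meas: "(\<lambda>d. mse_inf \<nu> P \<phi> d) \<in> borel_measurable TS"
proof -
  interpret N: prob_space \<nu> by (rule prob_nu)
  interpret P: prob_space P by (rule P_facts)
  have "(\<lambda>w. \<phi> (fst (fst w)) (snd w) (fst (snd (fst w)))) \<in> borel_measurable ((TS \<Otimes>\<^sub>M \<nu>) \<Otimes>\<^sub>M P)"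
  proof (rule phi_comp)
    show "(\<lambda>w. fst (fst w)) \<in> measurable ((TS \<Otimes>\<^sub>M \<nu>) \<Otimes>\<^sub>M P) TS" by measurable
    show "snd \<in> measurable ((TS \<Otimes>\<^sub>M \<nu>) \<Otimes>\<^sub>M P) R"
      using measurable_snd[of "TS \<Otimes>\<^sub>M \<nu>" P] measurable_cong_sets[OF refl P_facts(2)] by blast
    show "(\<lambda>w. fst (snd (fst w))) \<in> measurable ((TS \<Otimes>\<^sub>M \<nu>) \<Otimes>\<^sub>M P) MX"
      by (intro measurable_compose[OF measurable_fst] measurable_compose[OF measurable_snd] fst_nu)
  qed
  then have "(\<lambda>q. \<integral>r. \<phi> (fst q) r (fst (snd q)) \<partial>P) \<in> borel_measurable (TS \<Otimes>\<^sub>M \<nu>)"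
    by (intro P.borel_measurable_lebesgue_integral) (simp add: split_beta')
  moreover have "(\<lambda>q. snd (snd q)) \<in> borel_measurable (TS \<Otimes>\<^sub>M \<nu>)"
    by (rule measurable_compose[OF measurable_snd snd_nu])
  ultimately have "(\<lambda>q. (snd (snd q) - (\<integral>r. \<phi> (fst q) r (fst (snd q)) \<partial>P))\<^sup>2) \<in> borel_measurable (TS \<Otimes>\<^sub>M \<nu>)"
    by simp
  then show ?thesis unfolding mse_inf_def psi_def theta_def
    by (intro N.borel_measurable_lebesgue_integral) (simp add: split_beta')
qed

definition excess :: "(nat \<Rightarrow> 'x \<times> real) \<times> (nat \<Rightarrow> 'r) \<times> (nat \<times> nat \<Rightarrow> nat) \<Rightarrow> real" where
  "excess x = MSE \<nu> t (\<lambda>i. \<phi> (fst x) (fst (snd x) i)) - mse_inf \<nu> P \<phi> (fst x)"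

definition boots :: "nat \<Rightarrow> (nat \<Rightarrow> 'x \<times> real) \<times> (nat \<Rightarrow> 'r) \<times> (nat \<times> nat \<Rightarrow> nat) \<Rightarrow> real" where
  "boots b x = boot_sample \<nu> t (\<lambda>i. \<phi> (fst x) (fst (snd x) i)) (\<lambda>i. snd (snd x) (b, i))"

text \<open>Coverage is expressed by counting instead of the infimum in \<open>emp_quantile\<close>,
  so its measurability reduces to that of finitely many comparisons.\<close>

definition covered :: "real \<Rightarrow> ((nat \<Rightarrow> 'x \<times> real) \<times> (nat \<Rightarrow> 'r) \<times> (nat \<times> nat \<Rightarrow> nat)) set" where
  "covered q = {x \<in> space (TS \<Otimes>\<^sub>M (SR \<Otimes>\<^sub>M SJ)). \<not> q * B \<le> card {b \<in> {..<B}. boots b x < excess x}}"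

abbreviation "Tot \<equiv> TS \<Otimes>\<^sub>M (SR \<Otimes>\<^sub>M SJ)"

lemma coord_meas: "i < t \<Longrightarrow> (\<lambda>x. fst (snd x) i) \<in> measurable Tot R"
  by (intro measurable_compose[OF measurable_snd] measurable_compose[OF measurable_fst]
      measurable_component_singleton[of i "{..<t}" "\<lambda>_. R"]) simp

lemma excess_meas: "excess \<in> borel_measurable Tot"
  unfolding excess_def[abs_def] MSE_def
  by (intro borel_measurable_diff psi_avg_meas measurable_fst coord_meas measurable_compose[OF measurable_fst mse_inf_meas])

lemma boots_meas:
  assumes b: "b < B" shows "boots b \<in> borel_measurable Tot"
proof -
  have "(\<lambda>x. fst (snd x) (snd (snd x) (b, i))) \<in> measurable Tot R" if i: "i < t" for i
  \<comment> \<open>A coordinate selected by a random index is measurable because the index takes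
    finitely many values.\<close>
  proof (rule measurable_compose_countable'[where I = "{..<t}" and f = "\<lambda>j x. fst (snd x) j" and g = "\<lambda>x. snd (snd x) (b, i)"])
    show "(\<lambda>x. snd (snd x) (b, i)) \<in> measurable Tot (count_space {..<t})"
      by (intro measurable_compose[OF measurable_snd] measurable_compose[OF measurable_snd]
          measurable_component_singleton[of "(b, i)" "{..<B} \<times> {..<t}" "\<lambda>_. count_space {..<t}"]) (use b i in simp)
  qed (use coord_meas in auto)
  then show ?thesis
    unfolding boots_def[abs_def] boot_sample_def
    by (intro borel_measurable_diff psi_avg_meas measurable_fst coord_meas)
qed

lemma covered_sets: "covered q \<in> sets Tot"
proof -
  define f where "f x = (\<Sum>b<B. if boots b x < excess x then 1 else 0 :: real)" for x
  have "(\<lambda>x. if boots b x < excess x then 1 else 0 :: real) \<in> borel_measurable Tot" if "b < B" for b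
    using boots_meas[OF that] excess_meas by measurable
  then have [measurable]: "f \<in> borel_measurable Tot"
    unfolding f_def[abs_def] by (intro borel_measurable_sum) auto
  have "real (card {b \<in> {..<B}. boots b x < excess x}) = f x" for x
    unfolding f_def by (simp add: sum.If_cases Int_def)
  then have "covered q = {x \<in> space Tot. \<not> q * B \<le> f x}" unfolding covered_def by simp
  also have "\<dots> \<in> sets Tot" by measurable
  finally show ?thesis .
qed

lemma coverage_iff:
  assumes \<omega>: "\<omega> \<in> space M" and q: "0 < q" "q \<le> 1"
  shows "MSE \<nu> t (\<lambda>i. \<phi> (D \<omega>) (\<xi> i \<omega>)) - mse_inf \<nu> P \<phi> (D \<omega>)
        \<le> emp_quantile B (\<lambda>b. boot_sample \<nu> t (\<lambda>i. \<phi> (D \<omega>) (\<xi> i \<omega>)) (\<lambda>i. J b i \<omega>)) q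
     \<longleftrightarrow> (D \<omega>, (Xi \<omega>, Idx \<omega>)) \<in> covered q"
proof -
  let ?x = "(D \<omega>, (Xi \<omega>, Idx \<omega>))"
  have sp: "?x \<in> space Tot"
    using measurable_space[OF rv(1) \<omega>] measurable_space[OF rv(2) \<omega>] measurable_space[OF rv(3) \<omega>]
    by (simp only: space_pair_measure mem_Times_iff fst_conv snd_conv)
  have avg: "ens_avg t (\<lambda>i. \<phi> (D \<omega>) (\<xi> i \<omega>)) = ens_avg t (\<lambda>i. \<phi> (D \<omega>) (Xi \<omega> i))"
    by (rule ext) (simp add: ens_avg_def Xi_def)
  have e: "MSE \<nu> t (\<lambda>i. \<phi> (D \<omega>) (\<xi> i \<omega>)) - mse_inf \<nu> P \<phi> (D \<omega>) = excess ?x"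
    unfolding excess_def MSE_def fst_conv snd_conv avg ..
  have b: "boot_sample \<nu> t (\<lambda>i. \<phi> (D \<omega>) (\<xi> i \<omega>)) (\<lambda>i. J b i \<omega>) = boots b ?x" if b: "b < B" for b
  proof -
    have "J b i \<omega> < t" if i: "i < t" for i
    proof -
      have "J b i \<in> measurable M (count_space {..<t})"
        using J_indep b i unfolding indep_vars_def by force
      from measurable_space[OF this \<omega>] show ?thesis by simp
    qed
    then have "ens_avg t (\<lambda>i. \<phi> (D \<omega>) (\<xi> (J b i \<omega>) \<omega>)) = ens_avg t (\<lambda>i. \<phi> (D \<omega>) (Xi \<omega> (Idx \<omega> (b, i))))"
      using b by (intro ext) (simp add: ens_avg_def Xi_def Idx_def)
    then show ?thesis unfolding boots_def boot_sample_def fst_conv snd_conv avg by simp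
  qed
  have "{b \<in> {..<B}. boot_sample \<nu> t (\<lambda>i. \<phi> (D \<omega>) (\<xi> i \<omega>)) (\<lambda>i. J b i \<omega>) < excess ?x} = {b \<in> {..<B}. boots b ?x < excess ?x}"
    using b by auto
  then show ?thesis
    unfolding e using less_emp_quantile_iff[OF q, of B] B1 sp by (simp add: covered_def)
qed

lemma cond_prob_eq:
  assumes q: "0 < q" "q \<le> 1"
  shows "AE \<omega> in M. cond_prob_given M TS D
      {\<omega> \<in> space M. MSE \<nu> t (\<lambda>i. \<phi> (D \<omega>) (\<xi> i \<omega>)) - mse_inf \<nu> P \<phi> (D \<omega>)
        \<le> emp_quantile B (\<lambda>b. boot_sample \<nu> t (\<lambda>i. \<phi> (D \<omega>) (\<xi> i \<omega>)) (\<lambda>i. J b i \<omega>)) q} \<omega>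
    = measure Law (Pair (D \<omega>) -` covered q)"
proof -
  have eq: "{\<omega> \<in> space M. MSE \<nu> t (\<lambda>i. \<phi> (D \<omega>) (\<xi> i \<omega>)) - mse_inf \<nu> P \<phi> (D \<omega>)
        \<le> emp_quantile B (\<lambda>b. boot_sample \<nu> t (\<lambda>i. \<phi> (D \<omega>) (\<xi> i \<omega>)) (\<lambda>i. J b i \<omega>)) q}
    = {\<omega> \<in> space M. (D \<omega>, (Xi \<omega>, Idx \<omega>)) \<in> covered q}"
    using coverage_iff[OF _ q] by blast
  interpret P: prob_space P by (rule P_facts)
  interpret X: prob_space "PiM {..<t} (\<lambda>_. P)" by (intro prob_space_PiM P.prob_space_axioms)
  interpret J: prob_space "PiM ({..<B} \<times> {..<t}) (\<lambda>_. Unif)"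
    using t1 by (intro prob_space_PiM prob_space_uniform_lessThan) simp
  interpret XJ: pair_prob_space "PiM {..<t} (\<lambda>_. P)" "PiM ({..<B} \<times> {..<t}) (\<lambda>_. Unif)" ..
  have sets_eq: "sets (PiM {..<t} (\<lambda>_. P)) = sets SR" "sets (PiM ({..<B} \<times> {..<t}) (\<lambda>_. Unif)) = sets SJ"
    by (auto intro!: sets_PiM_cong simp: P_facts sets_uniform_count_measure)
  show ?thesis
    unfolding cond_prob_given_def eq
    by (rule real_cond_exp_indep[OF rv(1) measurable_Pair[OF rv(2,3)] joint_law XJ.prob_space_axioms
          sets_pair_measure_cong[OF sets_eq] covered_sets])
qed

text \<open>Stated for every positive \<open>b\<close> above \<open>beta\<close>. The bound by
  \<open>8 * b\<close> is exported because a sufficiently small \<open>b\<close> would contradict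
  it, which excludes \<open>beta = 0\<close>.\<close>

lemma section_prob_ge:
  assumes d: "d \<in> space TS" and B2: "2 \<le> B" and \<alpha>: "0 < \<alpha>" "\<alpha> < 1" and k: "1 \<le> k"
    and b: "0 < b" "beta \<nu> P \<phi> (3 * k) d \<le> ennreal b" and s: "sigma_D \<nu> P \<phi> d \<noteq> 0"
  shows "1 - \<alpha> - 10^10 * ((real k)\<^sup>2 / sqrt t * (b / sigma_D \<nu> P \<phi> d) ^ 3 + exp (- (real k / 2)) + sqrt (ln B / B))
      \<le> measure Law (Pair d -` covered (1 - \<alpha>))"
    and "0 < sigma_D \<nu> P \<phi> d" "sigma_D \<nu> P \<phi> d \<le> 8 * b"
proof -
  interpret P: prob_space P by (rule P_facts)
  interpret N: prob_space \<nu> by (rule prob_nu)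
  have [measurable_cong]: "sets P = sets R" by (rule P_facts)
  interpret F: fixed_training P \<nu> MX \<phi> d t k b
  proof
    show "(\<lambda>z. \<phi> d (fst z) (snd z)) \<in> borel_measurable (P \<Otimes>\<^sub>M MX)"
      by (rule phi_comp) (use d in measurable)
  qed (use sets_nu t1 k b s in auto)
  show s_pos: "0 < sigma_D \<nu> P \<phi> d" by (rule F.s_pos)
  show "sigma_D \<nu> P \<phi> d \<le> 8 * b" using F.E.ratio_ge s_pos by (simp add: field_simps)
  interpret X: prob_space "PiM {..<t} (\<lambda>_. P)" by (intro prob_space_PiM P.prob_space_axioms)
  interpret J: prob_space "PiM ({..<B} \<times> {..<t}) (\<lambda>_. Unif)"
    using t1 by (intro prob_space_PiM prob_space_uniform_lessThan) simp
  interpret XJ: pair_prob_space "PiM {..<t} (\<lambda>_. P)" "PiM ({..<B} \<times> {..<t}) (\<lambda>_. Unif)" ..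
  have sets_eq: "sets (PiM {..<t} (\<lambda>_. P)) = sets SR" "sets (PiM ({..<B} \<times> {..<t}) (\<lambda>_. Unif)) = sets SJ"
    by (auto intro!: sets_PiM_cong simp: P_facts sets_uniform_count_measure)
  have sets_Law: "sets Law = sets (SR \<Otimes>\<^sub>M SJ)" by (rule sets_pair_measure_cong[OF sets_eq])
  have sec: "Pair d -` covered (1 - \<alpha>) \<in> sets Law"
    unfolding sets_Law by (rule sets_Pair1[OF covered_sets])
  have compl: "{z \<in> space Law. F.miss (1 - \<alpha>) B z} = space Law - Pair d -` covered (1 - \<alpha>)"
  proof -
    have "(d, z) \<in> space Tot" if "z \<in> space Law" for z
      using that d unfolding sets_eq_imp_space_eq[OF sets_Law] space_pair_measure[of TS] by (intro SigmaI)
    then show ?thesis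
      unfolding covered_def F.miss_def boots_def excess_def by auto
  qed
  have "{z \<in> space Law. F.miss (1 - \<alpha>) B z} \<in> sets Law"
    unfolding compl using sec by auto
  then have "XJ.prob {z \<in> space Law. F.miss (1 - \<alpha>) B z}
      \<le> \<alpha> + 10^10 * (F.E.\<eta> + exp (- (real k / 2)) + sqrt (ln B / B))"
    by (rule F.miss_prob_le[OF B2 \<alpha>])
  moreover have "XJ.prob {z \<in> space Law. F.miss (1 - \<alpha>) B z} = 1 - XJ.prob (Pair d -` covered (1 - \<alpha>))"
    unfolding compl by (rule XJ.prob_compl[OF sec])
  ultimately show "1 - \<alpha> - 10^10 * ((real k)\<^sup>2 / sqrt t * (b / sigma_D \<nu> P \<phi> d) ^ 3 + exp (- (real k / 2)) + sqrt (ln B / B))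
      \<le> measure Law (Pair d -` covered (1 - \<alpha>))"
    unfolding F.E.\<eta>_def by linarith
qed

text \<open>For \<sigma> = 0 the left-hand side is -\<infinity>. Otherwise the moment itself may
  serve as \<open>b\<close>, once it is known to be positive.\<close>

lemma coverage_ge_delta:
  assumes d: "d \<in> space TS" and B2: "2 \<le> B" and \<alpha>: "0 < \<alpha>" "\<alpha> < 1" and k: "1 \<le> k"
    and fin: "beta \<nu> P \<phi> (3 * k) d < \<infinity>"
  shows "ereal (1 - \<alpha>) - ereal (10^10) * delta \<nu> P \<phi> t k B d \<le> ereal (measure Law (Pair d -` covered (1 - \<alpha>)))"
proof (cases "sigma_D \<nu> P \<phi> d = 0")
  case True
  then have "delta \<nu> P \<phi> t k B d = \<infinity>" by (simp add: delta_def)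
  then show ?thesis by simp
next
  case False
  define b where "b = enn2real (beta \<nu> P \<phi> (3 * k) d)"
  have beta_b: "beta \<nu> P \<phi> (3 * k) d = ennreal b" and b0: "0 \<le> b"
    using fin by (simp_all add: b_def less_top)
  have s: "0 < sigma_D \<nu> P \<phi> d" and sb: "sigma_D \<nu> P \<phi> d \<le> 8 * c" if "0 < c" "b \<le> c" for c
    using section_prob_ge(2,3)[OF d B2 \<alpha> k, of c] that False beta_b by (simp_all add: ennreal_leI)
  \<comment> \<open>Any positive upper bound of \<open>beta\<close> will do here, while
    \<open>b\<close> itself might still be 0.\<close>
  have sp: "0 < sigma_D \<nu> P \<phi> d" by (rule s[of "b + 1"]) (use b0 in auto)
  have bp: "0 < b"
  proof (rule ccontr)
    assume "\<not> 0 < b"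
    then have "b = 0" using b0 by simp
    \<comment> \<open>With \<open>b = 0\<close> the inequality \<sigma> \<le> 8 c holds for every
      positive c; this choice gives \<sigma> \<le> \<sigma> / 2.\<close>
    then show False using sb[of "sigma_D \<nu> P \<phi> d / 16"] sp by simp
  qed
  have "delta \<nu> P \<phi> t k B d = ereal ((real k)\<^sup>2 / sqrt t * (b / sigma_D \<nu> P \<phi> d) ^ 3 + exp (- (real k / 2)) + sqrt (ln B / B))"
    using False bp sp unfolding delta_def beta_b by (simp add: enn2ereal_ennreal)
  then show ?thesis
    using section_prob_ge(1)[OF d B2 \<alpha> k bp] beta_b False by simp
qed

end

end

text \<open>The bound holds for almost every \<omega>, since a conditional probability is determined
  only up to null sets. The range of B starts at 2: for B = 1 the term sqrt(ln B / B) is 0, although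
  the quantile is then a single bootstrap sample.\<close>

theorem theorem3p1:
  shows "\<exists>c\<^sub>0 > 0.
    \<forall>(M :: 'w measure) (MX :: 'x measure) (\<nu> :: ('x \<times> real) measure)
     (R :: 'r measure) (P :: 'r measure) (n :: nat) (t :: nat)
     (\<phi> :: (nat \<Rightarrow> 'x \<times> real) \<Rightarrow> 'r \<Rightarrow> 'x \<Rightarrow> real)
     (D :: 'w \<Rightarrow> nat \<Rightarrow> 'x \<times> real) (\<xi> :: nat \<Rightarrow> 'w \<Rightarrow> 'r)
     (B :: nat) (J :: nat \<Rightarrow> nat \<Rightarrow> 'w \<Rightarrow> nat) (\<alpha> :: real) (k :: nat).
      bootstrapped_ensemble M MX \<nu> R P n t \<phi> D \<xi> B J \<longrightarrow>
      1 \<le> t \<longrightarrow> 2 \<le> B \<longrightarrow> 0 < \<alpha> \<longrightarrow> \<alpha> < 1 \<longrightarrow> 2 \<le> k \<longrightarrow>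
      (let T = (\<lambda>\<omega> i. \<phi> (D \<omega>) (\<xi> i \<omega>));
           q = (\<lambda>\<omega>. emp_quantile B (\<lambda>b. boot_sample \<nu> t (T \<omega>) (\<lambda>i. J b i \<omega>)) (1 - \<alpha>))
       in AE \<omega> in M. beta \<nu> P \<phi> (3 * k) (D \<omega>) < \<infinity> \<longrightarrow>
            ereal (cond_prob_given M (train_space MX n) D
                     {\<omega>' \<in> space M. MSE \<nu> t (T \<omega>') - mse_inf \<nu> P \<phi> (D \<omega>') \<le> q \<omega>'} \<omega>)
            \<ge> ereal (1 - \<alpha>) - ereal c\<^sub>0 * delta \<nu> P \<phi> t k B (D \<omega>))"
proof (intro exI[of _ "10^10 :: real"] conjI allI impI)
  fix M :: "'w measure" and MX :: "'x measure" and \<nu> :: "('x \<times> real) measure"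
    and R P :: "'r measure" and n t B k :: nat and \<phi> :: "(nat \<Rightarrow> 'x \<times> real) \<Rightarrow> 'r \<Rightarrow> 'x \<Rightarrow> real"
    and D :: "'w \<Rightarrow> nat \<Rightarrow> 'x \<times> real" and \<xi> :: "nat \<Rightarrow> 'w \<Rightarrow> 'r" and J :: "nat \<Rightarrow> nat \<Rightarrow> 'w \<Rightarrow> nat" and \<alpha> :: real
  assume "bootstrapped_ensemble M MX \<nu> R P n t \<phi> D \<xi> B J"
    and *: "1 \<le> t" "2 \<le> B" "0 < \<alpha>" "\<alpha> < 1" "2 \<le> k"
  then interpret bootstrapped_ensemble M MX \<nu> R P n t \<phi> D \<xi> B J by simp
  have B1: "1 \<le> B" and k1: "1 \<le> k" and q: "0 < 1 - \<alpha>" "1 - \<alpha> \<le> 1" using * by simp_all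
  have "AE \<omega> in M. beta \<nu> P \<phi> (3 * k) (D \<omega>) < \<infinity> \<longrightarrow>
      ereal (1 - \<alpha>) - ereal (10^10) * delta \<nu> P \<phi> t k B (D \<omega>) \<le>
      ereal (cond_prob_given M TS D
        {\<omega> \<in> space M. MSE \<nu> t (\<lambda>i. \<phi> (D \<omega>) (\<xi> i \<omega>)) - mse_inf \<nu> P \<phi> (D \<omega>)
          \<le> emp_quantile B (\<lambda>b. boot_sample \<nu> t (\<lambda>i. \<phi> (D \<omega>) (\<xi> i \<omega>)) (\<lambda>i. J b i \<omega>)) (1 - \<alpha>)} \<omega>)"
    using cond_prob_eq[OF *(1) B1 q] AE_space
  proof eventually_elim
    case (elim \<omega>)
    have "D \<omega> \<in> space TS" using measurable_space[OF rv(1)[OF *(1) B1] elim(2)] .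
    then show ?case
      unfolding elim(1) using coverage_ge_delta[OF *(1) B1 _ *(2,3,4) k1] by blast
  qed
  then show "let T = (\<lambda>\<omega> i. \<phi> (D \<omega>) (\<xi> i \<omega>));
           q = (\<lambda>\<omega>. emp_quantile B (\<lambda>b. boot_sample \<nu> t (T \<omega>) (\<lambda>i. J b i \<omega>)) (1 - \<alpha>))
       in AE \<omega> in M. beta \<nu> P \<phi> (3 * k) (D \<omega>) < \<infinity> \<longrightarrow>
            ereal (cond_prob_given M (train_space MX n) D
                     {\<omega>' \<in> space M. MSE \<nu> t (T \<omega>') - mse_inf \<nu> P \<phi> (D \<omega>') \<le> q \<omega>'} \<omega>)
            \<ge> ereal (1 - \<alpha>) - ereal (10^10) * delta \<nu> P \<phi> t k B (D \<omega>)"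
    unfolding Let_def .
qed simp

end
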